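(* (Local efficiency of the edge residual.) There is a constant $C>0$ independent of the mesh size such that for every interior edge $e\in\mathcal E_h^i$, $$h_e^{1/2}\,\|[\![\nabla_wu_h]\!]\|_{L^2(e)}\le C\Big(\|\nabla u-\nabla_wu_h\|_{L^2(\mathcal T_e)}+h_e\,\|\nabla\cdot(\nabla_wu_h)+f-\lambda_h(u_h)\|_{L^2(\mathcal T_e)}+\|\lambda(u)-\lambda_h(u_h)\|_{H^{-1}(\mathcal T_e)}\Big),$$ where $\mathcal T_e$ denotes the patch $T^-\cup T^+$ of the two triangles sharing $e$ (and $\nabla\cdot$ is taken elementwise).
   Context: Continuous problem. $\Omega\subset\mathbb R^2$ is a bounded polygonal domain, assumed convex, with boundary $\Gamma$; $f\in L^2(\Omega)$; $\psi\in H^2(\Omega)$ with $\psi\le 0$ on $\Gamma$; $V=H^1_0(\Omega)$; $\mathcal K=\{v\in V: v\ge\psi \text{ a.e. in }\Omega\}$; $a(w,v)=\int_\Omega\nabla w\cdot\nabla v\,dx$, $L(v)=\int_\Omega fv\,dx$. $u\in\mathcal K$ is the unique solution of $a(u,v-u)\ge L(v-u)$ for all $v\in\mathcal K$. The continuous Lagrange multiplier $\lambda(u)\in H^{-1}(\Omega)$ is $(\lambda(u),v)_{-1,1}=L(v)-a(u,v)$ for $v\in V$, where $(\cdot,\cdot)_{-1,1}$ is the duality pairing of $H^{-1}(\Omega)$ and $H^1_0(\Omega)$. Mesh. $\mathcal T_h$ is a (conforming) triangulation of $\Omega$ from a shape-regular family, $\mathcal E_h$ the set of all edges, $\mathcal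 E_h^i$ the interior edges, $h_e$ the length of $e$. On an interior edge $e$ shared by $T_1,T_2$ with outward unit normals $\boldsymbol n_1=-\boldsymbol n_2$, $\{\!\{w\}\!\}=\frac12(w|_{T_1}+w|_{T_2})$, $[\![w]\!]=w|_{T_1}\boldsymbol n_1+w|_{T_2}\boldsymbol n_2$ for scalar $w$, and $[\![\boldsymbol v]\!]=\boldsymbol v|_{T_1}\cdot\boldsymbol n_1+\boldsymbol v|_{T_2}\cdot\boldsymbol n_2$ for vector-valued $\boldsymbol v$; on a boundary edge $\{\!\{w\}\!\}=w$, $[\![w]\!]=w\boldsymbol n_e$ with $\boldsymbol n_e$ the outward unit normal. Discrete problem. $V_h^{0w}$ is the set of pairs $v_h=(v_h^0,v_h^b)$ with $v_h^0|_T\in\mathbb P_1(T)$ for all $T\in\mathcal T_h$ (no continuity imposed), $v_h^b|_e=\{\!\{v_h^0\}\!\}$ on interior edges, and $v_h^b=0$ on boundary edges. The discrete weak gradient $\nabla_w v_h|_T\in[\mathbb P_0(T)]^2$ is defined by $\int_T\nabla_w v_h\cdot\boldsymbol q\,dx=\int_{\partial T}\{\!\{v_h^0\}\!\}\boldsymbol q\cdot\boldsymbol n\,ds$ for all $\boldsymbol q\in[\mathbb P_0(T)]^2$. Set $a_h(w_h,v_h)=\sum_T\int_T\nabla_w w_h\cdot\nabla_w v_h\,dx+\sum_{e\in\mathcal E_h}\frac1{h_e}\int_e[\![w_h^0]\!]\cdot[\![v_h^0]\!]\,ds$, $L(v_h)=\sum_T\int_T f v_h^0\,dx$, and $\mathcal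 K_h=\{v_h\in V_h^{0w}:\int_T v_h^0\,dx\ge\int_T\psi\,dx\ \forall T\in\mathcal T_h\}$. $u_h\in\mathcal K_h$ is the unique solution of $a_h(u_h,v_h-u_h)\ge L(v_h-u_h)$ for all $v_h\in\mathcal K_h$. Discrete multiplier. $W_h$ is the space of functions that are constant on each $T$; $\pi_h^0v_h|_T=\frac1{|T|}\int_Tv_h^0\,dx$; the right inverse $\pi_h^{-1}:W_h\to V_h^{0w}$ sends $w_h$ to $(w_h,q_h^b)$ with $q_h^b=\{\!\{w_h\}\!\}$ on interior edges and $0$ on boundary edges. $\lambda_h(u_h)\in W_h$ is defined by $(\lambda_h(u_h),w_h)_{L^2(\Omega)}=L(\pi_h^{-1}w_h)-a_h(u_h,\pi_h^{-1}w_h)$ for all $w_h\in W_h$; it acts on $v\in V$ by $(\lambda_h(u_h),v)_{-1,1}=\int_\Omega\lambda_h(u_h)v\,dx$. For a functional on $H^1_0(\Omega)$ and open $D\subset\Omega$, $\|g\|_{H^{-1}(D)}=\sup_{0\ne\xi\in H^1_0(D)}g(\xi)/\|\xi\|_{H^1(D)}$, functions of $H^1_0(D)$ being extended by zero; $H^{-1}(\mathcal T_e)$ refers to $D$ the interior of $T^-\cup T^+$. *)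

theory Defs
  imports "HOL-Analysis.Analysis"
begin

section \<open>Sobolev spaces on planar open sets\<close>

text \<open>
  Elements of Lebesgue and Sobolev spaces are represented by functions on the whole plane of
  which only the values on the domain matter, up to null sets.
\<close>

definition L2 :: "(real^2) set \<Rightarrow> (real^2 \<Rightarrow> 'b::euclidean_space) set" where
  "L2 D = {f. f \<in> borel_measurable (lebesgue_on D) \<and>
              integrable (lebesgue_on D) (\<lambda>x. (norm (f x))\<^sup>2)}"

definition L2_norm :: "(real^2) set \<Rightarrow> (real^2 \<Rightarrow> 'b::euclidean_space) \<Rightarrow> real" where
  "L2_norm D f = sqrt (LINT x|lebesgue_on D. (norm (f x))\<^sup>2)"

definition gradient :: "(real^2 \<Rightarrow> real) \<Rightarrow> real^2 \<Rightarrow> real^2" where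
  "gradient f x = (\<chi> i. frechet_derivative f (at x) (axis i 1))"

primrec C_k :: "nat \<Rightarrow> (real^2 \<Rightarrow> real) \<Rightarrow> bool" where
  "C_k 0 f \<longleftrightarrow> continuous_on UNIV f"
| "C_k (Suc k) f \<longleftrightarrow> (\<forall>x. f differentiable (at x)) \<and> (\<forall>i. C_k k (\<lambda>x. gradient f x $ i))"

definition test_functions :: "(real^2) set \<Rightarrow> (real^2 \<Rightarrow> real) set" where
  "test_functions D = {\<phi>. (\<forall>k. C_k k \<phi>) \<and>
     compact (closure {x. \<phi> x \<noteq> 0}) \<and> closure {x. \<phi> x \<noteq> 0} \<subseteq> D}"

definition has_weak_gradient ::
  "(real^2) set \<Rightarrow> (real^2 \<Rightarrow> real) \<Rightarrow> (real^2 \<Rightarrow> real^2) \<Rightarrow> bool" where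
  "has_weak_gradient D u G \<longleftrightarrow> u \<in> L2 D \<and> G \<in> L2 D \<and>
     (\<forall>\<phi>\<in>test_functions D.
        (LINT x|lebesgue_on D. u x *\<^sub>R gradient \<phi> x) = - (LINT x|lebesgue_on D. \<phi> x *\<^sub>R G x))"

definition H1 :: "(real^2) set \<Rightarrow> (real^2 \<Rightarrow> real) set" where
  "H1 D = {u. \<exists>G. has_weak_gradient D u G}"

text \<open>The weak gradient is unique up to null sets, so the choice is immaterial.\<close>

definition wgrad :: "(real^2) set \<Rightarrow> (real^2 \<Rightarrow> real) \<Rightarrow> real^2 \<Rightarrow> real^2" where
  "wgrad D u = (SOME G. has_weak_gradient D u G)"

definition H1_norm :: "(real^2) set \<Rightarrow> (real^2 \<Rightarrow> real) \<Rightarrow> real" where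
  "H1_norm D u = sqrt ((L2_norm D u)\<^sup>2 + (L2_norm D (wgrad D u))\<^sup>2)"

definition H10 :: "(real^2) set \<Rightarrow> (real^2 \<Rightarrow> real) set" where
  "H10 D = {u \<in> H1 D. \<exists>\<phi>. (\<forall>n::nat. \<phi> n \<in> test_functions D) \<and>
                 (\<lambda>n. H1_norm D (\<lambda>x. u x - \<phi> n x)) \<longlonglongrightarrow> 0}"

definition H2 :: "(real^2) set \<Rightarrow> (real^2 \<Rightarrow> real) set" where
  "H2 D = {u \<in> H1 D. \<forall>i. (\<lambda>x. wgrad D u x $ i) \<in> H1 D}"

text \<open>
  On a convex polygonal domain a function of H2 has a unique representative that is continuous
  up to the boundary; its boundary values are the trace.
\<close>

definition nonpos_on_boundary :: "(real^2) set \<Rightarrow> (real^2 \<Rightarrow> real) \<Rightarrow> bool" where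
  "nonpos_on_boundary D u \<longleftrightarrow> (\<exists>g. continuous_on (closure D) g \<and>
     (AE x in lebesgue_on D. u x = g x) \<and> (\<forall>x\<in>frontier D. g x \<le> 0))"

text \<open>
  Dual norm on \<open>D\<close> of a functional on H10 of a larger domain.  The supremum is one of real
  numbers, hence meaningful for functionals that are bounded on H10 of \<open>D\<close>.
\<close>

definition zero_ext :: "(real^2) set \<Rightarrow> (real^2 \<Rightarrow> real) \<Rightarrow> real^2 \<Rightarrow> real" where
  "zero_ext D \<xi> x = (if x \<in> D then \<xi> x else 0)"

definition Hm1_norm :: "(real^2) set \<Rightarrow> ((real^2 \<Rightarrow> real) \<Rightarrow> real) \<Rightarrow> real" where
  "Hm1_norm D g =
     (SUP \<xi>\<in>{\<xi> \<in> H10 D. \<not> (AE x in lebesgue_on D. \<xi> x = 0)}. g (zero_ext D \<xi>) / H1_norm D \<xi>)"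

section \<open>The obstacle problem\<close>

definition convex_polygonal_domain :: "(real^2) set \<Rightarrow> bool" where
  "convex_polygonal_domain \<Omega> \<longleftrightarrow> open \<Omega> \<and> \<Omega> \<noteq> {} \<and> convex \<Omega> \<and> polytope (closure \<Omega>)"

definition a_form :: "(real^2) set \<Rightarrow> (real^2 \<Rightarrow> real) \<Rightarrow> (real^2 \<Rightarrow> real) \<Rightarrow> real" where
  "a_form \<Omega> w v = (LINT x|lebesgue_on \<Omega>. wgrad \<Omega> w x \<bullet> wgrad \<Omega> v x)"

definition load :: "(real^2) set \<Rightarrow> (real^2 \<Rightarrow> real) \<Rightarrow> (real^2 \<Rightarrow> real) \<Rightarrow> real" where
  "load \<Omega> f v = (LINT x|lebesgue_on \<Omega>. f x * v x)"

definition obstacle_set :: "(real^2) set \<Rightarrow> (real^2 \<Rightarrow> real) \<Rightarrow> (real^2 \<Rightarrow> real) set" where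
  "obstacle_set \<Omega> \<psi> = {v \<in> H10 \<Omega>. AE x in lebesgue_on \<Omega>. v x \<ge> \<psi> x}"

definition obstacle_solution ::
  "(real^2) set \<Rightarrow> (real^2 \<Rightarrow> real) \<Rightarrow> (real^2 \<Rightarrow> real) \<Rightarrow> (real^2 \<Rightarrow> real) \<Rightarrow> bool" where
  "obstacle_solution \<Omega> f \<psi> u \<longleftrightarrow> u \<in> obstacle_set \<Omega> \<psi> \<and>
     (\<forall>v\<in>obstacle_set \<Omega> \<psi>. a_form \<Omega> u (\<lambda>x. v x - u x) \<ge> load \<Omega> f (\<lambda>x. v x - u x))"

definition multiplier ::
  "(real^2) set \<Rightarrow> (real^2 \<Rightarrow> real) \<Rightarrow> (real^2 \<Rightarrow> real) \<Rightarrow> (real^2 \<Rightarrow> real) \<Rightarrow> real" where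
  "multiplier \<Omega> f u v = load \<Omega> f v - a_form \<Omega> u v"

section \<open>Triangulations\<close>

text \<open>
  Triangles and edges are closed sets; \<^const>\<open>triangulation\<close> provides finiteness and conformity.
\<close>

definition mesh_of :: "(real^2) set \<Rightarrow> (real^2) set set \<Rightarrow> bool" where
  "mesh_of \<Omega> \<T> \<longleftrightarrow> triangulation \<T> \<and> (\<forall>T\<in>\<T>. 2 simplex T) \<and> \<Union>\<T> = closure \<Omega>"

definition inball_diameter :: "(real^2) set \<Rightarrow> real" where
  "inball_diameter T = (SUP r\<in>{r. 0 \<le> r \<and> (\<exists>x. cball x r \<subseteq> T)}. 2 * r)"

definition shape_regular :: "(real^2) set set set \<Rightarrow> bool" where
  "shape_regular \<TT> \<longleftrightarrow> (\<exists>\<sigma>. \<forall>\<T>\<in>\<TT>. \<forall>T\<in>\<T>. diameter T \<le> \<sigma> * inball_diameter T)"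

definition edges :: "(real^2) set set \<Rightarrow> (real^2) set set" where
  "edges \<T> = {e. \<exists>T\<in>\<T>. e edge_of T}"

definition patch :: "(real^2) set set \<Rightarrow> (real^2) set \<Rightarrow> (real^2) set set" where
  "patch \<T> e = {T \<in> \<T>. e edge_of T}"

definition interior_edges :: "(real^2) set set \<Rightarrow> (real^2) set set" where
  "interior_edges \<T> = {e \<in> edges \<T>. card (patch \<T> e) = 2}"

definition outward_normal :: "(real^2) set \<Rightarrow> (real^2) set \<Rightarrow> real^2" where
  "outward_normal T e = (THE n. norm n = 1 \<and> (\<forall>x\<in>e. \<forall>y\<in>T. n \<bullet> (y - x) \<le> 0))"

text \<open>
  Arc length integral over a segment; reversing the chosen parametrisation does not change it.
  The length of an edge is its diameter.
\<close>

definition edge_integral :: "(real^2) set \<Rightarrow> (real^2 \<Rightarrow> real) \<Rightarrow> real" where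
  "edge_integral e g =
     (let (a, b) = (SOME (a, b). e = closed_segment a b)
      in dist a b * (LINT t|lebesgue_on {0..1}. g (linepath a b t)))"

section \<open>Broken functions, averages and jumps\<close>

text \<open>
  A function that may be discontinuous across edges is a family of functions, one for each
  triangle \<open>T\<close>, of which only the values on \<open>T\<close> matter.
\<close>

type_synonym 'b broken = "(real^2) set \<Rightarrow> real^2 \<Rightarrow> 'b"

text \<open>
  An edge belongs to two triangles if it is interior and to one if it lies on the boundary, so
  that the following sums cover both cases.
\<close>

definition avg :: "(real^2) set set \<Rightarrow> (real^2) set \<Rightarrow> real broken \<Rightarrow> real^2 \<Rightarrow> real" where
  "avg \<T> e w x = (\<Sum>T\<in>patch \<T> e. w T x) / real (card (patch \<T> e))"

definition jump :: "(real^2) set set \<Rightarrow> (real^2) set \<Rightarrow> real broken \<Rightarrow> real^2 \<Rightarrow> real^2" where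
  "jump \<T> e w x = (\<Sum>T\<in>patch \<T> e. w T x *\<^sub>R outward_normal T e)"

definition vjump :: "(real^2) set set \<Rightarrow> (real^2) set \<Rightarrow> (real^2) broken \<Rightarrow> real^2 \<Rightarrow> real" where
  "vjump \<T> e w x = (\<Sum>T\<in>patch \<T> e. w T x \<bullet> outward_normal T e)"

definition broken_L2_norm :: "(real^2) set set \<Rightarrow> 'b::euclidean_space broken \<Rightarrow> real" where
  "broken_L2_norm \<S> w = sqrt (\<Sum>T\<in>\<S>. LINT x|lebesgue_on T. (norm (w T x))\<^sup>2)"

definition edge_L2_norm :: "(real^2) set \<Rightarrow> (real^2 \<Rightarrow> real) \<Rightarrow> real" where
  "edge_L2_norm e g = sqrt (edge_integral e (\<lambda>x. (g x)\<^sup>2))"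

definition divergence :: "(real^2 \<Rightarrow> real^2) \<Rightarrow> real^2 \<Rightarrow> real" where
  "divergence F x = (\<Sum>i\<in>UNIV. frechet_derivative F (at x) (axis i 1) $ i)"

section \<open>The discrete problem\<close>

text \<open>A weak function: a broken function together with a function on each edge.\<close>

type_synonym weak_fun = "real broken \<times> real broken"

definition Vh0 :: "(real^2) set set \<Rightarrow> weak_fun set" where
  "Vh0 \<T> = {v.
     (\<forall>T\<in>\<T>. \<exists>a b. \<forall>x\<in>T. fst v T x = a + b \<bullet> x) \<and>
     (\<forall>e\<in>interior_edges \<T>. \<forall>x\<in>e. snd v e x = avg \<T> e (fst v) x) \<and>
     (\<forall>e\<in>edges \<T> - interior_edges \<T>. \<forall>x\<in>e. snd v e x = 0)}"

text \<open>
  The average on a boundary edge is the one-sided value, not the boundary component (zero) of the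
  weak function.
\<close>

definition discrete_wgrad :: "(real^2) set set \<Rightarrow> weak_fun \<Rightarrow> (real^2) broken" where
  "discrete_wgrad \<T> v T x = (THE g. \<forall>q. (LINT y|lebesgue_on T. g \<bullet> q) =
     (\<Sum>e | e edge_of T. edge_integral e (\<lambda>y. avg \<T> e (fst v) y * (q \<bullet> outward_normal T e))))"

definition ah_form :: "(real^2) set set \<Rightarrow> weak_fun \<Rightarrow> weak_fun \<Rightarrow> real" where
  "ah_form \<T> w v =
     (\<Sum>T\<in>\<T>. LINT x|lebesgue_on T. discrete_wgrad \<T> w T x \<bullet> discrete_wgrad \<T> v T x) +
     (\<Sum>e\<in>edges \<T>. 1 / diameter e *
        edge_integral e (\<lambda>x. jump \<T> e (fst w) x \<bullet> jump \<T> e (fst v) x))"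

definition broken_inner :: "(real^2) set set \<Rightarrow> real broken \<Rightarrow> real broken \<Rightarrow> real" where
  "broken_inner \<T> w v = (\<Sum>T\<in>\<T>. LINT x|lebesgue_on T. w T x * v T x)"

definition loadh :: "(real^2) set set \<Rightarrow> (real^2 \<Rightarrow> real) \<Rightarrow> weak_fun \<Rightarrow> real" where
  "loadh \<T> f v = broken_inner \<T> (\<lambda>T. f) (fst v)"

definition Kh :: "(real^2) set set \<Rightarrow> (real^2 \<Rightarrow> real) \<Rightarrow> weak_fun set" where
  "Kh \<T> \<psi> = {v \<in> Vh0 \<T>. \<forall>T\<in>\<T>. (LINT x|lebesgue_on T. fst v T x) \<ge> (LINT x|lebesgue_on T. \<psi> x)}"

definition discrete_solution ::
  "(real^2) set set \<Rightarrow> (real^2 \<Rightarrow> real) \<Rightarrow> (real^2 \<Rightarrow> real) \<Rightarrow> weak_fun \<Rightarrow> bool" where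
  "discrete_solution \<T> f \<psi> uh \<longleftrightarrow> uh \<in> Kh \<T> \<psi> \<and>
     (\<forall>vh\<in>Kh \<T> \<psi>. ah_form \<T> uh (vh - uh) \<ge> loadh \<T> f (vh - uh))"

definition Wh :: "(real^2) set set \<Rightarrow> real broken set" where
  "Wh \<T> = {w. \<forall>T\<in>\<T>. \<exists>c. \<forall>x\<in>T. w T x = c}"

definition pi_inv :: "(real^2) set set \<Rightarrow> real broken \<Rightarrow> weak_fun" where
  "pi_inv \<T> w = (w, \<lambda>e x. if e \<in> interior_edges \<T> then avg \<T> e w x else 0)"

text \<open>Characterises \<open>lh\<close> uniquely as an element of \<^const>\<open>Wh\<close>.\<close>

definition discrete_multiplier ::
  "(real^2) set set \<Rightarrow> (real^2 \<Rightarrow> real) \<Rightarrow> weak_fun \<Rightarrow> real broken \<Rightarrow> bool" where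
  "discrete_multiplier \<T> f uh lh \<longleftrightarrow> lh \<in> Wh \<T> \<and>
     (\<forall>w\<in>Wh \<T>. broken_inner \<T> lh w = loadh \<T> f (pi_inv \<T> w) - ah_form \<T> uh (pi_inv \<T> w))"

end

theory Submission
  imports Defs
begin

text \<open>
  The proof tests the residual with a smooth bump at the midpoint of the edge.

  Let \<open>e\<close> be an interior edge of length \<open>h\<close> with adjacent triangles \<open>T1\<close>, \<open>T2\<close>, and let \<open>G\<close> be the discrete
  weak gradient, a constant vector on each triangle.  The jump of \<open>G\<close> is then a constant \<open>J\<close>, and the
  left-hand side equals \<open>h \<bar>J\<bar>\<close>.  Shape regularity provides a disc about the midpoint of \<open>e\<close>, of radius
  \<open>r\<close> proportional to \<open>h\<close>, whose two halves lie in \<open>T1\<close> and \<open>T2\<close> (\<open>interior_edge_geometry\<close>).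
  Let \<open>\<phi>\<close> be a radial smooth bump supported in this disc.  Multiplying \<open>grad \<phi>\<close> by \<open>G\<close> and integrating
  over the patch gives \<open>\<kappa> r J\<close> with an absolute constant \<open>\<kappa> > 0\<close>, because on each half of the disc the
  integral of \<open>grad \<phi>\<close> is normal to \<open>e\<close> by reflection symmetry and scales with \<open>r\<close>
  (\<open>half_bump_integral\<close>).  The definition of the continuous multiplier turns the same quantity into
  \<open>\<integral> (f - \<lambda>\<^sub>h) \<phi> - \<integral> (grad u - G) \<bullet> grad \<phi> - (\<lambda>(u) - \<lambda>\<^sub>h, \<phi>)\<close>,
  and the Cauchy-Schwarz inequality together with \<open>\<bar>\<phi>\<bar> \<le> 1\<close> and \<open>\<bar>grad \<phi>\<bar> \<le> 4 / r\<close> bounds the three terms by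
  \<open>r\<close> times the element residual, the gradient error and the dual norm (\<open>edge_jump_bound\<close>).  Since \<open>G\<close>
  is constant on triangles, its elementwise divergence vanishes.

  The bump supported in a disc takes the place of the usual edge bubble: the boundary terms of an
  integration by parts on the triangles become integrals over half-discs, which a similarity
  reduces to one fixed integral.

  Two points concern the function spaces.  The weak gradient is a choice, so it has to be unique
  almost everywhere (\<open>weak_gradient_unique\<close>); and the supremum in the dual norm has to be finite, which
  requires that functions of \<open>H10\<close> on the patch, extended by zero, belong to \<open>H1\<close> on the whole domain
  with equal norms (\<open>zero_ext_H1\<close>, \<open>residual_bounded\<close>).
\<close>

section \<open>Gradients\<close>

lemma gradient_eqI:
  assumes "GDERIV f x :> D"
  shows "gradient f x = D"
proof -
  have "frechet_derivative f (at x) = (\<lambda>h. h \<bullet> D)"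
    using assms frechet_derivative_at unfolding gderiv_def by metis
  then show ?thesis
    by (simp add: gradient_def vec_eq_iff inner_axis')
qed

lemma GDERIV_gradient:
  assumes "f differentiable (at x)"
  shows "GDERIV f x :> gradient f x"
proof -
  let ?f' = "frechet_derivative f (at x)"
  have d: "(f has_derivative ?f') (at x)"
    using assms frechet_derivative_works by blast
  then interpret linear ?f' by (rule has_derivative_linear)
  have "?f' h = h \<bullet> gradient f x" for h
  proof -
    have "?f' h = ?f' (\<Sum>i\<in>UNIV. (h $ i) *\<^sub>R axis i 1)"
      by (simp add: basis_expansion flip: scalar_mult_eq_scaleR)
    also have "\<dots> = h \<bullet> gradient f x"
      by (simp add: sum scale gradient_def inner_vec_def)
    finally show ?thesis .
  qed
  then have "?f' = (\<lambda>h. h \<bullet> gradient f x)" by auto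
  then show ?thesis using d unfolding gderiv_def by metis
qed

lemma GDERIV_imp_differentiable: "GDERIV f x :> D \<Longrightarrow> f differentiable (at x)"
  unfolding gderiv_def differentiable_def by blast

section \<open>Smooth bump functions\<close>

text \<open>
  The family \<open>exp (-1/t) / t ^ n\<close>, extended by zero to \<open>t \<le> 0\<close>.  The powers of \<open>1/t\<close> are part of it
  because differentiation then leads to linear combinations of members of the family.
\<close>

definition flat :: "nat \<Rightarrow> real \<Rightarrow> real" where
  "flat n t = (if t > 0 then exp (- inverse t) * inverse t ^ n else 0)"

lemma flat_tendsto_0: "(flat n \<longlongrightarrow> 0) (at 0)"
proof -
  have "((\<lambda>t. inverse t ^ n / exp (inverse t)) \<longlongrightarrow> (0::real)) (at_right 0)"
    by (rule filterlim_compose[OF tendsto_power_div_exp_0 filterlim_inverse_at_top_right])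
  then have "(flat n \<longlongrightarrow> 0) (at_right 0)"
  proof (rule Lim_transform_eventually)
    have "\<forall>\<^sub>F t::real in at_right 0. t > 0"
      by (simp add: eventually_at_right_less)
    then show "\<forall>\<^sub>F t in at_right 0. inverse t ^ n / exp (inverse t) = flat n t"
      by eventually_elim (simp add: flat_def exp_minus divide_inverse del: power_inverse)
  qed
  moreover have "(flat n \<longlongrightarrow> 0) (at_left 0)"
  proof (rule Lim_transform_eventually)
    show "((\<lambda>t. 0) \<longlongrightarrow> (0::real)) (at_left (0::real))" by simp
    show "\<forall>\<^sub>F t in at_left 0. 0 = flat n t"
      by (auto simp: flat_def eventually_at_filter)
  qed
  ultimately show ?thesis
    using filterlim_at_split by blast
qed

lemma flat_DERIV:
  "DERIV (flat n) t :> flat (n + 2) t - real n * flat (n + 1) t"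
proof -
  consider "t > 0" | "t < 0" | "t = 0" by linarith
  then show ?thesis
  proof cases
    case 1
    let ?s = "inverse t"
    have "DERIV (\<lambda>s. exp (- s) * s ^ n) ?s :> exp (- ?s) * (real n * ?s ^ (n - 1)) - exp (- ?s) * ?s ^ n"
      by (auto intro!: derivative_eq_intros)
    from DERIV_chain2[OF this DERIV_inverse[of t]] 1
    have "DERIV (\<lambda>t. exp (- inverse t) * inverse t ^ n) t :>
        (exp (- ?s) * (real n * ?s ^ (n - 1)) - exp (- ?s) * ?s ^ n) * - (?s\<^sup>2)"
      by (simp add: power2_eq_square)
    moreover have "(exp (- ?s) * (real n * ?s ^ (n - 1)) - exp (- ?s) * ?s ^ n) * - (?s\<^sup>2)
        = flat (n + 2) t - real n * flat (n + 1) t"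
      using 1 by (cases n) (simp_all add: flat_def algebra_simps power2_eq_square del: power_inverse)
    ultimately have "DERIV (\<lambda>t. exp (- inverse t) * inverse t ^ n) t :> flat (n + 2) t - real n * flat (n + 1) t"
      by simp
    moreover have "\<forall>\<^sub>F s in nhds t. exp (- inverse s) * inverse s ^ n = flat n s"
      using eventually_nhds_in_open[of "{0<..}" t] 1
      by (auto simp: flat_def elim!: eventually_mono)
    ultimately show ?thesis
      by (subst (asm) DERIV_cong_ev[OF refl _ refl])
  next
    case 2
    have "DERIV (\<lambda>t::real. 0::real) t :> flat (n + 2) t - real n * flat (n + 1) t"
      using 2 by (auto simp: flat_def)
    moreover have "\<forall>\<^sub>F s in nhds t. 0 = flat n s"
      using eventually_nhds_in_open[of "{..<0}" t] 2
      by (auto simp: flat_def elim!: eventually_mono)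
    ultimately show ?thesis
      by (subst (asm) DERIV_cong_ev[OF refl _ refl])
  next
    case 3
    have "((\<lambda>h. (flat n (0 + h) - flat n 0) / h) \<longlongrightarrow> 0) (at 0)"
    proof (rule Lim_transform_eventually[OF flat_tendsto_0[of "Suc n"]])
      show "\<forall>\<^sub>F h in at 0. flat (Suc n) h = (flat n (0 + h) - flat n 0) / h"
        by (auto simp: flat_def eventually_at_filter divide_inverse mult_ac)
    qed
    then show ?thesis
      using 3 by (simp add: DERIV_def flat_def)
  qed
qed

lemma flat_nonneg: "0 \<le> flat n t"
  by (simp add: flat_def)

lemma flat_0_less_1: "flat 0 t < 1"
  by (simp add: flat_def)

text \<open>
  The inequality \<open>s\<^sup>2 / 2 \<le> exp s\<close> at \<open>s = 1/t\<close>; it yields the bound on the gradient of a bump.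
\<close>

lemma flat_2_le: "flat 2 t \<le> 2"
proof (cases "t > 0")
  case True
  let ?s = "inverse t"
  have "?s\<^sup>2 / 2 \<le> 1 + ?s + ?s\<^sup>2 / 2" using True by simp
  also have "\<dots> \<le> exp ?s"
    using exp_lower_Taylor_quadratic[of ?s] True by simp
  finally have "exp (- ?s) * (?s\<^sup>2 / 2) \<le> exp (- ?s) * exp ?s"
    by (intro mult_left_mono) auto
  also have "\<dots> = 1" by (simp flip: exp_add)
  finally show ?thesis using True by (simp add: flat_def del: power_inverse)
qed (simp add: flat_def)

text \<open>
  The algebra generated by coordinates and compositions with the flat functions.  It contains the
  partial derivatives of its elements, hence consists of functions with derivatives of all orders;
  the test functions constructed below are exhibited as elements of it.
\<close>

inductive_set smooth_alg :: "(real^2 \<Rightarrow> real) set" where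
  const: "(\<lambda>x. c) \<in> smooth_alg"
| coord: "(\<lambda>x. x $ i) \<in> smooth_alg"
| flat: "g \<in> smooth_alg \<Longrightarrow> (\<lambda>x. flat n (g x)) \<in> smooth_alg"
| add: "f \<in> smooth_alg \<Longrightarrow> g \<in> smooth_alg \<Longrightarrow> (\<lambda>x. f x + g x) \<in> smooth_alg"
| mult: "f \<in> smooth_alg \<Longrightarrow> g \<in> smooth_alg \<Longrightarrow> (\<lambda>x. f x * g x) \<in> smooth_alg"

lemma smooth_alg_GDERIV:
  assumes "f \<in> smooth_alg"
  shows "\<exists>G. (\<forall>x. GDERIV f x :> G x) \<and> (\<forall>i. (\<lambda>x. G x $ i) \<in> smooth_alg)"
  using assms
proof induction
  case (const c)
  show ?case
    by (intro exI[of _ "\<lambda>x. 0"]) (auto intro: smooth_alg.const simp: gderiv_def)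
next
  case (coord i)
  have "GDERIV (\<lambda>x::real^2. x $ i) x :> axis i 1" for x
    unfolding gderiv_def
    by (simp add: inner_axis bounded_linear_vec_nth bounded_linear_imp_has_derivative)
  then show ?case
    by (intro exI[of _ "\<lambda>x. axis i 1"]) (auto intro: smooth_alg.const)
next
  case (flat g n)
  then obtain G where G: "\<And>x. GDERIV g x :> G x" "\<And>i. (\<lambda>x. G x $ i) \<in> smooth_alg" by blast
  let ?H = "\<lambda>x. (flat (n + 2) (g x) + (- real n) * flat (n + 1) (g x)) *\<^sub>R G x"
  have "GDERIV (\<lambda>x. flat n (g x)) x :> ?H x" for x
    using GDERIV_DERIV_compose[OF G(1) flat_DERIV[of n]] by simp
  moreover have "(\<lambda>x. ?H x $ i) \<in> smooth_alg" for i
    unfolding vector_scaleR_component real_scaleR_def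
    by (intro smooth_alg.mult smooth_alg.add smooth_alg.const smooth_alg.flat G flat)
  ultimately show ?case by (intro exI[of _ ?H]) auto
next
  case (add f g)
  then obtain F G where "\<And>x. GDERIV f x :> F x" "\<And>i. (\<lambda>x. F x $ i) \<in> smooth_alg"
      "\<And>x. GDERIV g x :> G x" "\<And>i. (\<lambda>x. G x $ i) \<in> smooth_alg" by blast
  then show ?case
    by (intro exI[of _ "\<lambda>x. F x + G x"]) (auto intro: smooth_alg.add GDERIV_add)
next
  case (mult f g)
  then obtain F G where FG: "\<And>x. GDERIV f x :> F x" "\<And>i. (\<lambda>x. F x $ i) \<in> smooth_alg"
      "\<And>x. GDERIV g x :> G x" "\<And>i. (\<lambda>x. G x $ i) \<in> smooth_alg" by blast
  let ?H = "\<lambda>x. f x *\<^sub>R G x + g x *\<^sub>R F x"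
  have "(\<lambda>x. ?H x $ i) \<in> smooth_alg" for i
    unfolding vector_scaleR_component vector_add_component real_scaleR_def
    by (intro smooth_alg.mult smooth_alg.add FG mult)
  then show ?case
    using FG by (intro exI[of _ ?H]) (auto intro: GDERIV_mult)
qed

lemma smooth_alg_C_k: "f \<in> smooth_alg \<Longrightarrow> C_k k f"
proof (induction k arbitrary: f)
  case 0
  then obtain G where "\<And>x. GDERIV f x :> G x" using smooth_alg_GDERIV by blast
  then have "f differentiable (at x)" for x by (rule GDERIV_imp_differentiable)
  then show ?case
    by (auto simp: continuous_on_eq_continuous_at differentiable_imp_continuous_within)
next
  case (Suc k)
  then obtain G where G: "\<And>x. GDERIV f x :> G x" "\<And>i. (\<lambda>x. G x $ i) \<in> smooth_alg"
    using smooth_alg_GDERIV by blast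
  have "gradient f = G" using G(1) gradient_eqI by blast
  then show ?case using Suc.IH G by (auto intro: GDERIV_imp_differentiable)
qed

lemma smooth_alg_diff: "f \<in> smooth_alg \<Longrightarrow> g \<in> smooth_alg \<Longrightarrow> (\<lambda>x. f x - g x) \<in> smooth_alg"
  using smooth_alg.add[OF _ smooth_alg.mult[OF smooth_alg.const[of "-1"]], of f g] by simp

lemma smooth_alg_sum: "(\<And>i. i \<in> I \<Longrightarrow> f i \<in> smooth_alg) \<Longrightarrow> (\<lambda>x. \<Sum>i\<in>I. f i x) \<in> smooth_alg"
  by (induction I rule: infinite_finite_induct) (auto intro: smooth_alg.add smooth_alg.const)

lemma smooth_alg_prod: "(\<And>i. i \<in> I \<Longrightarrow> f i \<in> smooth_alg) \<Longrightarrow> (\<lambda>x. \<Prod>i\<in>I. f i x) \<in> smooth_alg"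
  by (induction I rule: infinite_finite_induct) (auto intro: smooth_alg.mult smooth_alg.const)

lemma smooth_alg_power: "f \<in> smooth_alg \<Longrightarrow> (\<lambda>x. f x ^ n) \<in> smooth_alg"
  by (induction n) (auto intro: smooth_alg.mult smooth_alg.const)

definition bump :: "real^2 \<Rightarrow> real \<Rightarrow> real^2 \<Rightarrow> real" where
  "bump m r x = flat 0 (1 - (norm (x - m))\<^sup>2 / r\<^sup>2)"

lemma bump_smooth: "bump m r \<in> smooth_alg"
proof -
  have "(\<lambda>x. (x $ i - m $ i)\<^sup>2) \<in> smooth_alg" for i
    using smooth_alg_power[OF smooth_alg_diff[OF smooth_alg.coord smooth_alg.const], of i "m $ i" 2] .
  from smooth_alg_sum[of UNIV, OF this]
  have "(\<lambda>x. \<Sum>i\<in>UNIV. (x $ i - m $ i)\<^sup>2) \<in> smooth_alg" .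
  from smooth_alg_diff[OF smooth_alg.const[of 1] smooth_alg.mult[OF this smooth_alg.const[of "1 / r\<^sup>2"]]]
  have "(\<lambda>x. 1 - (\<Sum>i\<in>UNIV. (x $ i - m $ i)\<^sup>2) * (1 / r\<^sup>2)) \<in> smooth_alg" .
  from smooth_alg.flat[OF this, of 0]
  have "(\<lambda>x. flat 0 (1 - (\<Sum>i\<in>UNIV. (x $ i - m $ i)\<^sup>2) * (1 / r\<^sup>2))) \<in> smooth_alg" .
  moreover have "bump m r = (\<lambda>x. flat 0 (1 - (\<Sum>i\<in>UNIV. (x $ i - m $ i)\<^sup>2) * (1 / r\<^sup>2)))"
    by (simp add: bump_def fun_eq_iff norm_vec_def L2_set_def sum_nonneg)
  ultimately show ?thesis by simp
qed

lemma bump_bounds: "0 \<le> bump m r x" "bump m r x < 1"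
  by (simp_all add: bump_def flat_nonneg flat_0_less_1)

lemma norm_sq_less:
  fixes y :: "'a::real_normed_vector"
  shows "r > 0 \<Longrightarrow> (norm y)\<^sup>2 < r\<^sup>2 \<longleftrightarrow> norm y < r"
  using power_mono_iff[of r "norm y" 2] by (simp add: linorder_not_le[symmetric])

lemma bump_support: "r > 0 \<Longrightarrow> {x. bump m r x \<noteq> 0} = ball m r"
  by (auto simp: bump_def flat_def dist_norm norm_minus_commute norm_sq_less)

lemma test_functionsI:
  assumes "f \<in> smooth_alg" "compact K" "K \<subseteq> D" "\<And>x. x \<notin> K \<Longrightarrow> f x = 0"
  shows "f \<in> test_functions D"
proof -
  have "closure {x. f x \<noteq> 0} \<subseteq> K"
    using assms by (intro closure_minimal) (auto intro: compact_imp_closed)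
  moreover from this have "compact (closure {x. f x \<noteq> 0})"
    using \<open>compact K\<close> by (metis closed_closure compact_Int_closed inf.absorb_iff2)
  ultimately show ?thesis
    using assms smooth_alg_C_k by (auto simp: test_functions_def)
qed

lemma bump_test_function:
  assumes "r > 0" "cball m r \<subseteq> D"
  shows "bump m r \<in> test_functions D"
  by (rule test_functionsI[OF bump_smooth compact_cball assms(2)])
    (use bump_support[OF assms(1), of m] ball_subset_cball in blast)

lemma bump_gradient:
  assumes "r > 0"
  shows "gradient (bump m r) x
    = flat 2 (1 - (norm (x - m))\<^sup>2 / r\<^sup>2) *\<^sub>R (- (2 / r\<^sup>2) *\<^sub>R (x - m))"
proof -
  have *: "GDERIV (\<lambda>x. 1 - c * ((x - m) \<bullet> (x - m))) x :> (- (2 * c) *\<^sub>R (x - m))" for c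
    unfolding gderiv_def
    by (auto intro!: derivative_eq_intros simp: inner_commute inner_diff_left inner_diff_right algebra_simps)
  have "GDERIV (\<lambda>x. 1 - (norm (x - m))\<^sup>2 / r\<^sup>2) x :> (- (2 / r\<^sup>2) *\<^sub>R (x - m))"
    using *[of "1 / r\<^sup>2"] by (simp add: power2_norm_eq_inner)
  from GDERIV_DERIV_compose[OF this flat_DERIV[of 0]]
  show ?thesis
    unfolding bump_def[abs_def] by (intro gradient_eqI) (simp add: numeral_2_eq_2)
qed

lemma bump_gradient_bound:
  assumes "r > 0"
  shows "norm (gradient (bump m r) x) \<le> 4 / r"
proof (cases "norm (x - m) < r")
  case True
  have "norm (gradient (bump m r) x) = flat 2 (1 - (norm (x - m))\<^sup>2 / r\<^sup>2) * (2 / r\<^sup>2 * norm (x - m))"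
    by (simp add: bump_gradient[OF assms] flat_nonneg)
  also have "\<dots> \<le> 2 * (2 / r\<^sup>2 * r)"
    using True assms by (intro mult_mono flat_2_le) (auto intro!: divide_right_mono)
  also have "\<dots> = 4 / r" using assms by (simp add: power2_eq_square)
  finally show ?thesis .
next
  case False
  then show ?thesis using assms norm_sq_less[of r "x - m"]
    by (simp add: bump_gradient flat_def)
qed

lemma bump_gradient_outside:
  assumes "r > 0" "x \<notin> ball m r"
  shows "gradient (bump m r) x = 0"
  using assms norm_sq_less[of r "x - m"]
  by (simp add: bump_gradient flat_def dist_norm norm_minus_commute)

section \<open>Square integrable functions\<close>

lemma integral_if_subset:
  fixes F :: "real^2 \<Rightarrow> 'b::euclidean_space"
  assumes "D \<subseteq> \<Omega>" "D \<in> sets lebesgue" "\<Omega> \<in> sets lebesgue"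
  shows "(LINT x|lebesgue_on \<Omega>. (if x \<in> D then F x else 0)) = (LINT x|lebesgue_on D. F x)"
proof -
  have "(LINT x|lebesgue_on \<Omega>. (if x \<in> D then F x else 0))
      = (LINT x|lebesgue. (if x \<in> \<Omega> then (if x \<in> D then F x else 0) else 0))"
    by (rule Lebesgue_Measure.integral_restrict_UNIV[symmetric]) fact
  also have "\<dots> = (LINT x|lebesgue. (if x \<in> D then F x else 0))"
    using assms(1) by (intro Bochner_Integration.integral_cong) auto
  also have "\<dots> = (LINT x|lebesgue_on D. F x)"
    by (rule Lebesgue_Measure.integral_restrict_UNIV) fact
  finally show ?thesis .
qed

lemma integrable_if_subset:
  fixes F :: "real^2 \<Rightarrow> 'b::euclidean_space"
  assumes "D \<subseteq> \<Omega>" "D \<in> sets lebesgue" "\<Omega> \<in> sets lebesgue"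
  shows "integrable (lebesgue_on \<Omega>) (\<lambda>x. (if x \<in> D then F x else 0)) \<longleftrightarrow> integrable (lebesgue_on D) F"
proof -
  have "integrable (lebesgue_on \<Omega>) (\<lambda>x. (if x \<in> D then F x else 0))
      \<longleftrightarrow> integrable lebesgue (\<lambda>x. (if x \<in> \<Omega> then (if x \<in> D then F x else 0) else 0))"
    by (rule Lebesgue_Measure.integrable_restrict_UNIV[symmetric]) fact
  also have "(\<lambda>x. (if x \<in> \<Omega> then (if x \<in> D then F x else 0) else 0)) = (\<lambda>x. if x \<in> D then F x else 0)"
    using assms(1) by (intro ext) auto
  also have "integrable lebesgue \<dots> \<longleftrightarrow> integrable (lebesgue_on D) F"
    by (rule Lebesgue_Measure.integrable_restrict_UNIV) fact
  finally show ?thesis .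
qed

lemma integral_vanishing_outside:
  fixes F :: "real^2 \<Rightarrow> 'b::euclidean_space"
  assumes "D \<in> sets lebesgue" "\<And>x. x \<notin> D \<Longrightarrow> F x = 0"
  shows "(LINT x|lebesgue_on D. F x) = (LINT x|lebesgue. F x)"
proof -
  have "(LINT x|lebesgue. (if x \<in> D then F x else 0)) = (LINT x|lebesgue. F x)"
    using assms(2) by (intro Bochner_Integration.integral_cong) auto
  then show ?thesis
    using Lebesgue_Measure.integral_restrict_UNIV[OF assms(1), of F] by simp
qed

lemma L2_measurable: "f \<in> L2 D \<Longrightarrow> f \<in> borel_measurable (lebesgue_on D)"
  by (simp add: L2_def)

lemma L2_square_integrable: "f \<in> L2 D \<Longrightarrow> integrable (lebesgue_on D) (\<lambda>x. (norm (f x))\<^sup>2)"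
  by (simp add: L2_def)

lemma L2_norm_nonneg [simp]: "0 \<le> L2_norm D f"
  by (simp add: L2_norm_def)

lemma L2_norm_square: "(L2_norm D f)\<^sup>2 = (LINT x|lebesgue_on D. (norm (f x))\<^sup>2)"
  by (simp add: L2_norm_def)

lemma L2_norm_cong_AE:
  assumes "AE x in lebesgue_on D. f x = g x" "f \<in> borel_measurable (lebesgue_on D)"
    "g \<in> borel_measurable (lebesgue_on D)"
  shows "L2_norm D f = L2_norm D g"
proof -
  have "AE x in lebesgue_on D. (norm (f x))\<^sup>2 = (norm (g x))\<^sup>2"
    using assms(1) by eventually_elim simp
  then have "(LINT x|lebesgue_on D. (norm (f x))\<^sup>2) = (LINT x|lebesgue_on D. (norm (g x))\<^sup>2)"
    using assms(2,3) by (intro integral_cong_AE) auto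
  then show ?thesis by (simp add: L2_norm_def)
qed

lemma L2_diff:
  assumes "f \<in> L2 D" "g \<in> L2 D"
  shows "(\<lambda>x. f x - g x) \<in> L2 D"
proof -
  note [measurable] = assms[THEN L2_measurable]
  have "norm ((norm (f x - g x))\<^sup>2) \<le> norm (2 * (norm (f x))\<^sup>2 + 2 * (norm (g x))\<^sup>2)" for x
  proof -
    have "(norm (f x - g x))\<^sup>2 \<le> (norm (f x) + norm (g x))\<^sup>2"
      by (rule power_mono[OF norm_triangle_ineq4 norm_ge_zero])
    also have "\<dots> \<le> 2 * (norm (f x))\<^sup>2 + 2 * (norm (g x))\<^sup>2"
      using sum_squares_bound[of "norm (f x)" "norm (g x)"] unfolding power2_sum by linarith
    finally show ?thesis by simp
  qed
  note bound = this
  have "integrable (lebesgue_on D) (\<lambda>x. (norm (f x - g x))\<^sup>2)"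
  proof (rule Bochner_Integration.integrable_bound)
    show "integrable (lebesgue_on D) (\<lambda>x. 2 * (norm (f x))\<^sup>2 + 2 * (norm (g x))\<^sup>2)"
      using assms by (simp add: L2_square_integrable)
    show "AE x in lebesgue_on D. norm ((norm (f x - g x))\<^sup>2) \<le> norm (2 * (norm (f x))\<^sup>2 + 2 * (norm (g x))\<^sup>2)"
      by (rule AE_I2) (rule bound)
  qed measurable
  then show ?thesis by (simp add: L2_def)
qed

lemma L2_norm_mult_integrable:
  assumes "f \<in> L2 D" "g \<in> L2 D"
  shows "integrable (lebesgue_on D) (\<lambda>x. norm (f x) * norm (g x))"
proof (rule Bochner_Integration.integrable_bound)
  note [measurable] = assms[THEN L2_measurable]
  show "integrable (lebesgue_on D) (\<lambda>x. (norm (f x))\<^sup>2 + (norm (g x))\<^sup>2)"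
    using assms by (simp add: L2_square_integrable)
  have "norm (norm (f x) * norm (g x)) \<le> norm ((norm (f x))\<^sup>2 + (norm (g x))\<^sup>2)" for x
    using sum_squares_bound[of "norm (f x)" "norm (g x)"]
      mult_nonneg_nonneg[OF norm_ge_zero[of "f x"] norm_ge_zero[of "g x"]]
    unfolding real_norm_def by linarith
  then show "AE x in lebesgue_on D. norm (norm (f x) * norm (g x)) \<le> norm ((norm (f x))\<^sup>2 + (norm (g x))\<^sup>2)"
    by simp
  show "(\<lambda>x. norm (f x) * norm (g x)) \<in> borel_measurable (lebesgue_on D)" by measurable
qed

text \<open>
  Integrating \<open>2 t \<bar>f\<bar> \<bar>g\<bar> \<le> \<bar>f\<bar>\<^sup>2 + t\<^sup>2 \<bar>g\<bar>\<^sup>2\<close> gives a family of bounds with a parameter \<open>t\<close>, which is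
  chosen as the quotient of the two norms, or large, or proportional to the integral itself, when
  one of the norms vanishes.
\<close>

lemma L2_Cauchy_Schwarz:
  assumes f: "f \<in> L2 D" and g: "g \<in> L2 D"
  shows "(LINT x|lebesgue_on D. norm (f x) * norm (g x)) \<le> L2_norm D f * L2_norm D g"
proof -
  let ?I = "LINT x|lebesgue_on D. norm (f x) * norm (g x)"
  let ?A = "L2_norm D f" and ?B = "L2_norm D g"
  have quad: "2 * t * ?I \<le> ?A\<^sup>2 + t\<^sup>2 * ?B\<^sup>2" for t
  proof -
    have "2 * t * ?I = (LINT x|lebesgue_on D. 2 * t * (norm (f x) * norm (g x)))" by simp
    also have "\<dots> \<le> (LINT x|lebesgue_on D. (norm (f x))\<^sup>2 + t\<^sup>2 * (norm (g x))\<^sup>2)"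
    proof (rule integral_mono)
      fix x
      show "2 * t * (norm (f x) * norm (g x)) \<le> (norm (f x))\<^sup>2 + t\<^sup>2 * (norm (g x))\<^sup>2"
        using sum_squares_bound[of "norm (f x)" "t * norm (g x)"] 
        by (simp add: power_mult_distrib mult_ac)
    qed (use f g in \<open>simp_all add: L2_norm_mult_integrable L2_square_integrable\<close>)
    also have "\<dots> = ?A\<^sup>2 + t\<^sup>2 * ?B\<^sup>2"
      using f g by (simp add: L2_norm_square L2_square_integrable)
    finally show ?thesis .
  qed
  show ?thesis
  proof (cases "?B = 0")
    case True
    have "?I \<le> 0"
    proof (rule ccontr)
      assume "\<not> ?I \<le> 0"
      then show False
        using quad[of "(?A\<^sup>2 + 1) / (2 * ?I)"] True by (simp add: field_simps)
    qed
    then show ?thesis using True by simp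
  next
    case False
    then have B: "?B > 0" using L2_norm_nonneg[of D g] by linarith
    have "2 * ?A * ?I / ?B \<le> 2 * ?A\<^sup>2"
      using quad[of "?A / ?B"] B by (simp add: power_divide)
    then have *: "?A * ?I \<le> ?A * (?A * ?B)"
      using B by (simp add: field_simps power2_eq_square)
    show ?thesis
    proof (cases "?A = 0")
      case True
      have "?I \<le> 0"
      proof (rule ccontr)
        assume I: "\<not> ?I \<le> 0"
        have "(?I / ?B\<^sup>2)\<^sup>2 * ?B\<^sup>2 = ?I / ?B\<^sup>2 * ?I"
          using B by (simp add: power2_eq_square)
        then have "2 * (?I / ?B\<^sup>2 * ?I) \<le> ?I / ?B\<^sup>2 * ?I"
          using quad[of "?I / ?B\<^sup>2"] True by simp
        moreover have "?I / ?B\<^sup>2 * ?I > 0"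
          using I B by (intro mult_pos_pos divide_pos_pos) auto
        ultimately show False by linarith
      qed
      then show ?thesis using True by simp
    next
      case False
      then show ?thesis using * L2_norm_nonneg[of D f] by auto
    qed
  qed
qed

lemma L2_scaleR_integrable:
  fixes f :: "real^2 \<Rightarrow> real" and g :: "real^2 \<Rightarrow> 'b::euclidean_space"
  assumes "f \<in> L2 D" "g \<in> L2 D"
  shows "integrable (lebesgue_on D) (\<lambda>x. f x *\<^sub>R g x)"
  using assms[THEN L2_measurable]
  by (intro Bochner_Integration.integrable_bound[OF L2_norm_mult_integrable[OF assms]]) auto

lemma L2_inner_integrable:
  assumes "f \<in> L2 D" "g \<in> L2 D"
  shows "integrable (lebesgue_on D) (\<lambda>x. f x \<bullet> g x)"
  using assms[THEN L2_measurable]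
  by (intro Bochner_Integration.integrable_bound[OF L2_norm_mult_integrable[OF assms]])
     (auto simp: Cauchy_Schwarz_ineq2)

lemma L2_mult_integrable:
  fixes f g :: "real^2 \<Rightarrow> real"
  assumes "f \<in> L2 D" "g \<in> L2 D"
  shows "integrable (lebesgue_on D) (\<lambda>x. f x * g x)"
  using L2_inner_integrable[OF assms] by simp

lemma L2_scaleR_bound:
  fixes f :: "real^2 \<Rightarrow> real" and g :: "real^2 \<Rightarrow> 'b::euclidean_space"
  assumes "f \<in> L2 D" "g \<in> L2 D"
  shows "norm (LINT x|lebesgue_on D. f x *\<^sub>R g x) \<le> L2_norm D f * L2_norm D g"
  using integral_norm_bound[of "lebesgue_on D" "\<lambda>x. f x *\<^sub>R g x"] L2_Cauchy_Schwarz[OF assms] by simp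

lemma L2_inner_bound:
  assumes "f \<in> L2 D" "g \<in> L2 D"
  shows "\<bar>LINT x|lebesgue_on D. f x \<bullet> g x\<bar> \<le> L2_norm D f * L2_norm D g"
proof -
  have "\<bar>LINT x|lebesgue_on D. f x \<bullet> g x\<bar> \<le> (LINT x|lebesgue_on D. \<bar>f x \<bullet> g x\<bar>)"
    by (rule integral_abs_bound)
  also have "\<dots> \<le> (LINT x|lebesgue_on D. norm (f x) * norm (g x))"
    by (intro integral_mono integrable_abs L2_inner_integrable L2_norm_mult_integrable assms Cauchy_Schwarz_ineq2)
  finally show ?thesis using L2_Cauchy_Schwarz[OF assms] by linarith
qed

lemma L2_mult_bound:
  fixes f g :: "real^2 \<Rightarrow> real"
  assumes "f \<in> L2 D" "g \<in> L2 D"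
  shows "\<bar>LINT x|lebesgue_on D. f x * g x\<bar> \<le> L2_norm D f * L2_norm D g"
  using L2_inner_bound[OF assms] by simp

lemma L2_integrable:
  assumes "f \<in> L2 D" and "D \<in> lmeasurable"
  shows "integrable (lebesgue_on D) f"
proof (rule Bochner_Integration.integrable_bound)
  interpret finite_measure "lebesgue_on D"
    using assms(2) by (rule finite_measure_lebesgue_on)
  show "integrable (lebesgue_on D) (\<lambda>x. 1 + (norm (f x))\<^sup>2)"
    using assms by (simp add: L2_square_integrable)
  have "norm (f x) \<le> norm (1 + (norm (f x))\<^sup>2)" for x
  proof -
    have "2 * norm (f x) \<le> 1 + (norm (f x))\<^sup>2"
      using zero_le_power2[of "norm (f x) - 1"] by (simp add: power2_diff)
    then have "norm (f x) \<le> 1 + (norm (f x))\<^sup>2"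
      using zero_le_power2[of "norm (f x)"] by linarith
    then show ?thesis by simp
  qed
  then show "AE x in lebesgue_on D. norm (f x) \<le> norm (1 + (norm (f x))\<^sup>2)" by simp
qed (rule L2_measurable[OF assms(1)])

lemma L2_const:
  assumes "D \<in> lmeasurable"
  shows "(\<lambda>x. c) \<in> L2 D"
proof -
  interpret finite_measure "lebesgue_on D"
    using assms by (rule finite_measure_lebesgue_on)
  show ?thesis by (simp add: L2_def)
qed

lemma L2_zero_ext:
  fixes f :: "real^2 \<Rightarrow> 'b::euclidean_space"
  assumes "f \<in> L2 D" "D \<subseteq> \<Omega>" "D \<in> sets lebesgue" "\<Omega> \<in> sets lebesgue"
  shows "(\<lambda>x. if x \<in> D then f x else 0) \<in> L2 \<Omega>"
    and "L2_norm \<Omega> (\<lambda>x. if x \<in> D then f x else 0) = L2_norm D f"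
proof -
  have *: "(\<lambda>x. (norm (if x \<in> D then f x else 0))\<^sup>2) = (\<lambda>x. if x \<in> D then (norm (f x))\<^sup>2 else 0)"
    by auto
  show "(\<lambda>x. if x \<in> D then f x else 0) \<in> L2 \<Omega>"
    unfolding L2_def mem_Collect_eq *
    using borel_measurable_if_lebesgue_on[OF assms(3,4,2), of f] integrable_if_subset[OF assms(2-4), of "\<lambda>x. (norm (f x))\<^sup>2"]
      L2_measurable[OF assms(1)] L2_square_integrable[OF assms(1)] by blast
  show "L2_norm \<Omega> (\<lambda>x. if x \<in> D then f x else 0) = L2_norm D f"
    unfolding L2_norm_def * by (subst integral_if_subset[OF assms(2-4)]) (rule refl)
qed

section \<open>Integration by parts\<close>

lemma bounded_imp_subset_cball_0:
  fixes S :: "'a::real_normed_vector set"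
  assumes "bounded S"
  obtains R where "S \<subseteq> cball 0 R"
proof -
  obtain R where "\<forall>x\<in>S. norm x \<le> R" using assms unfolding bounded_iff ..
  then have "S \<subseteq> cball 0 R" by (intro subsetI) simp
  then show thesis by (rule that)
qed

lemma continuous_bounded_support_integrable:
  fixes F :: "real^2 \<Rightarrow> 'b::euclidean_space"
  assumes "continuous_on UNIV F" "bounded {x. F x \<noteq> 0}"
  shows "integrable lborel F" "integrable lebesgue F"
proof -
  obtain R where R: "{x. F x \<noteq> 0} \<subseteq> cball 0 R"
    by (rule bounded_imp_subset_cball_0[OF assms(2)])
  have "indicator (cball 0 R) x *\<^sub>R F x = F x" for x
    using R by (cases "F x = 0") (auto simp del: mem_cball)
  then have "(\<lambda>x. indicator (cball 0 R) x *\<^sub>R F x) = F"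
    by (rule ext)
  with borel_integrable_compact[OF compact_cball, of 0 R F] show I: "integrable lborel F"
    using assms(1) continuous_on_subset by fastforce
  then show "integrable lebesgue F"
    using integrable_completion[of F lborel] borel_measurable_continuous_onI[OF assms(1)] by simp
qed

lemma continuous_bounded_support_L2:
  fixes F :: "real^2 \<Rightarrow> 'b::euclidean_space"
  assumes "continuous_on UNIV F" "bounded {x. F x \<noteq> 0}" "D \<in> sets lebesgue"
  shows "F \<in> L2 D"
proof -
  have "integrable lebesgue (\<lambda>x. (norm (F x))\<^sup>2)"
    using assms by (intro continuous_bounded_support_integrable continuous_intros) auto
  then have "integrable (lebesgue_on D) (\<lambda>x. (norm (F x))\<^sup>2)"
    using integrable_mult_indicator[OF assms(3), of "\<lambda>x. (norm (F x))\<^sup>2"] assms(3)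
      integrable_restrict_space[of D lebesgue "\<lambda>x. (norm (F x))\<^sup>2"] by simp
  moreover have "F \<in> borel_measurable (lebesgue_on D)"
    using borel_measurable_continuous_onI[OF assms(1)]
    by (simp add: measurable_completion measurable_restrict_space1)
  ultimately show ?thesis by (simp add: L2_def)
qed

text \<open>
  Integration by parts uses a test function only through its first derivatives, and products of
  functions of this class are immediate.
\<close>

definition C1 :: "(real^2 \<Rightarrow> real) \<Rightarrow> bool" where
  "C1 f \<longleftrightarrow> (\<forall>x. f differentiable (at x)) \<and> continuous_on UNIV (gradient f)"

lemma C1_continuous: "C1 f \<Longrightarrow> continuous_on UNIV f"
  by (auto simp: C1_def continuous_on_eq_continuous_at differentiable_imp_continuous_within)

lemma test_function_C1: "\<phi> \<in> test_functions D \<Longrightarrow> C1 \<phi>"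
proof -
  assume "\<phi> \<in> test_functions D"
  then have "C_k (Suc 0) \<phi>" by (auto simp: test_functions_def)
  then show "C1 \<phi>"
    unfolding C1_def using continuous_on_vec_lambda[of UNIV "\<lambda>i x. gradient \<phi> x $ i"] by simp
qed

lemma test_function_bounded_support: "\<phi> \<in> test_functions D \<Longrightarrow> bounded {x. \<phi> x \<noteq> 0}"
  using bounded_subset[OF compact_imp_bounded closure_subset] by (auto simp: test_functions_def)

lemma test_function_outside: "\<phi> \<in> test_functions D \<Longrightarrow> x \<notin> D \<Longrightarrow> \<phi> x = 0"
  using closure_subset[of "{x. \<phi> x \<noteq> 0}"] unfolding test_functions_def by blast

lemma gradient_locally_zero:
  assumes "open U" "x \<in> U" "\<And>y. y \<in> U \<Longrightarrow> f y = 0"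
  shows "gradient f x = 0"
proof (rule gradient_eqI)
  have "((\<lambda>y. 0) has_derivative (\<lambda>h. 0)) (at x)" by simp
  then have "(f has_derivative (\<lambda>h. 0)) (at x)"
    by (rule has_derivative_transform_within_open[of _ _ _ _ U]) (use assms in auto)
  then show "GDERIV f x :> 0" by (simp add: gderiv_def)
qed

lemma gradient_support: "{x. gradient f x \<noteq> 0} \<subseteq> closure {x. f x \<noteq> 0}"
proof -
  have "gradient f x = 0" if "x \<notin> closure {x. f x \<noteq> 0}" for x
    by (rule gradient_locally_zero[of "- closure {x. f x \<noteq> 0}"])
      (use that closure_subset[of "{x. f x \<noteq> 0}"] in auto)
  then show ?thesis by auto
qed

lemma gradient_bounded_support: "bounded {x. f x \<noteq> 0} \<Longrightarrow> bounded {x. gradient f x \<noteq> 0}"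
  using gradient_support bounded_closure bounded_subset by metis

lemma test_function_gradient_outside:
  "\<phi> \<in> test_functions D \<Longrightarrow> x \<notin> D \<Longrightarrow> gradient \<phi> x = 0"
  using gradient_support[of \<phi>] unfolding test_functions_def by blast

lemma test_function_L2:
  assumes "\<phi> \<in> test_functions D" "S \<in> sets lebesgue"
  shows "\<phi> \<in> L2 S" "gradient \<phi> \<in> L2 S"
  using assms test_function_C1[OF assms(1)] test_function_bounded_support[OF assms(1)]
  by (auto intro!: continuous_bounded_support_L2 C1_continuous gradient_bounded_support simp: C1_def)

lemma integral_translation:
  fixes f :: "real^2 \<Rightarrow> 'b::euclidean_space"
  assumes "f \<in> borel_measurable borel"
  shows "(LINT x|lborel. f (c + x)) = (LINT x|lborel. f x)"
proof -
  have "(LINT x|lborel. f x) = (LINT x|distr lborel borel ((+) c). f x)"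
    by (simp add: lborel_distr_plus)
  also have "\<dots> = (LINT x|lborel. f (c + x))"
    using assms by (intro integral_distr) auto
  finally show ?thesis by simp
qed

lemma C1_mean_value_bound:
  assumes "C1 f" "\<And>x. norm (gradient f x) \<le> M"
  shows "\<bar>f y - f x\<bar> \<le> M * norm (y - x)"
proof -
  have "norm (f y - f x) \<le> M * norm (y - x)"
  proof (rule differentiable_bound[of UNIV])
    fix z
    show "(f has_derivative (\<lambda>h. h \<bullet> gradient f z)) (at z within UNIV)"
      using assms(1) GDERIV_gradient by (auto simp: C1_def gderiv_def)
    show "onorm (\<lambda>h. h \<bullet> gradient f z) \<le> M"
    proof (rule onorm_le)
      fix h
      have "norm (h \<bullet> gradient f z) \<le> norm h * norm (gradient f z)"
        by (simp add: Cauchy_Schwarz_ineq2)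
      also have "\<dots> \<le> norm h * M" by (intro mult_left_mono assms(2)) auto
      finally show "norm (h \<bullet> gradient f z) \<le> M * norm h" by (simp add: mult.commute)
    qed
  qed auto
  then show ?thesis by simp
qed

text \<open>
  The integral of a translate does not depend on the translation, so every difference quotient has
  integral zero; by the mean value bound the quotients converge dominatedly to the derivative.
\<close>

lemma integral_gradient_eq_0:
  assumes "C1 f" "bounded {x. f x \<noteq> 0}"
  shows "(LINT x|lborel. gradient f x) = 0"
proof -
  let ?G = "gradient f"
  have cG: "continuous_on UNIV ?G" and cf: "continuous_on UNIV f"
    using assms C1_continuous by (auto simp: C1_def)
  have [measurable]: "?G \<in> borel_measurable borel" "f \<in> borel_measurable borel"
    using cG cf borel_measurable_continuous_onI by auto
  have intG: "integrable lborel ?G"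
    by (rule continuous_bounded_support_integrable[OF cG gradient_bounded_support[OF assms(2)]])
  have intf: "integrable lborel f"
    by (rule continuous_bounded_support_integrable[OF cf assms(2)])
  obtain R where R: "{x. f x \<noteq> 0} \<subseteq> cball 0 R"
    by (rule bounded_imp_subset_cball_0[OF assms(2)])
  obtain S where S: "{x. ?G x \<noteq> 0} \<subseteq> cball 0 S"
    by (rule bounded_imp_subset_cball_0[OF gradient_bounded_support[OF assms(2)]])
  have "bounded (?G ` cball 0 S)"
    using cG continuous_on_subset by (intro compact_imp_bounded compact_continuous_image) auto
  then obtain M where M: "\<And>x. x \<in> cball 0 S \<Longrightarrow> norm (?G x) \<le> M" "M > 0"
    unfolding bounded_pos by blast
  have GM: "norm (?G x) \<le> M" for x
    using S M by (cases "?G x = 0") auto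
  have "(LINT x|lborel. ?G x \<bullet> e) = 0" if e: "norm e = 1" for e
  proof -
    define h where "h n = inverse (real (Suc n))" for n
    have h: "0 < h n" "h n \<le> 1" "h n \<noteq> 0" for n
      by (auto simp: h_def inverse_le_1_iff)
    let ?d = "\<lambda>n x. (f (h n *\<^sub>R e + x) - f x) / h n"
    \<comment> \<open>Step widths are at most one, so all quotients vanish outside one ball.\<close>
    have lim: "(\<lambda>n. LINT x|lborel. ?d n x) \<longlonglongrightarrow> (LINT x|lborel. ?G x \<bullet> e)"
    proof (rule integral_dominated_convergence)
      show "integrable lborel (\<lambda>x::real^2. indicator (cball 0 (R + 1)) x * M)"
        by (intro integrable_mult_left integrable_real_indicator)
          (use emeasure_bounded_finite[of "cball 0 (R + 1) :: (real^2) set"] in auto)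
      have "(\<lambda>n. ?d n x) \<longlonglongrightarrow> ?G x \<bullet> e" for x
      proof -
        have "GDERIV f x :> ?G x" using assms(1) GDERIV_gradient by (auto simp: C1_def)
        then have "((\<lambda>t. f (t *\<^sub>R e + x)) has_derivative (\<lambda>t. (t *\<^sub>R e) \<bullet> ?G x)) (at (0::real))"
          unfolding gderiv_def
          by (intro has_derivative_compose[of "\<lambda>t. t *\<^sub>R e + x" "\<lambda>t. t *\<^sub>R e" _ _ f "\<lambda>h. h \<bullet> ?G x"])
            (auto intro!: derivative_eq_intros)
        then have "DERIV (\<lambda>t. f (t *\<^sub>R e + x)) 0 :> ?G x \<bullet> e"
          by (simp add: has_field_derivative_def mult.commute[of "?G x \<bullet> e"] inner_commute[of e] mult_commute_abs)
        then have *: "((\<lambda>t. (f (t *\<^sub>R e + x) - f x) / t) \<longlongrightarrow> ?G x \<bullet> e) (at 0)"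
          by (simp add: DERIV_def)
        have "filterlim h (at 0) sequentially"
          unfolding h_def filterlim_at using LIMSEQ_inverse_real_of_nat by auto
        from filterlim_compose[OF * this] show ?thesis .
      qed
      then show "AE x in lborel. (\<lambda>n. ?d n x) \<longlonglongrightarrow> ?G x \<bullet> e" by simp
      have "norm (?d n x) \<le> indicator (cball 0 (R + 1)) x * M" for n x
      proof (cases "x \<in> cball 0 (R + 1)")
        case True
        then show ?thesis
          using C1_mean_value_bound[OF assms(1) GM, of "h n *\<^sub>R e + x" x] h[of n] e
          by (simp add: field_simps)
      next
        case False
        have "norm x \<le> norm (h n *\<^sub>R e + x) + h n"
          using norm_triangle_ineq4[of "h n *\<^sub>R e + x" "h n *\<^sub>R e"] h[of n] e by simp
        then have "h n *\<^sub>R e + x \<notin> cball 0 R" "x \<notin> cball 0 R"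
          using False h[of n] by auto
        then have "f (h n *\<^sub>R e + x) = 0" "f x = 0" using R by auto
        then show ?thesis using False by simp
      qed
      then show "AE x in lborel. norm (?d n x) \<le> indicator (cball 0 (R + 1)) x * M" for n by simp
    qed measurable
    have zero: "(LINT x|lborel. ?d n x) = 0" for n
    proof -
      have "integrable lborel (\<lambda>x. f (h n *\<^sub>R e + x))"
      proof (rule continuous_bounded_support_integrable)
        show "continuous_on UNIV (\<lambda>x. f (h n *\<^sub>R e + x))"
          by (intro continuous_on_compose2[OF cf] continuous_intros) auto
        have "{x. f (h n *\<^sub>R e + x) \<noteq> 0} = (+) (- (h n *\<^sub>R e)) ` {x. f x \<noteq> 0}"
        proof -
          have "x \<in> (+) (- (h n *\<^sub>R e)) ` {x. f x \<noteq> 0}" if "f (h n *\<^sub>R e + x) \<noteq> 0" for x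
            using that by (intro image_eqI[of _ _ "h n *\<^sub>R e + x"]) auto
          then show ?thesis by auto
        qed
        then show "bounded {x. f (h n *\<^sub>R e + x) \<noteq> 0}"
          using bounded_translation[OF assms(2), of "- (h n *\<^sub>R e)"] by simp
      qed
      then show ?thesis
        using intf integral_translation[of f "h n *\<^sub>R e"] by simp
    qed
    have "(\<lambda>n::nat. 0::real) \<longlonglongrightarrow> (LINT x|lborel. ?G x \<bullet> e)"
      using lim unfolding zero .
    then show ?thesis using LIMSEQ_unique tendsto_const by blast
  qed
  then have "(LINT x|lborel. ?G x) \<bullet> e = 0" if "norm e = 1" for e
    using that intG by (simp flip: integral_inner_left)
  then show ?thesis
    by (metis euclidean_eqI inner_zero_left norm_Basis)
qed

lemma integration_by_parts:
  assumes f: "C1 f" "bounded {x. f x \<noteq> 0}" and g: "C1 g"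
  shows "(LINT x|lebesgue. f x *\<^sub>R gradient g x) = - (LINT x|lebesgue. g x *\<^sub>R gradient f x)"
proof -
  have grad: "gradient (\<lambda>x. f x * g x) x = f x *\<^sub>R gradient g x + g x *\<^sub>R gradient f x" for x
    using f g by (intro gradient_eqI GDERIV_mult GDERIV_gradient) (auto simp: C1_def)
  have cont: "continuous_on UNIV (\<lambda>x. f x *\<^sub>R gradient g x)" "continuous_on UNIV (\<lambda>x. g x *\<^sub>R gradient f x)"
    using f g C1_continuous by (auto intro!: continuous_intros simp: C1_def)
  have bdd: "bounded {x. f x *\<^sub>R gradient g x \<noteq> 0}" "bounded {x. g x *\<^sub>R gradient f x \<noteq> 0}"
    by (rule bounded_subset[OF f(2)], force)
      (rule bounded_subset[OF gradient_bounded_support[OF f(2)]], force)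
  note int = continuous_bounded_support_integrable[OF cont(1) bdd(1)]
    continuous_bounded_support_integrable[OF cont(2) bdd(2)]
  have "C1 (\<lambda>x. f x * g x)"
    unfolding C1_def grad using f g cont by (auto intro!: continuous_intros simp: C1_def)
  moreover have "bounded {x. f x * g x \<noteq> 0}"
    by (rule bounded_subset[OF f(2)]) auto
  ultimately have "(LINT x|lborel. gradient (\<lambda>x. f x * g x) x) = 0"
    by (rule integral_gradient_eq_0)
  then have "(LINT x|lborel. f x *\<^sub>R gradient g x) + (LINT x|lborel. g x *\<^sub>R gradient f x) = 0"
    using int unfolding grad by simp
  moreover have "(LINT x|lebesgue. f x *\<^sub>R gradient g x) = (LINT x|lborel. f x *\<^sub>R gradient g x)"
    "(LINT x|lebesgue. g x *\<^sub>R gradient f x) = (LINT x|lborel. g x *\<^sub>R gradient f x)"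
    using cont by (auto intro!: integral_completion borel_measurable_continuous_onI)
  ultimately show ?thesis by (simp add: eq_neg_iff_add_eq_0)
qed

lemma test_function_has_weak_gradient:
  assumes "\<phi> \<in> test_functions D" "D \<in> sets lebesgue"
  shows "has_weak_gradient D \<phi> (gradient \<phi>)"
  unfolding has_weak_gradient_def
proof (intro conjI ballI test_function_L2[OF assms])
  fix \<psi> assume \<psi>: "\<psi> \<in> test_functions D"
  show "(LINT x|lebesgue_on D. \<phi> x *\<^sub>R gradient \<psi> x) = - (LINT x|lebesgue_on D. \<psi> x *\<^sub>R gradient \<phi> x)"
    using integration_by_parts[OF test_function_C1 test_function_bounded_support test_function_C1, OF assms(1) assms(1) \<psi>]
    by (subst (1 2) integral_vanishing_outside)
      (use assms \<psi> in \<open>auto simp: test_function_outside\<close>)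
qed

section \<open>Uniqueness of weak gradients\<close>

text \<open>
  Cover \<open>U\<close> by countably many balls whose closures lie in \<open>U\<close>, with bumps \<open>\<beta> k\<close>.  The functions
  \<open>1 - (\<Prod>k<n. 1 - \<beta> k) ^ n\<close> are smooth, have compact support in \<open>U\<close>, take values in the unit interval, and
  tend to one wherever some \<open>\<beta> k\<close> is positive.
\<close>

lemma test_functions_approximate_open:
  assumes "open U"
  obtains \<zeta> where "\<And>n. \<zeta> n \<in> test_functions U" "\<And>n x. \<bar>\<zeta> n x\<bar> \<le> 1"
    "\<And>x. (\<lambda>n. \<zeta> n x) \<longlonglongrightarrow> indicator U x"
proof (cases "U = {}")
  case True
  show thesis
    by (rule that[of "\<lambda>n x. 0"])
      (use True test_functionsI[OF smooth_alg.const[of 0], of "{}"] in auto)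
next
  case False
  define \<B> where "\<B> = {ball c r | c r. 0 < r \<and> cball c r \<subseteq> U}"
  have UB: "\<Union>\<B> = U"
  proof
    show "\<Union>\<B> \<subseteq> U" using ball_subset_cball by (fastforce simp: \<B>_def)
    show "U \<subseteq> \<Union>\<B>"
    proof
      fix x assume "x \<in> U"
      then obtain r where "r > 0" "cball x r \<subseteq> U" using assms open_contains_cball by blast
      then have "ball x r \<in> \<B>" "x \<in> ball x r" by (auto simp: \<B>_def)
      then show "x \<in> \<Union>\<B>" by blast
    qed
  qed
  obtain \<B>' where B': "\<B>' \<subseteq> \<B>" "countable \<B>'" "\<Union>\<B>' = \<Union>\<B>"
    using Lindelof[of \<B>] by (auto simp: \<B>_def)
  with UB False have "\<B>' \<noteq> {}" by auto
  have "\<exists>c r. 0 < r \<and> cball c r \<subseteq> U \<and> from_nat_into \<B>' k = ball c r" for k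
    using from_nat_into[OF \<open>\<B>' \<noteq> {}\<close>, of k] B'(1) unfolding \<B>_def by blast
  then obtain c r where cr: "\<And>k. 0 < r k" "\<And>k. cball (c k) (r k) \<subseteq> U"
      "\<And>k. from_nat_into \<B>' k = ball (c k) (r k)" by metis
  have U: "U = (\<Union>k. ball (c k) (r k))"
    using UB B' range_from_nat_into[OF \<open>\<B>' \<noteq> {}\<close> B'(2)] cr(3) by auto
  define p where "p n x = (\<Prod>k<n. 1 - bump (c k) (r k) x)" for n x
  have p01: "0 \<le> p n x" "p n x \<le> 1" for n x
    unfolding p_def using bump_bounds
    by (auto intro!: prod_nonneg prod_le_1 simp: less_imp_le)
  define \<zeta> where "\<zeta> n x = 1 - p n x ^ n" for n :: nat and x
  have 1: "\<zeta> n \<in> test_functions U" for n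
  proof (rule test_functionsI)
    show "\<zeta> n \<in> smooth_alg"
      unfolding \<zeta>_def[abs_def] p_def
      by (intro smooth_alg_diff smooth_alg.const smooth_alg_power smooth_alg_prod bump_smooth)
    show "compact (\<Union>k<n. cball (c k) (r k))" by auto
    show "(\<Union>k<n. cball (c k) (r k)) \<subseteq> U" using cr by auto
    show "\<zeta> n x = 0" if "x \<notin> (\<Union>k<n. cball (c k) (r k))" for x
    proof -
      have "bump (c k) (r k) x = 0" if "k < n" for k
        using bump_support[OF cr(1), of "c k" k] ball_subset_cball \<open>x \<notin> _\<close> that by blast
      then show ?thesis by (simp add: \<zeta>_def p_def)
    qed
  qed
  have 2: "\<bar>\<zeta> n x\<bar> \<le> 1" for n x
    using p01[of n x] power_le_one[OF p01, of n x n] zero_le_power[OF p01(1), of n x n]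
    unfolding \<zeta>_def by linarith
  have 3: "(\<lambda>n. \<zeta> n x) \<longlonglongrightarrow> indicator U x" for x
  proof (cases "x \<in> U")
    case True
    then obtain k where k: "x \<in> ball (c k) (r k)" using U by blast
    let ?q = "1 - bump (c k) (r k) x"
    have "bump (c k) (r k) x \<noteq> 0" using bump_support[OF cr(1), of "c k" k] k by blast
    then have q: "0 \<le> ?q" "?q < 1" using bump_bounds[of "c k" "r k" x] by linarith+
    have "p n x ^ n \<le> ?q ^ n" if "n > k" for n
    proof (rule power_mono[OF _ p01(1)])
      have "p n x = ?q * (\<Prod>k\<in>{..<n} - {k}. 1 - bump (c k) (r k) x)"
        unfolding p_def using that by (subst prod.remove[of _ k]) auto
      also have "\<dots> \<le> ?q * 1"
        using q bump_bounds by (intro mult_left_mono prod_le_1) (auto simp: less_imp_le)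
      finally show "p n x \<le> ?q" by simp
    qed
    then have ev: "\<forall>\<^sub>F n in sequentially. p n x ^ n \<le> ?q ^ n"
      by (rule eventually_mono[OF eventually_gt_at_top[of k]])
    have "(\<lambda>n. p n x ^ n) \<longlonglongrightarrow> 0"
      by (rule tendsto_sandwich[OF _ ev tendsto_const LIMSEQ_power_zero])
        (use q p01 in auto)
    then have "(\<lambda>n. 1 - p n x ^ n) \<longlonglongrightarrow> 1 - 0" by (intro tendsto_intros)
    then show ?thesis using True by (simp add: \<zeta>_def)
  next
    case False
    then have "\<zeta> n x = 0" for n using test_function_outside[OF 1] by simp
    then show ?thesis using False by simp
  qed
  show thesis using that[of \<zeta>] 1 2 3 by blast
qed

lemma test_functions_mono: "D \<subseteq> E \<Longrightarrow> test_functions D \<subseteq> test_functions E"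
  by (auto simp: test_functions_def)

text \<open>
  By dominated convergence the integral of \<open>H\<close> vanishes over every open subset of \<open>D\<close>, then over
  countable intersections of open sets, and these exhaust all measurable sets up to null sets.
\<close>

lemma fundamental_lemma_of_variations:
  fixes H :: "real^2 \<Rightarrow> 'b::euclidean_space"
  assumes "open D" "bounded D" "H \<in> L2 D"
    and zero: "\<And>\<phi>. \<phi> \<in> test_functions D \<Longrightarrow> (LINT x|lebesgue_on D. \<phi> x *\<^sub>R H x) = 0"
  shows "AE x in lebesgue_on D. H x = 0"
proof -
  have D: "D \<in> lmeasurable" "D \<in> sets lebesgue"
    using lmeasurable_open[OF assms(2,1)] assms(1) by auto
  have intH: "integrable (lebesgue_on D) H" by (rule L2_integrable[OF assms(3) D(1)])
  have [measurable]: "H \<in> borel_measurable (lebesgue_on D)" by (rule L2_measurable[OF assms(3)])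
  have meas: "\<phi> \<in> borel_measurable (lebesgue_on D)" if "\<phi> \<in> test_functions D" for \<phi>
    using test_function_L2[OF that D(2)] L2_measurable by blast
  have meas_ind: "indicat_real S \<in> borel_measurable (lebesgue_on D)" if "S \<in> sets lebesgue" for S
    using that by (intro measurable_restrict_space1) auto
  have open_zero: "(LINT x|lebesgue_on D. indicator U x *\<^sub>R H x) = 0" if "open U" "U \<subseteq> D" for U
  proof -
    obtain \<zeta> where \<zeta>: "\<And>n. \<zeta> n \<in> test_functions U" "\<And>n x. \<bar>\<zeta> n x\<bar> \<le> 1"
      "\<And>x. (\<lambda>n. \<zeta> n x) \<longlonglongrightarrow> indicator U x"
      using test_functions_approximate_open[OF \<open>open U\<close>] by metis
    have \<zeta>D: "\<zeta> n \<in> test_functions D" for n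
      using \<zeta>(1) test_functions_mono[OF \<open>U \<subseteq> D\<close>] by blast
    have "(\<lambda>n. LINT x|lebesgue_on D. \<zeta> n x *\<^sub>R H x) \<longlonglongrightarrow> (LINT x|lebesgue_on D. indicator U x *\<^sub>R H x)"
    proof (rule integral_dominated_convergence)
      show "integrable (lebesgue_on D) (\<lambda>x. norm (H x))" using intH by simp
      show "AE x in lebesgue_on D. (\<lambda>n. \<zeta> n x *\<^sub>R H x) \<longlonglongrightarrow> indicator U x *\<^sub>R H x"
        using \<zeta>(3) by (intro AE_I2 tendsto_intros)
      show "AE x in lebesgue_on D. norm (\<zeta> n x *\<^sub>R H x) \<le> norm (H x)" for n
        using \<zeta>(2) by (intro AE_I2) (simp add: mult_left_le_one_le)
      show "(\<lambda>x. indicator U x *\<^sub>R H x) \<in> borel_measurable (lebesgue_on D)"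
      proof -
        have "indicat_real U \<in> borel_measurable (lebesgue_on D)"
          by (rule meas_ind) (use \<open>open U\<close> in auto)
        then show ?thesis by measurable
      qed
      show "(\<lambda>x. \<zeta> n x *\<^sub>R H x) \<in> borel_measurable (lebesgue_on D)" for n
        using meas[OF \<zeta>D, of n] by measurable
    qed
    then have "(\<lambda>n::nat. 0::'b) \<longlonglongrightarrow> (LINT x|lebesgue_on D. indicator U x *\<^sub>R H x)"
      unfolding zero[OF \<zeta>D] .
    then show ?thesis using LIMSEQ_unique tendsto_const by blast
  qed
  interpret finite_measure "lebesgue_on D"
    using D(1) by (rule finite_measure_lebesgue_on)
  show ?thesis
  proof (rule density_zero[OF intH])
    fix A assume A: "A \<in> sets (lebesgue_on D)"
    then have AD: "A \<subseteq> D" "A \<in> sets lebesgue"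
      using D(2) sets_restrict_space_iff[of D lebesgue A] by auto
    obtain C T where C: "gdelta C" "T \<in> null_sets lebesgue" "A \<union> T = C" "disjnt A T"
      using lebesgue_set_almost_gdelta[OF AD(2)] by metis
    from C(1) obtain F :: "nat \<Rightarrow> (real^2) set" where F: "\<And>n. open (F n)" "C = \<Inter> (range F)"
      by (auto elim!: gdelta.cases)
    define V where "V n = D \<inter> (\<Inter>k\<le>n. F k)" for n
    have V: "open (V n)" "V n \<subseteq> D" for n using F assms(1) by (auto simp: V_def)
    have C': "C \<in> sets lebesgue" using C AD by auto
    have "(\<lambda>n. LINT x|lebesgue_on D. indicator (V n) x *\<^sub>R H x) \<longlonglongrightarrow> (LINT x|lebesgue_on D. indicator C x *\<^sub>R H x)"
    proof (rule integral_dominated_convergence)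
      show "integrable (lebesgue_on D) (\<lambda>x. norm (H x))" using intH by simp
      have "(\<lambda>n. indicat_real (V n) x) \<longlonglongrightarrow> indicator C x" if "x \<in> D" for x
      proof (cases "x \<in> C")
        case True
        then have "x \<in> V n" for n using F that by (auto simp: V_def)
        then show ?thesis using True by simp
      next
        case False
        then obtain k where "x \<notin> F k" using F by auto
        then have "x \<notin> V n" if "n \<ge> k" for n using that by (auto simp: V_def)
        then have "\<forall>\<^sub>F n in sequentially. indicat_real (V n) x = indicator C x"
          using False by (intro eventually_mono[OF eventually_ge_at_top[of k]]) auto
        then show ?thesis by (rule tendsto_eventually)
      qed
      then show "AE x in lebesgue_on D. (\<lambda>n. indicator (V n) x *\<^sub>R H x) \<longlonglongrightarrow> indicator C x *\<^sub>R H x"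
        by (intro AE_I2 tendsto_intros) auto
      show "AE x in lebesgue_on D. norm (indicator (V n) x *\<^sub>R H x) \<le> norm (H x)" for n
        by (intro AE_I2) (auto simp: indicator_def)
      show "(\<lambda>x. indicator C x *\<^sub>R H x) \<in> borel_measurable (lebesgue_on D)"
        using meas_ind[OF C'] by measurable
      show "(\<lambda>x. indicator (V n) x *\<^sub>R H x) \<in> borel_measurable (lebesgue_on D)" for n
      proof -
        have "indicat_real (V n) \<in> borel_measurable (lebesgue_on D)"
          by (rule meas_ind) (use V in auto)
        then show ?thesis by measurable
      qed
    qed
    then have "(\<lambda>n::nat. 0::'b) \<longlonglongrightarrow> (LINT x|lebesgue_on D. indicator C x *\<^sub>R H x)"
      unfolding open_zero[OF V] .
    then have C0: "(LINT x|lebesgue_on D. indicator C x *\<^sub>R H x) = 0"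
      using LIMSEQ_unique tendsto_const by blast
    \<comment> \<open>The set C differs from A by a null set only.\<close>
    have "AE x in lebesgue. x \<notin> T" using C(2) AE_not_in by blast
    then have "AE x in lebesgue_on D. x \<notin> T"
      using D(2) by (subst AE_restrict_space_iff) auto
    then have ae: "AE x in lebesgue_on D. indicator A x *\<^sub>R H x = indicator C x *\<^sub>R H x"
      by eventually_elim (use C(3) in \<open>auto simp: indicator_def\<close>)
    have "(LINT x|lebesgue_on D. indicator A x *\<^sub>R H x) = (LINT x|lebesgue_on D. indicator C x *\<^sub>R H x)"
      by (rule integral_cong_AE[OF _ _ ae])
        (use meas_ind[OF C'] meas_ind[OF AD(2)] in measurable)
    then show "set_lebesgue_integral (lebesgue_on D) A H = 0"
      using C0 by (simp add: set_lebesgue_integral_def)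
  qed
qed

lemma has_weak_gradient_diff:
  assumes "has_weak_gradient D u G" "has_weak_gradient D v H" "D \<in> sets lebesgue"
  shows "has_weak_gradient D (\<lambda>x. u x - v x) (\<lambda>x. G x - H x)"
proof -
  have L: "u \<in> L2 D" "v \<in> L2 D" "G \<in> L2 D" "H \<in> L2 D"
    using assms by (auto simp: has_weak_gradient_def)
  have "(LINT x|lebesgue_on D. (u x - v x) *\<^sub>R gradient \<phi> x) = - (LINT x|lebesgue_on D. \<phi> x *\<^sub>R (G x - H x))"
    if \<phi>: "\<phi> \<in> test_functions D" for \<phi>
  proof -
    note int = L2_scaleR_integrable[OF L(1) test_function_L2(2)[OF \<phi> assms(3)]]
      L2_scaleR_integrable[OF L(2) test_function_L2(2)[OF \<phi> assms(3)]]
      L2_scaleR_integrable[OF test_function_L2(1)[OF \<phi> assms(3)] L(3)]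
      L2_scaleR_integrable[OF test_function_L2(1)[OF \<phi> assms(3)] L(4)]
    have "(LINT x|lebesgue_on D. u x *\<^sub>R gradient \<phi> x) = - (LINT x|lebesgue_on D. \<phi> x *\<^sub>R G x)"
      "(LINT x|lebesgue_on D. v x *\<^sub>R gradient \<phi> x) = - (LINT x|lebesgue_on D. \<phi> x *\<^sub>R H x)"
      using assms \<phi> by (auto simp: has_weak_gradient_def)
    then show ?thesis
      unfolding scaleR_diff_left scaleR_diff_right
      by (simp add: Bochner_Integration.integral_diff[OF int(1,2)] Bochner_Integration.integral_diff[OF int(3,4)])
  qed
  then show ?thesis using L by (auto simp: has_weak_gradient_def L2_diff)
qed

text \<open>
  Uniqueness is what makes \<^const>\<open>wgrad\<close>, an arbitrary choice, computable: it lets the gradient of a test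
  function, or a gradient extended by zero, stand in for the chosen weak gradient.
\<close>

lemma weak_gradient_unique:
  assumes "open D" "bounded D" "has_weak_gradient D u G" "has_weak_gradient D u H"
  shows "AE x in lebesgue_on D. G x = H x"
proof -
  have D: "D \<in> sets lebesgue" using assms(1) by simp
  have 0: "has_weak_gradient D (\<lambda>x. 0) (\<lambda>x. G x - H x)"
    using has_weak_gradient_diff[OF assms(3,4) D] by simp
  have "AE x in lebesgue_on D. G x - H x = 0"
  proof (rule fundamental_lemma_of_variations[OF assms(1,2)])
    show "(\<lambda>x. G x - H x) \<in> L2 D" using 0 by (simp add: has_weak_gradient_def)
    show "(LINT x|lebesgue_on D. \<phi> x *\<^sub>R (G x - H x)) = 0" if "\<phi> \<in> test_functions D" for \<phi>
      using 0 that unfolding has_weak_gradient_def by simp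
  qed
  then show ?thesis by simp
qed

lemma wgrad_has_weak_gradient: "u \<in> H1 D \<Longrightarrow> has_weak_gradient D u (wgrad D u)"
  using someI_ex[of "has_weak_gradient D u"] by (simp add: H1_def wgrad_def)

lemma H1_L2:
  assumes "u \<in> H1 D"
  shows "u \<in> L2 D" "wgrad D u \<in> L2 D"
  using wgrad_has_weak_gradient[OF assms] by (auto simp: has_weak_gradient_def)

lemma has_weak_gradient_H1: "has_weak_gradient D u G \<Longrightarrow> u \<in> H1 D"
  by (auto simp: H1_def)

lemma wgrad_AE_eq:
  assumes "open D" "bounded D" "has_weak_gradient D u G"
  shows "AE x in lebesgue_on D. wgrad D u x = G x"
  using weak_gradient_unique[OF assms(1,2) wgrad_has_weak_gradient[OF has_weak_gradient_H1] assms(3)] assms(3)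
  by blast

lemma L2_norm_wgrad:
  assumes "open D" "bounded D" "has_weak_gradient D u G"
  shows "L2_norm D (wgrad D u) = L2_norm D G"
  using assms H1_L2(2)[OF has_weak_gradient_H1[OF assms(3)]]
  by (intro L2_norm_cong_AE[OF wgrad_AE_eq]) (auto simp: L2_measurable has_weak_gradient_def)

lemma H1_norm_eq:
  assumes "open D" "bounded D" "has_weak_gradient D u G"
  shows "H1_norm D u = sqrt ((L2_norm D u)\<^sup>2 + (L2_norm D G)\<^sup>2)"
  unfolding H1_norm_def L2_norm_wgrad[OF assms] ..

lemma L2_norm_le_H1_norm: "L2_norm D u \<le> H1_norm D u" "L2_norm D (wgrad D u) \<le> H1_norm D u"
  unfolding H1_norm_def by (auto intro!: real_le_rsqrt)

lemma test_function_H10: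
  assumes "open D" "bounded D" "\<phi> \<in> test_functions D"
  shows "\<phi> \<in> H10 D"
proof -
  have D: "D \<in> sets lebesgue" using assms(1) by simp
  have wg: "has_weak_gradient D \<phi> (gradient \<phi>)"
    by (rule test_function_has_weak_gradient[OF assms(3) D])
  have 0: "has_weak_gradient D (\<lambda>x. \<phi> x - \<phi> x) (\<lambda>x. 0)"
    using has_weak_gradient_diff[OF wg wg D] by simp
  have "H1_norm D (\<lambda>x. \<phi> x - \<phi> x) = 0"
    unfolding H1_norm_eq[OF assms(1,2) 0] by (simp add: L2_norm_def)
  then have "(\<lambda>n. H1_norm D (\<lambda>x. \<phi> x - (\<lambda>n::nat. \<phi>) n x)) \<longlonglongrightarrow> 0" by simp
  then show ?thesis
    using assms(3) has_weak_gradient_H1[OF wg] unfolding H10_def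
    by (intro CollectI conjI exI[of _ "\<lambda>n::nat. \<phi>"]) auto
qed

section \<open>Extension by zero\<close>

text \<open>
  The function \<open>\<phi>\<close> may differ from zero at the boundary of \<open>D\<close>.  The identity holds for the test functions that
  approximate \<open>\<xi>\<close>, since those vanish near the boundary, and passes to the limit in the H1 norm.
\<close>

lemma H10_integration_by_parts:
  assumes "open D" "bounded D" "\<xi> \<in> H10 D" "C1 \<phi>" "bounded {x. \<phi> x \<noteq> 0}"
  shows "(LINT x|lebesgue_on D. \<xi> x *\<^sub>R gradient \<phi> x) = - (LINT x|lebesgue_on D. \<phi> x *\<^sub>R wgrad D \<xi> x)"
proof -
  have D: "D \<in> sets lebesgue" using assms(1) by simp
  have \<xi>H1: "\<xi> \<in> H1 D" using assms(3) by (simp add: H10_def)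
  note wg\<xi> = wgrad_has_weak_gradient[OF \<xi>H1]
  obtain s where s: "\<And>n::nat. s n \<in> test_functions D"
    and lim: "(\<lambda>n. H1_norm D (\<lambda>x. \<xi> x - s n x)) \<longlonglongrightarrow> 0"
    using assms(3) by (auto simp: H10_def)
  note wgs = test_function_has_weak_gradient[OF s D]
  have d: "has_weak_gradient D (\<lambda>x. \<xi> x - s n x) (\<lambda>x. wgrad D \<xi> x - gradient (s n) x)" for n
    by (rule has_weak_gradient_diff[OF wg\<xi> wgs D])
  then have dL2: "(\<lambda>x. \<xi> x - s n x) \<in> L2 D" "(\<lambda>x. wgrad D \<xi> x - gradient (s n) x) \<in> L2 D" for n
    by (auto simp: has_weak_gradient_def)
  have \<phi>L2: "\<phi> \<in> L2 D" "gradient \<phi> \<in> L2 D"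
    using assms D by (auto intro!: continuous_bounded_support_L2 C1_continuous gradient_bounded_support simp: C1_def)
  let ?E = "(LINT x|lebesgue_on D. \<xi> x *\<^sub>R gradient \<phi> x) + (LINT x|lebesgue_on D. \<phi> x *\<^sub>R wgrad D \<xi> x)"
  have E: "norm ?E \<le> H1_norm D (\<lambda>x. \<xi> x - s n x) * (L2_norm D (gradient \<phi>) + L2_norm D \<phi>)" for n
  proof -
    have "(LINT x|lebesgue_on D. s n x *\<^sub>R gradient \<phi> x) = - (LINT x|lebesgue_on D. \<phi> x *\<^sub>R gradient (s n) x)"
      using integration_by_parts[OF test_function_C1[OF s] test_function_bounded_support[OF s] assms(4), of n]
      by (subst (1 2) integral_vanishing_outside)
        (use D in \<open>auto simp: test_function_outside[OF s] test_function_gradient_outside[OF s]\<close>)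
    moreover have "(LINT x|lebesgue_on D. (\<xi> x - s n x) *\<^sub>R gradient \<phi> x)
        = (LINT x|lebesgue_on D. \<xi> x *\<^sub>R gradient \<phi> x) - (LINT x|lebesgue_on D. s n x *\<^sub>R gradient \<phi> x)"
      unfolding scaleR_diff_left
      by (intro Bochner_Integration.integral_diff L2_scaleR_integrable \<phi>L2 H1_L2[OF \<xi>H1] test_function_L2(1)[OF s D])
    moreover have "(LINT x|lebesgue_on D. \<phi> x *\<^sub>R (wgrad D \<xi> x - gradient (s n) x))
        = (LINT x|lebesgue_on D. \<phi> x *\<^sub>R wgrad D \<xi> x) - (LINT x|lebesgue_on D. \<phi> x *\<^sub>R gradient (s n) x)"
      unfolding scaleR_diff_right
      by (intro Bochner_Integration.integral_diff L2_scaleR_integrable \<phi>L2 H1_L2[OF \<xi>H1] test_function_L2(2)[OF s D])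
    ultimately have "?E = (LINT x|lebesgue_on D. (\<xi> x - s n x) *\<^sub>R gradient \<phi> x)
        + (LINT x|lebesgue_on D. \<phi> x *\<^sub>R (wgrad D \<xi> x - gradient (s n) x))"
      by simp
    then have "norm ?E \<le> norm (LINT x|lebesgue_on D. (\<xi> x - s n x) *\<^sub>R gradient \<phi> x)
        + norm (LINT x|lebesgue_on D. \<phi> x *\<^sub>R (wgrad D \<xi> x - gradient (s n) x))"
      by (simp only: norm_triangle_ineq)
    also have "\<dots> \<le> L2_norm D (\<lambda>x. \<xi> x - s n x) * L2_norm D (gradient \<phi>)
        + L2_norm D \<phi> * L2_norm D (\<lambda>x. wgrad D \<xi> x - gradient (s n) x)"
      by (intro add_mono L2_scaleR_bound dL2 \<phi>L2)
    also have "\<dots> \<le> H1_norm D (\<lambda>x. \<xi> x - s n x) * L2_norm D (gradient \<phi>)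
        + L2_norm D \<phi> * H1_norm D (\<lambda>x. \<xi> x - s n x)"
      using L2_norm_le_H1_norm[of D "\<lambda>x. \<xi> x - s n x"] L2_norm_wgrad[OF assms(1,2) d, of n]
        order_trans[OF L2_norm_nonneg L2_norm_le_H1_norm(1), of D "\<lambda>x. \<xi> x - s n x"]
      by (intro add_mono mult_mono) auto
    finally show ?thesis by (simp add: algebra_simps)
  qed
  have "(\<lambda>n. H1_norm D (\<lambda>x. \<xi> x - s n x) * (L2_norm D (gradient \<phi>) + L2_norm D \<phi>)) \<longlonglongrightarrow> 0"
    using tendsto_mult_left_zero[OF lim] .
  then have "norm ?E \<le> 0"
    using E by (intro LIMSEQ_le_const) auto
  then show ?thesis by (simp add: eq_neg_iff_add_eq_0)
qed

lemma zero_ext_has_weak_gradient: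
  assumes "open D" "open \<Omega>" "bounded D" "D \<subseteq> \<Omega>" "\<xi> \<in> H10 D"
  shows "has_weak_gradient \<Omega> (zero_ext D \<xi>) (\<lambda>x. if x \<in> D then wgrad D \<xi> x else 0)"
proof -
  have D: "D \<in> sets lebesgue" "\<Omega> \<in> sets lebesgue" using assms by auto
  have \<xi>H1: "\<xi> \<in> H1 D" using assms(5) by (simp add: H10_def)
  have z: "zero_ext D \<xi> = (\<lambda>x. if x \<in> D then \<xi> x else 0)"
    by (auto simp: zero_ext_def)
  show ?thesis
    unfolding has_weak_gradient_def
  proof (intro conjI ballI)
    show "zero_ext D \<xi> \<in> L2 \<Omega>"
      unfolding z by (rule L2_zero_ext(1)[OF H1_L2(1)[OF \<xi>H1] assms(4) D])
    show "(\<lambda>x. if x \<in> D then wgrad D \<xi> x else 0) \<in> L2 \<Omega>"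
      by (rule L2_zero_ext(1)[OF H1_L2(2)[OF \<xi>H1] assms(4) D])
    fix \<phi> assume \<phi>: "\<phi> \<in> test_functions \<Omega>"
    have "(LINT x|lebesgue_on \<Omega>. zero_ext D \<xi> x *\<^sub>R gradient \<phi> x)
        = (LINT x|lebesgue_on \<Omega>. (if x \<in> D then \<xi> x *\<^sub>R gradient \<phi> x else 0))"
      by (intro Bochner_Integration.integral_cong) (auto simp: zero_ext_def)
    also have "\<dots> = (LINT x|lebesgue_on D. \<xi> x *\<^sub>R gradient \<phi> x)"
      by (rule integral_if_subset[OF assms(4) D])
    also have "\<dots> = - (LINT x|lebesgue_on D. \<phi> x *\<^sub>R wgrad D \<xi> x)"
      by (rule H10_integration_by_parts[OF assms(1,3,5) test_function_C1[OF \<phi>] test_function_bounded_support[OF \<phi>]])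
    also have "(LINT x|lebesgue_on D. \<phi> x *\<^sub>R wgrad D \<xi> x)
        = (LINT x|lebesgue_on \<Omega>. (if x \<in> D then \<phi> x *\<^sub>R wgrad D \<xi> x else 0))"
      by (rule integral_if_subset[OF assms(4) D, symmetric])
    also have "\<dots> = (LINT x|lebesgue_on \<Omega>. \<phi> x *\<^sub>R (if x \<in> D then wgrad D \<xi> x else 0))"
      by (intro Bochner_Integration.integral_cong) auto
    finally show "(LINT x|lebesgue_on \<Omega>. zero_ext D \<xi> x *\<^sub>R gradient \<phi> x)
        = - (LINT x|lebesgue_on \<Omega>. \<phi> x *\<^sub>R (if x \<in> D then wgrad D \<xi> x else 0))" .
  qed
qed

lemma zero_ext_H1:
  assumes "open D" "open \<Omega>" "bounded \<Omega>" "D \<subseteq> \<Omega>" "\<xi> \<in> H10 D"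
  shows "zero_ext D \<xi> \<in> H1 \<Omega>"
    and "L2_norm \<Omega> (zero_ext D \<xi>) = L2_norm D \<xi>"
    and "L2_norm \<Omega> (wgrad \<Omega> (zero_ext D \<xi>)) = L2_norm D (wgrad D \<xi>)"
proof -
  have D: "D \<in> sets lebesgue" "\<Omega> \<in> sets lebesgue" "bounded D"
    using assms bounded_subset by auto
  have \<xi>H1: "\<xi> \<in> H1 D" using assms(5) by (simp add: H10_def)
  note wg = zero_ext_has_weak_gradient[OF assms(1,2) D(3) assms(4,5)]
  show "zero_ext D \<xi> \<in> H1 \<Omega>" using wg by (rule has_weak_gradient_H1)
  have z: "zero_ext D \<xi> = (\<lambda>x. if x \<in> D then \<xi> x else 0)"
    by (auto simp: zero_ext_def)
  show "L2_norm \<Omega> (zero_ext D \<xi>) = L2_norm D \<xi>"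
    unfolding z by (rule L2_zero_ext(2)[OF H1_L2(1)[OF \<xi>H1] assms(4) D(1,2)])
  show "L2_norm \<Omega> (wgrad \<Omega> (zero_ext D \<xi>)) = L2_norm D (wgrad D \<xi>)"
    unfolding L2_norm_wgrad[OF assms(2,3) wg]
    by (rule L2_zero_ext(2)[OF H1_L2(2)[OF \<xi>H1] assms(4) D(1,2)])
qed

section \<open>The half-plane integral of the gradient of a bump\<close>

lemma integral_linear_change:
  fixes F :: "real^2 \<Rightarrow> real^2"
  assumes "linear g" "det (matrix g) \<noteq> 0" "integrable lebesgue F"
  shows "(LINT x|lebesgue. F x) = \<bar>det (matrix g)\<bar> *\<^sub>R (LINT x|lebesgue. F (g x))"
    and "integrable lebesgue (\<lambda>x. F (g x))"
proof -
  have "inj g" using det_nz_iff_inj[OF assms(1)] assms(2) by blast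
  then have g: "g ` UNIV = UNIV"
    using linear_injective_imp_surjective[OF assms(1)] by simp
  have F: "F absolutely_integrable_on UNIV"
    using assms(3) by (simp add: set_integrable_def)
  then have "(F \<circ> g) absolutely_integrable_on UNIV"
    using absolutely_integrable_on_linear_image[OF assms(1), where f = F and S = UNIV] assms(2) g by simp
  then show int: "integrable lebesgue (\<lambda>x. F (g x))"
    by (simp add: set_integrable_def o_def)
  have "integral UNIV F = \<bar>det (matrix g)\<bar> *\<^sub>R integral UNIV (F \<circ> g)"
    using integral_change_of_variables_linear[OF assms(1), where f = F and S = UNIV] F g by simp
  then show "(LINT x|lebesgue. F x) = \<bar>det (matrix g)\<bar> *\<^sub>R (LINT x|lebesgue. F (g x))"
    using integral_lebesgue[OF assms(3)] integral_lebesgue[OF int] by (simp add: o_def)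
qed

lemma bump_C1: "r > 0 \<Longrightarrow> C1 (bump m r)"
  by (rule test_function_C1[OF bump_test_function[of r m UNIV]]) auto

text \<open>
  Inside a small ball around the midpoint of an edge, a triangle coincides with the half-plane on the
  inner side of that edge; integrals over the triangle turn into integrals of this function.
\<close>

definition half_bump :: "real^2 \<Rightarrow> real \<Rightarrow> real^2 \<Rightarrow> real^2 \<Rightarrow> real^2" where
  "half_bump m r n x = indicator {x. n \<bullet> (x - m) \<le> 0} x *\<^sub>R gradient (bump m r) x"

lemma half_bump_integrable:
  assumes "r > 0"
  shows "half_bump m r n \<in> borel_measurable borel" "integrable lebesgue (half_bump m r n)"
proof -
  have cont: "continuous_on UNIV (gradient (bump m r))"
    using bump_C1[OF assms] by (simp add: C1_def)
  have cl: "closed {x. n \<bullet> (x - m) \<le> 0}"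
    by (intro closed_Collect_le continuous_intros)
  have b: "gradient (bump m r) \<in> borel_measurable borel"
    by (rule borel_measurable_continuous_onI[OF cont])
  show "half_bump m r n \<in> borel_measurable borel"
    unfolding half_bump_def[abs_def] using b cl by measurable
  have "bounded {x. gradient (bump m r) x \<noteq> 0}"
    by (rule bounded_subset[OF bounded_ball[of m r]]) (use bump_gradient_outside[OF assms] in blast)
  then have "integrable lebesgue (gradient (bump m r))"
    using continuous_bounded_support_integrable[OF cont] by simp
  then show "integrable lebesgue (half_bump m r n)"
    unfolding half_bump_def[abs_def] using cl by (intro integrable_mult_indicator) auto
qed

lemma half_bump_unit:
  "half_bump 0 1 (axis 2 1) y
    = (indicator {y. y $ 2 \<le> 0} y * flat 2 (1 - (norm y)\<^sup>2) * (-2)) *\<^sub>R y"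
  by (simp add: half_bump_def bump_gradient inner_axis' indicator_def)

text \<open>
  Reflection in the vertical axis preserves the half-plane and reverses the horizontal component.
\<close>

lemma half_bump_tangential_flux: "(LINT y|lebesgue. half_bump 0 1 (axis 2 1) y) $ 1 = 0"
proof -
  let ?G = "half_bump 0 1 (axis 2 1)"
  let ?g = "\<lambda>y::real^2. (\<chi> i. if i = 1 then - (y $ 1) else y $ i) :: real^2"
  have lin: "linear ?g"
    by (rule linearI) (auto simp: vec_eq_iff)
  have det: "det (matrix ?g) = -1"
    by (simp add: det_2 matrix_def axis_def)
  have norm: "norm (?g y) = norm y" for y
    by (simp add: norm_vec_def L2_set_def sum_2)
  have G: "?G (?g y) $ 1 = - (?G y $ 1)" for y
    unfolding half_bump_unit norm by (simp add: indicator_def)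
  note int = half_bump_integrable(2)[OF zero_less_one, of 0 "axis 2 1"]
  have comp: "(LINT y|lebesgue. F y) $ 1 = (LINT y|lebesgue. F y $ 1)" if "integrable lebesgue F" for F :: "real^2 \<Rightarrow> real^2"
    using integral_bounded_linear[OF bounded_linear_vec_nth that, of 1] by simp
  have "(LINT y|lebesgue. ?G y) = (LINT y|lebesgue. ?G (?g y))"
    using integral_linear_change(1)[OF lin _ int] det by simp
  also have "\<dots> $ 1 = (LINT y|lebesgue. ?G (?g y) $ 1)"
    using integral_linear_change(2)[OF lin _ int] det by (intro comp) simp
  also have "\<dots> = - (LINT y|lebesgue. ?G y $ 1)"
    unfolding G by simp
  finally show ?thesis using comp[OF int] by simp
qed

text \<open>
  A radial bump decreases away from its centre, so its vertical derivative is nonnegative on the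
  lower half-plane and positive in the lower half of the ball.
\<close>

lemma half_bump_flux_pos: "(LINT y|lebesgue. half_bump 0 1 (axis 2 1) y) $ 2 > 0"
proof -
  let ?G = "half_bump 0 1 (axis 2 1)"
  let ?k = "\<lambda>y. ?G y $ 2"
  note int = half_bump_integrable(2)[OF zero_less_one, of 0 "axis 2 1"]
  have comp: "(LINT y|lebesgue. ?G y) $ 2 = (LINT y|lebesgue. ?k y)"
    using integral_bounded_linear[OF bounded_linear_vec_nth int, of 2] by simp
  have intk: "integrable lebesgue ?k"
    using integrable_bounded_linear[OF bounded_linear_vec_nth int, of 2] by simp
  have nonneg: "0 \<le> ?k y" for y
    unfolding half_bump_unit by (auto simp: indicator_def flat_nonneg mult_nonneg_nonpos mult_nonpos_nonneg)
  define U where "U = ball 0 1 \<inter> {y::real^2. y $ 2 < 0}"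
  have "open U" unfolding U_def by (intro open_Int open_ball open_Collect_less continuous_intros)
  moreover have "- (1 / 2) *\<^sub>R axis 2 1 \<in> U"
    by (simp add: U_def norm_axis_1)
  ultimately have U: "\<not> negligible U" "U \<in> sets lebesgue" using open_not_negligible by auto
  have pos: "?k y \<noteq> 0" if "y \<in> U" for y
  proof -
    have "(norm y)\<^sup>2 < 1" using that norm_sq_less[of 1 y] by (simp add: U_def)
    then show ?thesis using that unfolding half_bump_unit by (auto simp: U_def flat_def)
  qed
  have "(LINT y|lebesgue. ?k y) \<noteq> 0"
  proof
    assume "(LINT y|lebesgue. ?k y) = 0"
    then have "AE y in lebesgue. ?k y = 0"
      using integral_nonneg_eq_0_iff_AE[OF intk] nonneg by simp
    then have "AE y in lebesgue. y \<notin> U"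
      by eventually_elim (use pos in blast)
    then have "U \<in> null_sets lebesgue" using AE_iff_null_sets[OF U(2)] by simp
    then show False using U(1) negligible_iff_null_sets by blast
  qed
  moreover have "0 \<le> (LINT y|lebesgue. ?k y)" using nonneg by simp
  ultimately show ?thesis using comp by simp
qed

lemma integral_translation_lebesgue:
  fixes f :: "real^2 \<Rightarrow> 'b::euclidean_space"
  assumes [measurable]: "f \<in> borel_measurable borel"
  shows "(LINT x|lebesgue. f x) = (LINT x|lebesgue. f (m + x))"
proof -
  have "(LINT x|lebesgue. f x) = (LINT x|lborel. f x)"
    by (intro integral_completion) simp
  also have "\<dots> = (LINT x|lborel. f (m + x))"
    by (rule integral_translation[symmetric]) simp
  also have "\<dots> = (LINT x|lebesgue. f (m + x))"
    by (intro integral_completion[symmetric]) simp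
  finally show ?thesis .
qed

lemma integrable_translation_lebesgue:
  fixes f :: "real^2 \<Rightarrow> 'b::euclidean_space"
  assumes [measurable]: "f \<in> borel_measurable borel" and "integrable lebesgue f"
  shows "integrable lebesgue (\<lambda>x. f (m + x))"
proof -
  have "integrable (distr lborel borel ((+) m)) f"
    using assms integrable_completion[of f lborel] by (simp add: lborel_distr_plus)
  then have "integrable lborel (\<lambda>x. f (m + x))"
    by (subst (asm) integrable_distr_eq) auto
  then show ?thesis by (subst integrable_completion) auto
qed

text \<open>
  The similarity that maps the unit disc to the disc of radius \<open>r\<close> about \<open>m\<close> and the second
  coordinate direction to \<open>n\<close> contributes the factor \<open>r\<^sup>2\<close> through its determinant and \<open>1/r\<close> through the
  gradient.  The constant is therefore the same for all edges of all meshes.  It equals the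
  integral of the bump over the segment cut out by the line, divided by \<open>r\<close>.
\<close>

lemma half_bump_integral:
  assumes "r > 0" "norm n = 1"
  shows "(LINT x|lebesgue. half_bump m r n x)
    = ((LINT y|lebesgue. half_bump 0 1 (axis 2 1) y) $ 2 * r) *\<^sub>R n"
proof -
  let ?G = "half_bump 0 1 (axis 2 1)"
  let ?F = "half_bump m r n"
  let ?\<kappa> = "(LINT y|lebesgue. ?G y) $ 2"
  \<comment> \<open>The rotation with second column n.\<close>
  define Q :: "real^2 \<Rightarrow> real^2" where
    "Q y = (\<chi> i. if i = 1 then y $ 1 * n $ 2 + y $ 2 * n $ 1 else - (y $ 1 * n $ 1) + y $ 2 * n $ 2)" for y
  have n: "(n $ 1)\<^sup>2 + (n $ 2)\<^sup>2 = 1"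
    using assms(2) by (simp add: norm_vec_def L2_set_def sum_2)
  have Q12: "Q y $ 1 = y $ 1 * n $ 2 + y $ 2 * n $ 1" "Q y $ 2 = - (y $ 1 * n $ 1) + y $ 2 * n $ 2" for y
    by (simp_all add: Q_def)
  have linQ: "linear Q"
    by (rule linearI) (auto simp: vec_eq_iff forall_2 Q12 algebra_simps)
  let ?g = "\<lambda>y. r *\<^sub>R Q y"
  have ling: "linear ?g"
    using linQ by (simp add: linear_compose_scale_right)
  have det: "det (matrix ?g) = r\<^sup>2"
  proof -
    have "det (matrix ?g) = r\<^sup>2 * ((n $ 1)\<^sup>2 + (n $ 2)\<^sup>2)"
      by (simp add: det_2 matrix_def axis_def Q12 power2_eq_square algebra_simps)
    then show ?thesis by (simp add: n)
  qed
  have normQ: "norm (Q y) = norm y" for y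
  proof -
    have "(Q y $ 1)\<^sup>2 + (Q y $ 2)\<^sup>2 = ((n $ 1)\<^sup>2 + (n $ 2)\<^sup>2) * ((y $ 1)\<^sup>2 + (y $ 2)\<^sup>2)"
      unfolding Q12 by (simp add: power2_eq_square algebra_simps)
    then show ?thesis by (simp add: n norm_vec_def L2_set_def sum_2)
  qed
  have nQ: "n \<bullet> Q y = y $ 2" for y
  proof -
    have "n \<bullet> Q y = ((n $ 1)\<^sup>2 + (n $ 2)\<^sup>2) * y $ 2"
      by (simp add: inner_vec_def sum_2 Q12 power2_eq_square algebra_simps)
    then show ?thesis by (simp add: n)
  qed
  have F: "?F (m + ?g y) = (1 / r) *\<^sub>R Q (?G y)" for y
  proof -
    have "?F (m + ?g y) = indicator {y. y $ 2 \<le> 0} y *\<^sub>R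
        (flat 2 (1 - (norm y)\<^sup>2) *\<^sub>R (- (2 / r\<^sup>2) *\<^sub>R (r *\<^sub>R Q y)))"
      using assms(1) by (simp add: half_bump_def bump_gradient nQ normQ indicator_def mult_le_0_iff
          power_mult_distrib)
    also have "\<dots> = (1 / r) *\<^sub>R (indicator {y. y $ 2 \<le> 0} y * flat 2 (1 - (norm y)\<^sup>2) * (-2)) *\<^sub>R Q y"
      using assms(1) by (simp add: power2_eq_square)
    also have "\<dots> = (1 / r) *\<^sub>R Q (?G y)"
      unfolding half_bump_unit linear_cmul[OF linQ] ..
    finally show ?thesis .
  qed
  note intF = half_bump_integrable(2)[OF assms(1), of m n]
  have intF': "integrable lebesgue (\<lambda>x. ?F (m + x))"
    by (rule integrable_translation_lebesgue[OF half_bump_integrable(1)[OF assms(1)] intF])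
  note intG = half_bump_integrable(2)[OF zero_less_one, of 0 "axis 2 1"]
  have "(LINT x|lebesgue. ?F x) = (LINT x|lebesgue. ?F (m + x))"
    by (rule integral_translation_lebesgue[OF half_bump_integrable(1)[OF assms(1)]])
  also have "\<dots> = r\<^sup>2 *\<^sub>R (LINT y|lebesgue. ?F (m + ?g y))"
    using integral_linear_change(1)[OF ling _ intF'] det assms(1) by simp
  also have "\<dots> = r\<^sup>2 *\<^sub>R (1 / r) *\<^sub>R (LINT y|lebesgue. Q (?G y))"
    unfolding F by simp
  also have "(LINT y|lebesgue. Q (?G y)) = Q (LINT y|lebesgue. ?G y)"
    using integral_bounded_linear[OF linear_conv_bounded_linear[THEN iffD1, OF linQ] intG] .
  also have "\<dots> = ?\<kappa> *\<^sub>R n"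
    by (simp add: vec_eq_iff forall_2 Q12 half_bump_tangential_flux)
  finally show ?thesis using assms(1) by (simp add: power2_eq_square)
qed

section \<open>Geometry of adjacent triangles\<close>

lemma simplex_polytope_convex_compact:
  fixes T :: "'a::euclidean_space set"
  assumes "n simplex T"
  shows "polytope T" "convex T" "compact T"
  using simplex_imp_polytope[OF assms] polytope_imp_convex polytope_imp_compact by auto

lemma diameter_segment:
  fixes a b :: "'a::euclidean_space"
  shows "diameter (closed_segment a b) = dist a b"
proof (rule antisym)
  have "closed_segment a b \<subseteq> cball (midpoint a b) (dist a b / 2)"
    by (intro closed_segment_subset) (auto simp: dist_midpoint)
  then have "diameter (closed_segment a b) \<le> diameter (cball (midpoint a b) (dist a b / 2))"
    by (rule diameter_subset) simp
  then show "diameter (closed_segment a b) \<le> dist a b" by (simp add: diameter_cball)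
  show "dist a b \<le> diameter (closed_segment a b)"
    by (rule diameter_bounded_bound) (auto intro: compact_imp_bounded)
qed

lemma edge_is_segment:
  fixes T :: "(real^2) set"
  assumes "2 simplex T" "e edge_of T"
  obtains a b where "a \<noteq> b" "e = closed_segment a b"
proof -
  note T = simplex_polytope_convex_compact[OF assms(1)]
  have e: "e face_of T" "aff_dim e = 1" using assms(2) by (auto simp: edge_of_def)
  have "compact e" "convex e" using face_of_imp_compact face_of_imp_convex T e by auto
  moreover have "collinear e" using e(2) by (simp add: collinear_aff_dim)
  moreover have "e \<noteq> {}" using e(2) by auto
  ultimately obtain a b where ab: "e = closed_segment a b"
    using compact_convex_collinear_segment by metis
  moreover have "a \<noteq> b" using e(2) ab by auto
  ultimately show thesis using that by blast
qed

lemma unit_normals_2D: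
  fixes n n' v :: "real^2"
  assumes "norm n = 1" "norm n' = 1" "n \<bullet> v = 0" "n' \<bullet> v = 0" "v \<noteq> 0"
  shows "n' = n \<or> n' = - n"
proof -
  have "(n $ 1)\<^sup>2 + (n $ 2)\<^sup>2 = 1" "(n' $ 1)\<^sup>2 + (n' $ 2)\<^sup>2 = 1"
    using assms by (simp_all add: norm_vec_def L2_set_def sum_2)
  moreover have "n $ 1 * v $ 1 + n $ 2 * v $ 2 = 0" "n' $ 1 * v $ 1 + n' $ 2 * v $ 2 = 0"
    using assms by (simp_all add: inner_vec_def sum_2)
  moreover have v: "v $ 1 \<noteq> 0 \<or> v $ 2 \<noteq> 0"
    using assms(5) by (simp add: vec_eq_iff forall_2)
  ultimately have "n' $ 1 * n $ 2 = n' $ 2 * n $ 1"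
    by algebra
  then have c: "n' $ 1 * n $ 2 - n' $ 2 * n $ 1 = 0" by simp
  define s where "s = n \<bullet> n'"
  have "n' = s *\<^sub>R n"
    using \<open>(n $ 1)\<^sup>2 + (n $ 2)\<^sup>2 = 1\<close> c
    unfolding s_def vec_eq_iff forall_2 inner_vec_def sum_2 vector_scaleR_component real_scaleR_def inner_real_def
    by (intro conjI; algebra)
  moreover from this have "\<bar>s\<bar> = 1" using assms by (metis mult.right_neutral norm_scaleR)
  ultimately show ?thesis by (auto simp: abs_if split: if_splits)
qed

lemma orthogonal_to_normal_2D:
  fixes n u v :: "real^2"
  assumes "norm n = 1" "n \<bullet> u = 0" "n \<bullet> v = 0" "v \<noteq> 0"
  obtains \<tau> where "u = \<tau> *\<^sub>R v"
proof (cases "u = 0")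
  case True
  then show thesis using that[of 0] by simp
next
  case False
  have "sgn v = sgn u \<or> sgn v = - sgn u"
    by (rule unit_normals_2D[of _ _ n])
      (use assms False in \<open>auto simp: norm_sgn sgn_div_norm inner_commute\<close>)
  then have "sgn u = sgn v \<or> sgn u = - sgn v" by (metis minus_minus)
  moreover have "u = norm u *\<^sub>R sgn u" using False by (simp add: sgn_div_norm)
  ultimately have "u = norm u *\<^sub>R sgn v \<or> u = norm u *\<^sub>R (- sgn v)" by metis
  moreover have "norm u *\<^sub>R sgn v = (norm u / norm v) *\<^sub>R v"
    "norm u *\<^sub>R (- sgn v) = (- norm u / norm v) *\<^sub>R v"
    by (simp_all add: sgn_div_norm divide_inverse)
  ultimately show thesis using that by metis
qed

lemma simplex_interior_nonempty:
  fixes T :: "(real^2) set"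
  assumes "2 simplex T"
  shows "interior T \<noteq> {}"
proof -
  have "aff_dim T = 2" using aff_dim_simplex[OF assms] by simp
  then show ?thesis
    using interior_rel_interior_gen[of T] rel_interior_eq_empty[of T] simplex_polytope_convex_compact(2)[OF assms]
    by auto
qed

text \<open>
  An edge is an exposed face, so a supporting line has a unit normal as required.  Any other one is
  orthogonal to the edge too, hence equal or opposite, and the opposite one would confine the
  triangle to a line.
\<close>

lemma outward_normal:
  fixes T :: "(real^2) set"
  assumes "2 simplex T" "e edge_of T"
  shows "norm (outward_normal T e) = 1"
    and "\<And>x y. x \<in> e \<Longrightarrow> y \<in> T \<Longrightarrow> outward_normal T e \<bullet> (y - x) \<le> 0"
proof -
  let ?P = "\<lambda>n. norm n = 1 \<and> (\<forall>x\<in>e. \<forall>y\<in>T. n \<bullet> (y - x) \<le> 0)"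
  note T = simplex_polytope_convex_compact[OF assms(1)]
  have e: "e face_of T" "aff_dim e = 1" "e \<subseteq> T"
    using assms(2) edge_of_imp_subset by (auto simp: edge_of_def)
  obtain a b where ab: "a \<noteq> b" "e = closed_segment a b" by (rule edge_is_segment[OF assms])
  then have abe: "a \<in> e" "b \<in> e" "a \<in> T" "b \<in> T" using e(3) by auto
  have "e exposed_face_of T"
    using e(1) exposed_face_of_polyhedron[OF polytope_imp_polyhedron[OF T(1)]] by blast
  then obtain c d where cd: "T \<subseteq> {x. c \<bullet> x \<le> d}" "e = T \<inter> {x. c \<bullet> x = d}"
    unfolding exposed_face_of_def by blast
  have "c \<noteq> 0"
  proof
    assume "c = 0"
    then have "e = T" using cd abe by auto
    then show False using e(2) aff_dim_simplex[OF assms(1)] by simp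
  qed
  have "?P (sgn c)"
  proof (intro conjI ballI)
    show "norm (sgn c) = 1" using \<open>c \<noteq> 0\<close> by (simp add: norm_sgn)
    fix x y assume "x \<in> e" "y \<in> T"
    then have "c \<bullet> (y - x) \<le> 0" using cd by (auto simp: inner_diff_right)
    then show "sgn c \<bullet> (y - x) \<le> 0"
      by (simp add: sgn_div_norm mult_nonneg_nonpos)
  qed
  moreover have "n' = n" if n: "?P n" and n': "?P n'" for n n'
  proof -
    have "n \<bullet> (b - a) = 0" "n' \<bullet> (b - a) = 0"
    proof -
      have "n \<bullet> (b - a) \<le> 0" "n \<bullet> (a - b) \<le> 0" "n' \<bullet> (b - a) \<le> 0" "n' \<bullet> (a - b) \<le> 0"
        using n n' abe by blast+
      then show "n \<bullet> (b - a) = 0" "n' \<bullet> (b - a) = 0" unfolding inner_diff_right by linarith+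
    qed
    then have "n' = n \<or> n' = - n"
      using unit_normals_2D[of n n' "b - a"] n n' ab(1) by auto
    moreover have "n' \<noteq> - n"
    proof
      assume "n' = - n"
      then have "T \<subseteq> {x. n \<bullet> x = n \<bullet> a}"
        using n n' abe(1) by (force simp: inner_diff_right)
      then have "interior T \<subseteq> interior {x. n \<bullet> x = n \<bullet> a}" by (rule interior_mono)
      moreover have "n \<noteq> 0" using n by auto
      ultimately show False
        using simplex_interior_nonempty[OF assms(1)] interior_hyperplane[of n] by auto
    qed
    ultimately show ?thesis by blast
  qed
  ultimately have "?P (outward_normal T e)"
    unfolding outward_normal_def by (intro theI'[of ?P]) blast
  then show "norm (outward_normal T e) = 1"
    and "\<And>x y. x \<in> e \<Longrightarrow> y \<in> T \<Longrightarrow> outward_normal T e \<bullet> (y - x) \<le> 0" by auto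
qed

text \<open>
  The radius is a fixed fraction of the edge length because the triangle has a large inscribed disc.
  A point \<open>m + w\<close> of the half-disc lies on the line through the centre \<open>x0\<close> and a point \<open>m + u\<close> of the line
  through \<open>a\<close> and \<open>b\<close>, with weight \<open>\<gamma>\<close> at \<open>x0\<close> given by the ratio of the distances to that line.  As \<open>\<gamma>\<close> is at most
  \<open>r / \<rho>\<close>, the offset \<open>u\<close> is at most half an edge length, so \<open>m + u\<close> belongs to the edge.
\<close>

lemma half_disc_in_convex:
  fixes T :: "(real^2) set"
  assumes T: "convex T" "bounded T" and ab: "a \<in> T" "b \<in> T" "a \<noteq> b"
    and n: "norm n = 1" "n \<bullet> (b - a) = 0" "\<And>y. y \<in> T \<Longrightarrow> n \<bullet> (y - a) \<le> 0"
    and ball: "cball x0 \<rho> \<subseteq> T" "\<rho> > 0" "diameter T \<le> s * \<rho>" "s > 0"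
    and r: "r * (2 + 3 * s) \<le> dist a b"
    and w: "norm w < r" "n \<bullet> w \<le> 0"
  shows "midpoint a b + w \<in> T"
proof -
  define m where "m = midpoint a b"
  define h where "h = dist a b"
  define H where "H = - (n \<bullet> (x0 - a))"
  define \<gamma> where "\<gamma> = - (n \<bullet> w) / H"
  have mT: "m \<in> T" unfolding m_def
    using ab T(1) by (meson closed_segment_subset midpoint_in_closed_segment subsetD)
  have x0T: "x0 \<in> T" using ball by (auto simp: subset_iff)
  have "x0 + \<rho> *\<^sub>R n \<in> T" using ball n(1) by (auto simp: subset_iff dist_norm)
  then have H: "\<rho> \<le> H" using n(3)[of "x0 + \<rho> *\<^sub>R n"] n(1)
    by (simp add: H_def inner_diff_right inner_add_right dot_square_norm)
  have h: "h > 0" using ab(3) by (simp add: h_def)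
  have hd: "h \<le> diameter T" "norm (x0 - m) \<le> diameter T"
    using diameter_bounded_bound[OF T(2)] ab mT x0T by (auto simp: h_def simp flip: dist_norm)
  have r0: "r > 0" using w(1) norm_ge_zero[of w] by linarith
  have nm: "n \<bullet> (m - a) = 0"
    using n(2) by (simp add: m_def midpoint_def inner_diff_right inner_add_right)
  have nw: "- (n \<bullet> w) \<le> r" using Cauchy_Schwarz_ineq2[of n w] w(1) n(1) by simp
  have \<gamma>0: "0 \<le> \<gamma>" using w(2) H ball(2) by (auto simp: \<gamma>_def intro!: divide_nonpos_pos)
  have \<gamma>r: "\<gamma> * \<rho> \<le> r"
  proof -
    have "\<gamma> * \<rho> \<le> \<gamma> * H" using H \<gamma>0 by (rule mult_left_mono)
    also have "\<dots> = - (n \<bullet> w)" using H ball(2) by (simp add: \<gamma>_def)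
    finally show ?thesis using nw by linarith
  qed
  have \<gamma>d: "\<gamma> * diameter T \<le> r * s"
  proof -
    have "\<gamma> * diameter T \<le> \<gamma> * (s * \<rho>)" by (rule mult_left_mono[OF ball(3) \<gamma>0])
    also have "\<dots> = (\<gamma> * \<rho>) * s" by simp
    also have "\<dots> \<le> r * s" using \<gamma>r ball(4) by (intro mult_right_mono) auto
    finally show ?thesis .
  qed
  have \<gamma>h: "\<gamma> * h \<le> r * s" using mult_left_mono[OF hd(1) \<gamma>0] \<gamma>d by linarith
  have rs: "2 * r + 3 * (r * s) \<le> h" using r by (simp add: h_def algebra_simps)
  have "r * s > 0" using r0 ball(4) by simp
  then have "\<gamma> * h < 1 * h" using \<gamma>h rs r0 by linarith
  then have \<gamma>1: "\<gamma> < 1" using h by (simp add: mult_less_cancel_right_pos)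
  define X where "X = w - \<gamma> *\<^sub>R (x0 - m)"
  define u where "u = (1 / (1 - \<gamma>)) *\<^sub>R X"
  have nu: "n \<bullet> u = 0"
  proof -
    have "n \<bullet> (x0 - m) = - H" using nm by (simp add: H_def inner_diff_right)
    then have "n \<bullet> (w - \<gamma> *\<^sub>R (x0 - m)) = n \<bullet> w + \<gamma> * H"
      by (simp add: inner_diff_right)
    also have "\<dots> = 0" using H ball(2) by (simp add: \<gamma>_def)
    finally show ?thesis by (simp add: u_def X_def)
  qed
  have "norm (w - \<gamma> *\<^sub>R (x0 - m)) \<le> norm w + \<gamma> * norm (x0 - m)"
    using norm_triangle_ineq4[of w "\<gamma> *\<^sub>R (x0 - m)"] \<gamma>0 by simp
  also have "\<dots> \<le> r + r * s"
    using w(1) mult_left_mono[OF hd(2) \<gamma>0] \<gamma>d by linarith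
  also have "\<dots> \<le> (1 - \<gamma>) * (h / 2)"
    using rs \<gamma>h by (simp add: algebra_simps)
  finally have "norm X \<le> (1 - \<gamma>) * (h / 2)" by (simp only: X_def)
  moreover have "norm u = norm X / (1 - \<gamma>)" using \<gamma>1 by (simp add: u_def)
  ultimately have normu: "norm u \<le> h / 2"
    using \<gamma>1 by (simp add: divide_le_eq mult.commute)
  obtain \<tau> where \<tau>: "u = \<tau> *\<^sub>R (b - a)"
    using orthogonal_to_normal_2D[OF n(1) nu n(2)] ab(3) by auto
  have "\<bar>\<tau>\<bar> * h \<le> (1 / 2) * h"
    using normu \<tau> by (simp add: h_def dist_norm norm_minus_commute)
  then have \<tau>2: "\<bar>\<tau>\<bar> \<le> 1 / 2" using h by (simp add: mult_le_cancel_right)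
  have z: "m + u \<in> T"
  proof -
    have "m + u = (1 - (1 / 2 + \<tau>)) *\<^sub>R a + (1 / 2 + \<tau>) *\<^sub>R b"
      by (simp add: m_def midpoint_def \<tau> algebra_simps flip: scaleR_2)
    also have "\<dots> \<in> closed_segment a b"
      using \<tau>2 by (auto simp: closed_segment_def intro!: exI[of _ "1 / 2 + \<tau>"])
    finally show ?thesis using ab T(1) closed_segment_subset by blast
  qed
  have "m + w = \<gamma> *\<^sub>R x0 + (1 - \<gamma>) *\<^sub>R (m + u)"
    using \<gamma>1 by (simp add: u_def X_def scaleR_add_right scaleR_diff_right scaleR_diff_left)
  also have "\<dots> \<in> T"
    using convexD[OF T(1) x0T z, of \<gamma> "1 - \<gamma>"] \<gamma>0 \<gamma>1 by simp
  finally show ?thesis by (simp add: m_def)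
qed

lemma distinct_simplices_overlap:
  fixes T T' :: "(real^2) set"
  assumes "triangulation \<T>" "T \<in> \<T>" "T' \<in> \<T>" "2 simplex T" "2 simplex T'" "T \<noteq> T'"
  shows "interior (T \<inter> T') = {}" "negligible (T \<inter> T')"
proof -
  have conv: "convex T" "convex T'" using assms simplex_polytope_convex_compact(2) by auto
  have faces: "(T \<inter> T') face_of T" "(T \<inter> T') face_of T'"
    using assms(1-3) unfolding triangulation_def by (metis Int_commute)+
  show *: "interior (T \<inter> T') = {}"
  proof (rule ccontr)
    assume "interior (T \<inter> T') \<noteq> {}"
    then have dim: "aff_dim (T \<inter> T') = 2" using aff_dim_nonempty_interior by fastforce
    have "T \<inter> T' = T"
      using face_of_aff_dim_lt[OF conv(1) faces(1)] dim aff_dim_simplex[OF assms(4)] by fastforce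
    moreover have "T \<inter> T' = T'"
      using face_of_aff_dim_lt[OF conv(2) faces(2)] dim aff_dim_simplex[OF assms(5)] by fastforce
    ultimately show False using assms(6) by blast
  qed
  show "negligible (T \<inter> T')"
    using * negligible_convex_interior[OF convex_Int[OF conv]] by simp
qed

text \<open>
  The inball diameter is a supremum; any inscribed disc of more than half that diameter serves, which
  costs a factor two.
\<close>

lemma inball_exists:
  fixes T :: "(real^2) set"
  assumes "2 simplex T" "diameter T \<le> \<sigma> * inball_diameter T"
  obtains x0 \<rho> where "cball x0 \<rho> \<subseteq> T" "\<rho> > 0" "diameter T \<le> (4 * \<bar>\<sigma>\<bar> + 1) * \<rho>"
proof -
  have bT: "bounded T"
    by (rule compact_imp_bounded[OF simplex_polytope_convex_compact(3)[OF assms(1)]])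
  let ?R = "{r. 0 \<le> r \<and> (\<exists>x. cball x r \<subseteq> T)}"
  have bdd: "bdd_above ((\<lambda>r. 2 * r) ` ?R)"
  proof (rule bdd_aboveI2[of _ _ "diameter T"])
    fix r assume "r \<in> ?R"
    then obtain x where "cball x r \<subseteq> T" "0 \<le> r" by auto
    then show "2 * r \<le> diameter T"
      using diameter_subset[OF _ bT, of "cball x r"] by (simp add: diameter_cball)
  qed
  obtain x1 r1 where x1: "r1 > 0" "cball x1 r1 \<subseteq> T"
    using simplex_interior_nonempty[OF assms(1)] by (metis ex_in_conv mem_interior_cball)
  then have "r1 \<in> ?R" by auto
  then have "2 * r1 \<le> inball_diameter T"
    unfolding inball_diameter_def by (rule cSUP_upper[OF _ bdd])
  then have pos: "inball_diameter T > 0" using x1 by linarith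
  have ne: "?R \<noteq> {}" using \<open>r1 \<in> ?R\<close> by blast
  have "inball_diameter T / 2 < inball_diameter T" using pos by simp
  then have "\<exists>r\<in>?R. inball_diameter T / 2 < 2 * r"
    using less_cSUP_iff[OF ne bdd, of "inball_diameter T / 2"] unfolding inball_diameter_def by blast
  then obtain r x where r: "inball_diameter T / 2 < 2 * r" "cball x r \<subseteq> T" by auto
  then have rpos: "r > 0" using pos by linarith
  have "diameter T \<le> \<bar>\<sigma>\<bar> * inball_diameter T"
    using assms(2) mult_right_mono[of \<sigma> "\<bar>\<sigma>\<bar>" "inball_diameter T"] pos by linarith
  also have "\<dots> \<le> \<bar>\<sigma>\<bar> * (4 * r)" using r by (intro mult_left_mono) auto
  also have "\<dots> \<le> (4 * \<bar>\<sigma>\<bar> + 1) * r" using rpos by (simp add: algebra_simps)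
  finally show thesis using that r(2) rpos by blast
qed

text \<open>
  The two triangles lie on opposite sides of the common edge: on the same side, both would contain a
  half-disc at the midpoint, whereas their intersection is a proper face and has no interior.
\<close>

lemma interior_edge_geometry:
  fixes e :: "(real^2) set"
  assumes "triangulation \<T>" "\<And>T. T \<in> \<T> \<Longrightarrow> 2 simplex T"
    and shape: "\<And>T. T \<in> \<T> \<Longrightarrow> diameter T \<le> \<sigma> * inball_diameter T"
    and e: "e \<in> interior_edges \<T>"
    and q: "q = 2 + 3 * (4 * \<bar>\<sigma>\<bar> + 1)"
  obtains T1 T2 n m where "T1 \<noteq> T2" "patch \<T> e = {T1, T2}" "norm n = 1"
    "outward_normal T1 e = n" "outward_normal T2 e = - n" "0 < diameter e"
    "\<forall>x\<in>T1. n \<bullet> (x - m) \<le> 0" "\<forall>x\<in>T2. n \<bullet> (x - m) \<ge> 0"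
    "\<forall>x\<in>ball m (diameter e / q). n \<bullet> (x - m) \<le> 0 \<longrightarrow> x \<in> T1"
    "\<forall>x\<in>ball m (diameter e / q). n \<bullet> (x - m) \<ge> 0 \<longrightarrow> x \<in> T2"
proof -
  have "card (patch \<T> e) = 2" using e by (simp add: interior_edges_def)
  then obtain T1 T2 where P: "patch \<T> e = {T1, T2}" "T1 \<noteq> T2" by (auto simp: card_2_iff)
  then have "T1 \<in> patch \<T> e" "T2 \<in> patch \<T> e" by auto
  then have T: "T1 \<in> \<T>" "T2 \<in> \<T>" "e edge_of T1" "e edge_of T2" by (auto simp: patch_def)
  note s = assms(2)[OF T(1)] assms(2)[OF T(2)]
  obtain a b where ab: "a \<noteq> b" "e = closed_segment a b" by (rule edge_is_segment[OF s(1) T(3)])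
  have dia: "diameter e = dist a b" unfolding ab(2) by (rule diameter_segment)
  define m where "m = midpoint a b"
  define r where "r = diameter e / q"
  have me: "m \<in> e" by (simp add: m_def ab(2))
  have abe: "a \<in> e" "b \<in> e" using ab by auto
  have qpos: "q > 0" unfolding q by (simp add: algebra_simps add_nonneg_pos)
  have rq: "r * (2 + 3 * (4 * \<bar>\<sigma>\<bar> + 1)) \<le> dist a b"
    using qpos unfolding r_def dia q by simp
  have rpos: "r > 0" using qpos ab(1) by (simp add: r_def dia)
  have half: "m + w \<in> T" if "T \<in> \<T>" "e edge_of T" "norm w < r" "outward_normal T e \<bullet> w \<le> 0" for T w
  proof -
    note s = assms(2)[OF that(1)] and sh = shape[OF that(1)]
    note on = outward_normal[OF s that(2)]
    have eT: "e \<subseteq> T" using that(2) by (rule edge_of_imp_subset)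
    obtain x0 \<rho> where ball: "cball x0 \<rho> \<subseteq> T" "\<rho> > 0" "diameter T \<le> (4 * \<bar>\<sigma>\<bar> + 1) * \<rho>"
      by (rule inball_exists[OF s sh])
    have perp: "outward_normal T e \<bullet> (b - a) = 0"
      using on(2)[OF abe(1) subsetD[OF eT abe(2)]] on(2)[OF abe(2) subsetD[OF eT abe(1)]]
      unfolding inner_diff_right by linarith
    show ?thesis unfolding m_def
      by (rule half_disc_in_convex[OF _ _ _ _ ab(1) on(1) perp on(2)[OF abe(1)] ball _ rq that(3,4)])
        (use eT abe s in \<open>auto intro: simplex_polytope_convex_compact compact_imp_bounded\<close>)
  qed
  define n where "n = outward_normal T1 e"
  note on1 = outward_normal[OF s(1) T(3)] and on2 = outward_normal[OF s(2) T(4)]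
  have eT: "e \<subseteq> T1" "e \<subseteq> T2" using T edge_of_imp_subset by auto
  have "n \<bullet> (b - a) = 0" "outward_normal T2 e \<bullet> (b - a) = 0"
    using on1(2)[OF abe(1) subsetD[OF eT(1) abe(2)]] on1(2)[OF abe(2) subsetD[OF eT(1) abe(1)]]
      on2(2)[OF abe(1) subsetD[OF eT(2) abe(2)]] on2(2)[OF abe(2) subsetD[OF eT(2) abe(1)]]
    unfolding n_def inner_diff_right by linarith+
  then have "outward_normal T2 e = n \<or> outward_normal T2 e = - n"
    using unit_normals_2D[of n "outward_normal T2 e" "b - a"] on1(1) on2(1) ab(1) by (auto simp: n_def)
  moreover have "outward_normal T2 e \<noteq> n"
  proof
    assume same: "outward_normal T2 e = n"
    have "ball (m - (r / 2) *\<^sub>R n) (r / 2) \<subseteq> T1 \<inter> T2"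
    proof
      fix x assume "x \<in> ball (m - (r / 2) *\<^sub>R n) (r / 2)"
      then have v: "norm (x - m + (r / 2) *\<^sub>R n) < r / 2"
        by (simp add: dist_norm norm_minus_commute algebra_simps)
      have "norm (x - m) \<le> norm (x - m + (r / 2) *\<^sub>R n) + norm ((r / 2) *\<^sub>R n)"
        using norm_triangle_ineq4[of "x - m + (r / 2) *\<^sub>R n" "(r / 2) *\<^sub>R n"] by simp
      also have "\<dots> < r" using v on1(1) rpos by (simp add: n_def)
      finally have 1: "norm (x - m) < r" .
      have "n \<bullet> (x - m + (r / 2) *\<^sub>R n) \<le> r / 2"
        using norm_cauchy_schwarz[of n "x - m + (r / 2) *\<^sub>R n"] v on1(1) by (simp add: n_def)
      then have 2: "n \<bullet> (x - m) \<le> 0"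
        using on1(1) by (simp add: n_def inner_add_right dot_square_norm)
      show "x \<in> T1 \<inter> T2"
        using half[OF T(1,3) 1] half[OF T(2,4) 1] 2 same by (simp add: n_def)
    qed
    then have "interior (T1 \<inter> T2) \<noteq> {}"
      using interior_maximal[OF _ open_ball] rpos by (metis centre_in_ball empty_iff half_gt_zero subsetD)
    then show False
      using distinct_simplices_overlap(1)[OF assms(1) T(1,2) s P(2)] by blast
  qed
  ultimately have n2: "outward_normal T2 e = - n" by blast
  show thesis
  proof (rule that[OF P(2,1), of n m])
    show "norm n = 1" using on1 by (simp add: n_def)
    show "outward_normal T1 e = n" by (simp add: n_def)
    show "outward_normal T2 e = - n" by (rule n2)
    show "0 < diameter e" using ab(1) by (simp add: dia)
    show "\<forall>x\<in>T1. n \<bullet> (x - m) \<le> 0" using on1(2)[OF me] by (simp add: n_def)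
    show "\<forall>x\<in>T2. n \<bullet> (x - m) \<ge> 0" using on2(2)[OF me] n2 by simp
    show "\<forall>x\<in>ball m (diameter e / q). n \<bullet> (x - m) \<le> 0 \<longrightarrow> x \<in> T1"
    proof (intro ballI impI)
      fix x assume "x \<in> ball m (diameter e / q)" "n \<bullet> (x - m) \<le> 0"
      then show "x \<in> T1"
        using half[OF T(1,3), of "x - m"] by (simp add: r_def n_def dist_norm norm_minus_commute)
    qed
    show "\<forall>x\<in>ball m (diameter e / q). n \<bullet> (x - m) \<ge> 0 \<longrightarrow> x \<in> T2"
    proof (intro ballI impI)
      fix x assume "x \<in> ball m (diameter e / q)" "n \<bullet> (x - m) \<ge> 0"
      then show "x \<in> T2"
        using half[OF T(2,4), of "x - m"] n2 by (simp add: r_def dist_norm norm_minus_commute)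
    qed
  qed
qed

section \<open>Norms on triangles, patches and edges\<close>

lemma L2_restrict:
  fixes f :: "real^2 \<Rightarrow> 'b::euclidean_space"
  assumes "f \<in> L2 E" "T \<subseteq> E" "T \<in> sets lebesgue" "E \<in> sets lebesgue"
  shows "f \<in> L2 T" "L2_norm T f \<le> L2_norm E f"
proof -
  have m: "f \<in> borel_measurable (lebesgue_on T)"
    using measurable_restrict_mono[OF L2_measurable[OF assms(1)] assms(2)] .
  let ?g = "\<lambda>x. (norm (f x))\<^sup>2"
  note intE = L2_square_integrable[OF assms(1)]
  have "integrable (lebesgue_on E) (\<lambda>x. if x \<in> T then ?g x else 0)"
  proof (rule Bochner_Integration.integrable_bound[OF intE])
    have "?g \<in> borel_measurable (lebesgue_on T)" using m by measurable
    then show "(\<lambda>x. if x \<in> T then ?g x else 0) \<in> borel_measurable (lebesgue_on E)"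
      using borel_measurable_if_lebesgue_on[OF assms(3,4,2), of ?g] by blast
  qed auto
  then have intT: "integrable (lebesgue_on T) ?g"
    using integrable_if_subset[OF assms(2,3,4), of ?g] by blast
  then show "f \<in> L2 T" using m by (simp add: L2_def)
  have "(LINT x|lebesgue_on T. ?g x) = (LINT x|lebesgue_on E. (if x \<in> T then ?g x else 0))"
    by (rule integral_if_subset[OF assms(2-4), symmetric])
  also have "\<dots> \<le> (LINT x|lebesgue_on E. ?g x)"
    by (rule integral_mono[OF _ intE])
      (use intT integrable_if_subset[OF assms(2,3,4), of ?g] in auto)
  finally show "L2_norm T f \<le> L2_norm E f" by (simp add: L2_norm_def)
qed

lemma L2_cong_AE:
  fixes f g :: "real^2 \<Rightarrow> 'b::euclidean_space"
  assumes "f \<in> L2 T" "T \<in> sets lebesgue" "AE x in lebesgue_on T. f x = g x"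
  shows "g \<in> L2 T"
proof -
  have m: "(\<lambda>x. if x \<in> T then f x else 0) \<in> borel_measurable lebesgue"
    using borel_measurable_if_I[OF L2_measurable[OF assms(1)] assms(2)] .
  have ae: "AE x in lebesgue. (if x \<in> T then f x else 0) = (if x \<in> T then g x else 0)"
    using assms(3) AE_restrict_space_iff[of T lebesgue] assms(2) by (auto elim!: eventually_mono)
  have g: "g \<in> borel_measurable (lebesgue_on T)"
    by (rule borel_measurable_if_D[OF borel_measurable_AE[OF m ae]])
  have "AE x in lebesgue_on T. (norm (f x))\<^sup>2 = (norm (g x))\<^sup>2"
    using assms(3) by eventually_elim simp
  then have "integrable (lebesgue_on T) (\<lambda>x. (norm (g x))\<^sup>2)"
    using L2_square_integrable[OF assms(1)] L2_measurable[OF assms(1)] g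
    by (subst (asm) integrable_cong_AE) auto
  then show ?thesis using g by (simp add: L2_def)
qed

text \<open>
  Triangles are closed and may meet the boundary of \<open>\<Omega>\<close>, where the function is not controlled; that
  boundary is a null set because \<open>\<Omega>\<close> is convex.
\<close>

lemma L2_closure_subset:
  fixes f :: "real^2 \<Rightarrow> 'b::euclidean_space"
  assumes "open \<Omega>" "convex \<Omega>" "f \<in> L2 \<Omega>" "T \<subseteq> closure \<Omega>" "T \<in> sets lebesgue"
  shows "f \<in> L2 T"
proof -
  have \<Omega>: "\<Omega> \<in> sets lebesgue" using assms(1) by simp
  have "(\<lambda>x. if x \<in> \<Omega> then f x else 0) \<in> L2 UNIV"
    by (rule L2_zero_ext[OF assms(3) _ \<Omega>]) auto
  then have L: "(\<lambda>x. if x \<in> \<Omega> then f x else 0) \<in> L2 T"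
    by (rule L2_restrict) (use assms in auto)
  have "frontier \<Omega> \<in> null_sets lebesgue"
    using negligible_convex_frontier[OF assms(2)] negligible_iff_null_sets by blast
  then have "AE x in lebesgue. x \<notin> frontier \<Omega>" by (rule AE_not_in)
  then have "AE x in lebesgue_on T. x \<notin> frontier \<Omega>"
    using assms(5) by (subst AE_restrict_space_iff) auto
  then have "AE x in lebesgue_on T. (if x \<in> \<Omega> then f x else 0) = f x"
    using AE_space
  proof eventually_elim
    case (elim x)
    then show ?case using assms(1,4) by (auto simp: frontier_def interior_open)
  qed
  then show ?thesis by (rule L2_cong_AE[OF L assms(5)])
qed

lemma L2_norm_bounded_support:
  fixes F :: "real^2 \<Rightarrow> 'b::euclidean_space"
  assumes "F \<in> L2 S" "S \<in> sets lebesgue" "\<And>x. norm (F x) \<le> K" "\<And>x. x \<notin> ball m r \<Longrightarrow> F x = 0" "0 \<le> r"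
  shows "L2_norm S F \<le> K * r * sqrt pi"
proof -
  have K: "0 \<le> K" using assms(3)[of 0] norm_ge_zero order_trans by blast
  let ?g = "\<lambda>x. (norm (F x))\<^sup>2"
  have int: "integrable lebesgue (\<lambda>x. if x \<in> S then ?g x else 0)"
    using L2_square_integrable[OF assms(1)] Lebesgue_Measure.integrable_restrict_UNIV[OF assms(2), of ?g] by blast
  have fin: "emeasure lebesgue (ball m r) < \<infinity>"
    using emeasure_bounded_finite[OF bounded_ball[of m r]] by simp
  have "(LINT x|lebesgue_on S. ?g x) = (LINT x|lebesgue. (if x \<in> S then ?g x else 0))"
    by (rule Lebesgue_Measure.integral_restrict_UNIV[OF assms(2), symmetric])
  also have "\<dots> \<le> (LINT x|lebesgue. indicator (ball m r) x * K\<^sup>2)"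
  proof (rule integral_mono[OF int])
    show "integrable lebesgue (\<lambda>x. indicator (ball m r) x * K\<^sup>2)"
      using fin by (intro integrable_mult_left integrable_real_indicator) auto
    fix x
    show "(if x \<in> S then ?g x else 0) \<le> indicator (ball m r) x * K\<^sup>2"
      using assms(3)[of x] assms(4)[of x] by (cases "x \<in> ball m r") (auto intro: power_mono)
  qed
  also have "\<dots> = measure lebesgue (ball m r) * K\<^sup>2" by simp
  also have "measure lebesgue (ball m r) = pi * r\<^sup>2"
    using content_ball[OF assms(5), of m] by (simp add: unit_ball_vol_2)
  also have "pi * r\<^sup>2 * K\<^sup>2 = (K * r * sqrt pi)\<^sup>2" by (simp add: power_mult_distrib)
  finally show ?thesis unfolding L2_norm_def
    using real_sqrt_le_mono K assms(5) by fastforce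
qed

lemma broken_L2_norm_alt: "broken_L2_norm S w = sqrt (\<Sum>T\<in>S. (L2_norm T (w T))\<^sup>2)"
  by (simp add: broken_L2_norm_def L2_norm_square)

lemma L2_norm_le_broken:
  assumes "finite S" "T \<in> S"
  shows "L2_norm T (w T) \<le> broken_L2_norm S w"
  unfolding broken_L2_norm_alt
  using assms by (intro real_le_rsqrt member_le_sum[of T S "\<lambda>T. (L2_norm T (w T))\<^sup>2"]) auto

lemma edge_integral_const:
  assumes "e = closed_segment a b"
  shows "edge_integral e (\<lambda>x. K) = diameter e * K"
proof -
  define p where "p = (SOME p. e = closed_segment (fst p) (snd p))"
  have eq: "(SOME (a, b). e = closed_segment a b) = p"
    unfolding p_def by (rule arg_cong[of _ _ Eps]) auto
  have "e = closed_segment (fst p) (snd p)"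
    unfolding p_def by (rule someI[of "\<lambda>p. e = closed_segment (fst p) (snd p)" "(a, b)"]) (simp add: assms)
  then have "dist (fst p) (snd p) = diameter e" by (metis diameter_segment)
  moreover have "(LINT t|lebesgue_on {0..1::real}. K) = K"
    by (simp add: measure_restrict_space)
  ultimately show ?thesis
    unfolding edge_integral_def eq by (simp add: case_prod_beta)
qed

lemma divergence_const: "divergence (\<lambda>x. c) x = 0"
  by (simp add: divergence_def)

text \<open>
  The dual norm is a supremum of reals, hence meaningful only after boundedness of the quotients is
  known.  Both signs of \<open>\<phi>\<close> are admissible, which yields the absolute value and the nonnegativity of
  the norm.
\<close>

lemma Hm1_norm_bound:
  assumes "H1_norm D \<phi> > 0" "\<phi> \<in> H10 D" "(\<lambda>x. - \<phi> x) \<in> H10 D" "H1_norm D (\<lambda>x. - \<phi> x) = H1_norm D \<phi>"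
    and nz: "\<not> (AE x in lebesgue_on D. \<phi> x = 0)"
    and odd: "g (zero_ext D (\<lambda>x. - \<phi> x)) = - g (zero_ext D \<phi>)"
    and bdd: "\<And>\<xi>. \<xi> \<in> H10 D \<Longrightarrow> g (zero_ext D \<xi>) \<le> M * H1_norm D \<xi>" "0 \<le> M"
  shows "\<bar>g (zero_ext D \<phi>)\<bar> \<le> Hm1_norm D g * H1_norm D \<phi>" "0 \<le> Hm1_norm D g"
proof -
  let ?S = "{\<xi> \<in> H10 D. \<not> (AE x in lebesgue_on D. \<xi> x = 0)}"
  have b: "bdd_above ((\<lambda>\<xi>. g (zero_ext D \<xi>) / H1_norm D \<xi>) ` ?S)"
  proof (rule bdd_aboveI2)
    fix \<xi> assume "\<xi> \<in> ?S"
    then have *: "g (zero_ext D \<xi>) \<le> M * H1_norm D \<xi>" using bdd by blast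
    show "g (zero_ext D \<xi>) / H1_norm D \<xi> \<le> M"
    proof (cases "H1_norm D \<xi> > 0")
      case True
      then show ?thesis using * by (simp add: divide_le_eq)
    next
      case False
      then have "H1_norm D \<xi> = 0" using L2_norm_le_H1_norm(1)[of D \<xi>] L2_norm_nonneg[of D \<xi>] by linarith
      then show ?thesis using bdd(2) by simp
    qed
  qed
  have S: "\<phi> \<in> ?S" "(\<lambda>x. - \<phi> x) \<in> ?S" using assms by auto
  then have "g (zero_ext D \<phi>) / H1_norm D \<phi> \<le> Hm1_norm D g"
    "g (zero_ext D (\<lambda>x. - \<phi> x)) / H1_norm D (\<lambda>x. - \<phi> x) \<le> Hm1_norm D g"
    unfolding Hm1_norm_def using cSUP_upper[OF S(1) b] cSUP_upper[OF S(2) b] by simp_all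
  then have "\<bar>g (zero_ext D \<phi>)\<bar> / H1_norm D \<phi> \<le> Hm1_norm D g"
    unfolding odd assms(4) by (auto simp: abs_if)
  then show 1: "\<bar>g (zero_ext D \<phi>)\<bar> \<le> Hm1_norm D g * H1_norm D \<phi>"
    using assms(1) by (simp add: divide_le_eq)
  show "0 \<le> Hm1_norm D g"
    using 1 assms(1) by (metis abs_ge_zero order_trans zero_le_mult_iff linorder_not_less)
qed

section \<open>The residual functional\<close>

text \<open>
  The constant \<open>M\<close> may depend on the data and the mesh; its existence alone makes the supremum in the
  dual norm a genuine least upper bound.
\<close>

lemma residual_bounded:
  assumes \<Omega>: "open \<Omega>" "bounded \<Omega>" and D: "open D" "D \<subseteq> \<Omega>"
    and f: "f \<in> L2 \<Omega>" and u: "u \<in> H1 \<Omega>"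
    and \<T>: "\<And>T. T \<in> \<T> \<Longrightarrow> T \<in> lmeasurable" and lh: "lh \<in> Wh \<T>"
  obtains M where "0 \<le> M" "\<And>\<xi>. \<xi> \<in> H10 D \<Longrightarrow>
    multiplier \<Omega> f u (zero_ext D \<xi>) - broken_inner \<T> lh (\<lambda>T. zero_ext D \<xi>) \<le> M * H1_norm D \<xi>"
proof -
  have meas: "D \<in> sets lebesgue" "\<Omega> \<in> sets lebesgue" using \<Omega> D by auto
  obtain c where c: "\<And>T x. T \<in> \<T> \<Longrightarrow> x \<in> T \<Longrightarrow> lh T x = c T"
    using lh unfolding Wh_def by (simp add: bchoice_iff) metis
  let ?M = "L2_norm \<Omega> f + L2_norm \<Omega> (wgrad \<Omega> u) + (\<Sum>T\<in>\<T>. L2_norm T (\<lambda>x. c T))"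
  have "multiplier \<Omega> f u (zero_ext D \<xi>) - broken_inner \<T> lh (\<lambda>T. zero_ext D \<xi>) \<le> ?M * H1_norm D \<xi>"
    if \<xi>: "\<xi> \<in> H10 D" for \<xi>
  proof -
    let ?v = "zero_ext D \<xi>"
    note v = zero_ext_H1[OF D(1) \<Omega> D(2) \<xi>]
    have \<xi>L2: "\<xi> \<in> L2 D" using \<xi> H1_L2 by (auto simp: H10_def)
    have z: "?v = (\<lambda>x. if x \<in> D then \<xi> x else 0)" by (auto simp: zero_ext_def)
    have vU: "?v \<in> L2 UNIV" "L2_norm UNIV ?v = L2_norm D \<xi>"
      unfolding z by (rule L2_zero_ext[OF \<xi>L2 _ meas(1)]; simp)+
    note H = L2_norm_le_H1_norm[of D \<xi>]
    have 1: "load \<Omega> f ?v \<le> L2_norm \<Omega> f * H1_norm D \<xi>"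
      using L2_mult_bound[OF f H1_L2(1)[OF v(1)], unfolded v(2)] mult_left_mono[OF H(1) L2_norm_nonneg[of \<Omega> f]]
      unfolding load_def by linarith
    have 2: "- a_form \<Omega> u ?v \<le> L2_norm \<Omega> (wgrad \<Omega> u) * H1_norm D \<xi>"
      using L2_inner_bound[OF H1_L2(2)[OF u] H1_L2(2)[OF v(1)], unfolded v(3)]
        mult_left_mono[OF H(2) L2_norm_nonneg[of \<Omega> "wgrad \<Omega> u"]]
      unfolding a_form_def by linarith
    have "- broken_inner \<T> lh (\<lambda>T. ?v) = (\<Sum>T\<in>\<T>. - (LINT x|lebesgue_on T. lh T x * ?v x))"
      by (simp add: broken_inner_def sum_negf)
    also have "\<dots> \<le> (\<Sum>T\<in>\<T>. L2_norm T (\<lambda>x. c T) * H1_norm D \<xi>)"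
    proof (rule sum_mono)
      fix T assume T: "T \<in> \<T>"
      have "(LINT x|lebesgue_on T. lh T x * ?v x) = (LINT x|lebesgue_on T. c T * ?v x)"
        by (intro Bochner_Integration.integral_cong) (auto simp: c[OF T])
      moreover have "?v \<in> L2 T" "L2_norm T ?v \<le> L2_norm D \<xi>"
        using L2_restrict[OF vU(1), of T] vU(2) \<T>[OF T] by auto
      ultimately show "- (LINT x|lebesgue_on T. lh T x * ?v x) \<le> L2_norm T (\<lambda>x. c T) * H1_norm D \<xi>"
        using L2_mult_bound[OF L2_const[OF \<T>[OF T]] \<open>?v \<in> L2 T\<close>, of "c T"]
          mult_left_mono[OF order_trans[OF \<open>L2_norm T ?v \<le> L2_norm D \<xi>\<close> H(1)] L2_norm_nonneg[of T "\<lambda>x. c T"]]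
        by linarith
    qed
    finally show ?thesis
      using 1 2 by (simp add: multiplier_def algebra_simps sum_distrib_left)
  qed
  moreover have "0 \<le> ?M" by (intro add_nonneg_nonneg sum_nonneg L2_norm_nonneg)
  ultimately show thesis using that by blast
qed

lemma integral_split_patch:
  fixes F :: "real^2 \<Rightarrow> real"
  assumes "integrable lebesgue F" "\<And>x. x \<notin> T1 \<union> T2 \<Longrightarrow> F x = 0"
    and "T1 \<in> sets lebesgue" "T2 \<in> sets lebesgue" "negligible (T1 \<inter> T2)"
  shows "(LINT x|lebesgue. F x) = (LINT x|lebesgue_on T1. F x) + (LINT x|lebesgue_on T2. F x)"
proof -
  have ind: "integrable lebesgue (\<lambda>x. indicator T x *\<^sub>R F x)"
    "(LINT x|lebesgue_on T. F x) = (LINT x|lebesgue. indicator T x *\<^sub>R F x)" if "T \<in> sets lebesgue" for T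
    using integrable_mult_indicator[OF that assms(1)] integral_restrict_space[of T lebesgue F] that by auto
  have "AE x in lebesgue. x \<notin> T1 \<inter> T2"
    using assms(5) negligible_iff_null_sets AE_not_in by blast
  then have "AE x in lebesgue. F x = indicator T1 x *\<^sub>R F x + indicator T2 x *\<^sub>R F x"
    by eventually_elim (use assms(2) in \<open>auto simp: indicator_def\<close>)
  then have "(LINT x|lebesgue. F x) = (LINT x|lebesgue. indicator T1 x *\<^sub>R F x + indicator T2 x *\<^sub>R F x)"
    using assms(1) ind assms(3,4) by (intro integral_cong_AE) auto
  also have "\<dots> = (LINT x|lebesgue. indicator T1 x *\<^sub>R F x) + (LINT x|lebesgue. indicator T2 x *\<^sub>R F x)"
    using ind assms(3,4) by (intro Bochner_Integration.integral_add) auto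
  finally show ?thesis using ind assms(3,4) by simp
qed


section \<open>Testing with the bump\<close>

text \<open>
  The flux of the gradient of the unit bump through the lower half-plane, a positive absolute
  constant.
\<close>

abbreviation bump_flux :: real where
  "bump_flux \<equiv> (LINT y|lebesgue. half_bump 0 1 (axis 2 1) y) $ 2"

lemma bump_gradient_integral:
  assumes "r > 0" "norm n = 1" "T \<in> sets lebesgue"
    and half: "\<And>x. x \<in> ball m r \<Longrightarrow> x \<in> T \<longleftrightarrow> n \<bullet> (x - m) \<le> 0"
  shows "(LINT x|lebesgue_on T. gradient (bump m r) x) = (bump_flux * r) *\<^sub>R n"
proof -
  have "(LINT x|lebesgue_on T. gradient (bump m r) x)
      = (LINT x|lebesgue. indicator T x *\<^sub>R gradient (bump m r) x)"
    using assms(3) by (intro integral_restrict_space) simp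
  also have "\<dots> = (LINT x|lebesgue. half_bump m r n x)"
  proof (rule Bochner_Integration.integral_cong[OF refl])
    fix x
    show "indicator T x *\<^sub>R gradient (bump m r) x = half_bump m r n x"
      using half[of x] bump_gradient_outside[OF assms(1), of x m]
      by (cases "x \<in> ball m r") (auto simp: half_bump_def indicator_def)
  qed
  finally show ?thesis using half_bump_integral[OF assms(1,2)] by simp
qed

lemma bump_H1_norm:
  assumes "open D" "bounded D" "0 < r" "cball m r \<subseteq> D"
  shows "0 < H1_norm D (bump m r)" "H1_norm D (bump m r) \<le> sqrt (pi * r\<^sup>2 + 16 * pi)"
    and "\<not> (AE x in lebesgue_on D. bump m r x = 0)"
proof -
  let ?\<phi> = "bump m r"
  have D: "D \<in> sets lebesgue" using assms(1) by simp
  have test: "?\<phi> \<in> test_functions D" by (rule bump_test_function[OF assms(3,4)])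
  note L2 = test_function_L2[OF test D]
  note wg = test_function_has_weak_gradient[OF test D]
  have zero: "?\<phi> x = 0" "gradient ?\<phi> x = 0" if "x \<notin> ball m r" for x
    using that bump_support[OF assms(3), of m] bump_gradient_outside[OF assms(3)] by blast+
  show nz: "\<not> (AE x in lebesgue_on D. ?\<phi> x = 0)"
  proof
    assume "AE x in lebesgue_on D. ?\<phi> x = 0"
    then have "AE x in lebesgue. x \<in> D \<longrightarrow> ?\<phi> x = 0"
      using AE_restrict_space_iff[of D lebesgue] D by simp
    then have "AE x in lebesgue. x \<notin> ball m r"
    proof eventually_elim
      case (elim x)
      then show ?case using bump_support[OF assms(3), of m] assms(4) ball_subset_cball by blast
    qed
    then have "ball m r \<in> null_sets lebesgue"
      using AE_iff_null_sets[of "ball m r" lebesgue] by (simp del: mem_ball)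
    then have "negligible (ball m r)" unfolding negligible_iff_null_sets .
    then show False using open_not_negligible[of "ball m r"] assms(3) by simp
  qed
  have "L2_norm D ?\<phi> \<noteq> 0"
  proof
    assume "L2_norm D ?\<phi> = 0"
    then have "(LINT x|lebesgue_on D. (norm (?\<phi> x))\<^sup>2) = 0"
      using L2_norm_square[of D ?\<phi>] by simp
    then have "AE x in lebesgue_on D. (norm (?\<phi> x))\<^sup>2 = 0"
      using integral_nonneg_eq_0_iff_AE[OF L2_square_integrable[OF L2(1)]] by simp
    then show False using nz by simp
  qed
  then show "0 < H1_norm D ?\<phi>"
    using L2_norm_nonneg[of D ?\<phi>] L2_norm_le_H1_norm(1)[of D ?\<phi>] by linarith
  have "norm (?\<phi> x) \<le> 1" for x using bump_bounds[of m r x] by simp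
  then have 1: "L2_norm D ?\<phi> \<le> 1 * r * sqrt pi"
    using assms(3) zero(1) by (intro L2_norm_bounded_support[OF L2(1) D]) auto
  have 2: "L2_norm D (gradient ?\<phi>) \<le> 4 / r * r * sqrt pi"
    using assms(3) zero(2) bump_gradient_bound[OF assms(3)]
    by (intro L2_norm_bounded_support[OF L2(2) D]) auto
  have "(L2_norm D ?\<phi>)\<^sup>2 + (L2_norm D (gradient ?\<phi>))\<^sup>2 \<le> (1 * r * sqrt pi)\<^sup>2 + (4 / r * r * sqrt pi)\<^sup>2"
    by (intro add_mono power_mono 1 2 L2_norm_nonneg)
  also have "\<dots> = pi * r\<^sup>2 + 16 * pi"
    using assms(3) by (simp add: power_mult_distrib)
  finally show "H1_norm D ?\<phi> \<le> sqrt (pi * r\<^sup>2 + 16 * pi)"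
    unfolding H1_norm_eq[OF assms(1,2) wg] by simp
qed

lemma uminus_bump:
  assumes "0 < r" "cball m r \<subseteq> D"
  shows "(\<lambda>x. - bump m r x) \<in> test_functions D" "gradient (\<lambda>x. - bump m r x) x = - gradient (bump m r) x"
proof -
  show "(\<lambda>x. - bump m r x) \<in> test_functions D"
  proof (rule test_functionsI[OF _ compact_cball assms(2)])
    show "(\<lambda>x. - bump m r x) \<in> smooth_alg"
      using smooth_alg.mult[OF smooth_alg.const[of "-1"] bump_smooth[of m r]] by simp
    show "- bump m r x = 0" if "x \<notin> cball m r" for x
      using bump_support[OF assms(1), of m] that ball_subset_cball by fastforce
  qed
  show "gradient (\<lambda>x. - bump m r x) x = - gradient (bump m r) x"
    using bump_C1[OF assms(1)] by (intro gradient_eqI GDERIV_minus GDERIV_gradient) (simp add: C1_def)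
qed

text \<open>
  The core estimate.  Let \<open>\<phi>\<close> be the bump of radius \<open>r\<close> about \<open>m\<close>.  Inserting the
  piecewise constants \<open>G1\<close> and \<open>G2\<close> into the residual splits it into an element residual tested with
  \<open>\<phi>\<close>, the error \<open>wgrad \<Omega> u - G\<close> tested with the gradient of \<open>\<phi>\<close>, and \<open>G\<close> tested with the gradient
  of \<open>\<phi>\<close>; the last is the jump times \<open>r\<close> times the flux constant.  The factors in the estimate are the
  norms of \<open>\<phi>\<close> and its gradient: \<open>\<phi>\<close> is bounded by one and its gradient by \<open>4 / r\<close>, on a disc of area
  \<open>\<pi> r\<^sup>2\<close>.
\<close>

lemma edge_jump_bound:
  fixes \<Omega> :: "(real^2) set" and G1 G2 :: "real^2"
  assumes \<Omega>: "open \<Omega>" "bounded \<Omega>" "convex \<Omega>" and mesh: "mesh_of \<Omega> \<T>"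
    and f: "f \<in> L2 \<Omega>" and u: "u \<in> H1 \<Omega>" and lh: "lh \<in> Wh \<T>"
    and T: "T1 \<in> \<T>" "T2 \<in> \<T>" "T1 \<noteq> T2" and n: "norm n = 1" and r: "0 < r" "r < \<rho>"
    and sides_all: "\<forall>x\<in>T1. n \<bullet> (x - m) \<le> 0" "\<forall>x\<in>T2. n \<bullet> (x - m) \<ge> 0"
    and halves_all: "\<forall>x\<in>ball m \<rho>. n \<bullet> (x - m) \<le> 0 \<longrightarrow> x \<in> T1"
      "\<forall>x\<in>ball m \<rho>. n \<bullet> (x - m) \<ge> 0 \<longrightarrow> x \<in> T2"
  defines "N \<equiv> Hm1_norm (interior (T1 \<union> T2)) (\<lambda>v. multiplier \<Omega> f u v - broken_inner \<T> lh (\<lambda>T. v))"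
  shows "0 \<le> N"
    and "bump_flux * r * \<bar>(G1 - G2) \<bullet> n\<bar> \<le> N * sqrt (pi * r\<^sup>2 + 16 * pi)
      + r * sqrt pi * (L2_norm T1 (\<lambda>x. f x - lh T1 x) + L2_norm T2 (\<lambda>x. f x - lh T2 x))
      + 4 * sqrt pi * (L2_norm T1 (\<lambda>x. wgrad \<Omega> u x - G1) + L2_norm T2 (\<lambda>x. wgrad \<Omega> u x - G2))"
proof -
  note sides = sides_all(1)[rule_format] sides_all(2)[rule_format]
    and halves = halves_all(1)[rule_format] halves_all(2)[rule_format]
  define D where "D = interior (T1 \<union> T2)"
  define g where "g v = multiplier \<Omega> f u v - broken_inner \<T> lh (\<lambda>T. v)" for v
  have N: "N = Hm1_norm D g" unfolding N_def D_def g_def ..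
  let ?\<phi> = "bump m r"
  have tri: "triangulation \<T>" "finite \<T>" and triangles: "\<And>T. T \<in> \<T> \<Longrightarrow> 2 simplex T"
    and cover: "\<Union>\<T> = closure \<Omega>"
    using mesh by (auto simp: mesh_of_def triangulation_def)
  have comp: "compact T" if "T \<in> \<T>" for T
    using simplex_polytope_convex_compact(3)[OF triangles[OF that]] .
  have lmeas: "T \<in> lmeasurable" if "T \<in> \<T>" for T
    using comp[OF that] by (rule lmeasurable_compact)
  then have meas: "T \<in> sets lebesgue" if "T \<in> \<T>" for T
    using that by auto
  have sub\<Omega>: "T \<subseteq> closure \<Omega>" if "T \<in> \<T>" for T using cover that by blast
  have ball_sub: "ball m \<rho> \<subseteq> T1 \<union> T2"
    using halves by (metis UnCI linear subsetI)
  then have "ball m \<rho> \<subseteq> D" unfolding D_def by (intro interior_maximal open_ball)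
  moreover have "cball m r \<subseteq> ball m \<rho>" using r by auto
  ultimately have cbD: "cball m r \<subseteq> D" by blast
  have "D \<subseteq> interior (closure \<Omega>)" unfolding D_def using T sub\<Omega> by (intro interior_mono) auto
  also have "\<dots> = \<Omega>" using convex_interior_closure[OF \<Omega>(3)] \<Omega>(1) by (simp add: interior_open)
  finally have D\<Omega>: "D \<subseteq> \<Omega>" .
  have D: "open D" "bounded D" using D\<Omega> \<Omega>(2) bounded_subset by (auto simp: D_def)
  have sets: "D \<in> sets lebesgue" "\<Omega> \<in> sets lebesgue" using D \<Omega> by auto
  have outside: "?\<phi> x = 0" "gradient ?\<phi> x = 0" if "x \<notin> ball m r" for x
    using that bump_support[OF r(1), of m] bump_gradient_outside[OF r(1)] by blast+
  have test: "?\<phi> \<in> test_functions D" "(\<lambda>x. - ?\<phi> x) \<in> test_functions D"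
    using bump_test_function[OF r(1) cbD] uminus_bump(1)[OF r(1) cbD] .
  have test\<Omega>: "\<phi> \<in> test_functions \<Omega>" if "\<phi> \<in> test_functions D" for \<phi>
    using that test_functions_mono[OF D\<Omega>] by blast

  have g_test: "g (zero_ext D \<phi>) = (LINT x|lebesgue_on \<Omega>. f x * \<phi> x)
      - (LINT x|lebesgue_on \<Omega>. wgrad \<Omega> u x \<bullet> gradient \<phi> x) - (\<Sum>T\<in>\<T>. LINT x|lebesgue_on T. lh T x * \<phi> x)"
    if \<phi>: "\<phi> \<in> test_functions D" for \<phi>
  proof -
    have z: "zero_ext D \<phi> = \<phi>"
      using test_function_outside[OF \<phi>] by (auto simp: zero_ext_def)
    note wg = test_function_has_weak_gradient[OF test\<Omega>[OF \<phi>] sets(2)]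
    have "(LINT x|lebesgue_on \<Omega>. wgrad \<Omega> u x \<bullet> wgrad \<Omega> \<phi> x) = (LINT x|lebesgue_on \<Omega>. wgrad \<Omega> u x \<bullet> gradient \<phi> x)"
    proof (rule integral_cong_AE)
      show "AE x in lebesgue_on \<Omega>. wgrad \<Omega> u x \<bullet> wgrad \<Omega> \<phi> x = wgrad \<Omega> u x \<bullet> gradient \<phi> x"
        using wgrad_AE_eq[OF \<Omega>(1,2) wg] by eventually_elim simp
    qed (use L2_inner_integrable[OF H1_L2(2)[OF u] H1_L2(2)[OF has_weak_gradient_H1[OF wg]]]
        L2_inner_integrable[OF H1_L2(2)[OF u] test_function_L2(2)[OF \<phi> sets(2)]] in \<open>auto dest: borel_measurable_integrable\<close>)
    then show ?thesis
      by (simp add: z g_def multiplier_def load_def a_form_def broken_inner_def)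
  qed
  have odd: "g (zero_ext D (\<lambda>x. - ?\<phi> x)) = - g (zero_ext D ?\<phi>)"
    unfolding g_test[OF test(1)] g_test[OF test(2)] uminus_bump(2)[OF r(1) cbD]
    by (simp add: sum_negf)
  obtain M where M: "0 \<le> M" "\<And>\<xi>. \<xi> \<in> H10 D \<Longrightarrow> g (zero_ext D \<xi>) \<le> M * H1_norm D \<xi>"
    using residual_bounded[OF \<Omega>(1,2) D(1) D\<Omega> f u lmeas lh] unfolding g_def by metis
  note Hb = bump_H1_norm[OF D r(1) cbD]
  have Hneg: "H1_norm D (\<lambda>x. - ?\<phi> x) = H1_norm D ?\<phi>"
    unfolding H1_norm_eq[OF D test_function_has_weak_gradient[OF test(1) sets(1)]]
      H1_norm_eq[OF D test_function_has_weak_gradient[OF test(2) sets(1)]]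
    by (simp add: L2_norm_def uminus_bump(2)[OF r(1) cbD])
  note dual = Hm1_norm_bound[OF Hb(1) test_function_H10[OF D test(1)] test_function_H10[OF D test(2)] Hneg Hb(3)
      odd M(2,1)]
  show "0 \<le> N" unfolding N by (rule dual(2))
  have dual': "\<bar>g (zero_ext D ?\<phi>)\<bar> \<le> N * sqrt (pi * r\<^sup>2 + 16 * pi)"
    using dual(1) mult_left_mono[OF Hb(2) dual(2)] unfolding N by linarith

  have L2T: "f \<in> L2 S" "wgrad \<Omega> u \<in> L2 S" "lh S \<in> L2 S" "?\<phi> \<in> L2 S" "gradient ?\<phi> \<in> L2 S"
    if S: "S \<in> \<T>" for S
  proof -
    show "f \<in> L2 S" "wgrad \<Omega> u \<in> L2 S"
      using L2_closure_subset[OF \<Omega>(1,3) _ sub\<Omega>[OF S] meas[OF S]] f H1_L2(2)[OF u] by auto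
    obtain c where "\<And>x. x \<in> S \<Longrightarrow> lh S x = c" using lh S by (auto simp: Wh_def)
    then have "AE x in lebesgue_on S. c = lh S x" by (intro AE_I2) simp
    then show "lh S \<in> L2 S" by (rule L2_cong_AE[OF L2_const[OF lmeas[OF S]] meas[OF S]])
    show "?\<phi> \<in> L2 S" "gradient ?\<phi> \<in> L2 S"
      using test_function_L2[OF test(1) meas[OF S]] by auto
  qed

  have ball_T: "ball m r \<subseteq> T1 \<union> T2" and ball_\<Omega>: "ball m r \<subseteq> \<Omega>"
    using cbD D\<Omega> ball_subset_cball[of m r] interior_subset[of "T1 \<union> T2"] unfolding D_def by blast+
  \<comment> \<open>The integrand vanishes off the disc, which T1 and T2 cover with a null overlap.\<close>
  have split: "(LINT x|lebesgue_on \<Omega>. F x) = (LINT x|lebesgue_on T1. F x) + (LINT x|lebesgue_on T2. F x)"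
    if F: "integrable (lebesgue_on \<Omega>) F" "\<And>x. x \<notin> ball m r \<Longrightarrow> F x = 0" for F :: "real^2 \<Rightarrow> real"
  proof -
    have "(if x \<in> \<Omega> then F x else 0) = F x" for x
      using F(2)[of x] ball_\<Omega> by (cases "x \<in> ball m r") (auto simp del: mem_ball)
    then have "(\<lambda>x. if x \<in> \<Omega> then F x else 0) = F" by (rule ext)
    then have intF: "integrable lebesgue F"
      using Lebesgue_Measure.integrable_restrict_UNIV[OF sets(2), of F] F(1) by simp
    have "(LINT x|lebesgue_on \<Omega>. F x) = (LINT x|lebesgue. F x)"
      using F(2) ball_\<Omega> by (intro integral_vanishing_outside[OF sets(2)]) blast
    also have "\<dots> = (LINT x|lebesgue_on T1. F x) + (LINT x|lebesgue_on T2. F x)"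
      using F(2) ball_T T meas distinct_simplices_overlap(2)[OF tri(1) T(1,2) triangles[OF T(1)] triangles[OF T(2)] T(3)]
      by (intro integral_split_patch[OF intF]) blast+
    finally show ?thesis .
  qed
  have s1: "(LINT x|lebesgue_on \<Omega>. f x * ?\<phi> x)
      = (LINT x|lebesgue_on T1. f x * ?\<phi> x) + (LINT x|lebesgue_on T2. f x * ?\<phi> x)"
    by (rule split[OF L2_mult_integrable[OF f test_function_L2(1)[OF test(1) sets(2)]]]) (simp add: outside)
  have s2: "(LINT x|lebesgue_on \<Omega>. wgrad \<Omega> u x \<bullet> gradient ?\<phi> x)
      = (LINT x|lebesgue_on T1. wgrad \<Omega> u x \<bullet> gradient ?\<phi> x) + (LINT x|lebesgue_on T2. wgrad \<Omega> u x \<bullet> gradient ?\<phi> x)"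
    by (rule split[OF L2_inner_integrable[OF H1_L2(2)[OF u] test_function_L2(2)[OF test(1) sets(2)]]]) (simp add: outside)
  have "(LINT x|lebesgue_on S. lh S x * ?\<phi> x) = 0" if S: "S \<in> \<T> - {T1, T2}" for S
  proof -
    have "negligible (S \<inter> T1)" "negligible (S \<inter> T2)"
      using S distinct_simplices_overlap(2)[OF tri(1) _ T(1) triangles triangles[OF T(1)], of S]
        distinct_simplices_overlap(2)[OF tri(1) _ T(2) triangles triangles[OF T(2)], of S] by auto
    then have "negligible (S \<inter> T1 \<union> S \<inter> T2)" by (rule negligible_Un)
    then have "AE x in lebesgue. x \<notin> S \<inter> T1 \<union> S \<inter> T2"
      using negligible_iff_null_sets AE_not_in by blast
    then have "AE x in lebesgue_on S. x \<notin> S \<inter> T1 \<union> S \<inter> T2"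
      using meas S by (subst AE_restrict_space_iff) auto
    then have "AE x in lebesgue_on S. lh S x * ?\<phi> x = 0"
      using AE_space
    proof eventually_elim
      case (elim x)
      then have "x \<notin> ball m r" using ball_T by auto
      then show ?case by (simp add: outside)
    qed
    then show ?thesis by (rule integral_eq_zero_AE)
  qed
  then have "(\<Sum>T\<in>\<T>. LINT x|lebesgue_on T. lh T x * ?\<phi> x) = (\<Sum>T\<in>{T1, T2}. LINT x|lebesgue_on T. lh T x * ?\<phi> x)"
    using tri(2) T by (intro sum.mono_neutral_right) auto
  then have s3: "(\<Sum>T\<in>\<T>. LINT x|lebesgue_on T. lh T x * ?\<phi> x)
      = (LINT x|lebesgue_on T1. lh T1 x * ?\<phi> x) + (LINT x|lebesgue_on T2. lh T2 x * ?\<phi> x)"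
    using T(3) by simp

  have R: "(LINT x|lebesgue_on S. f x * ?\<phi> x) - (LINT x|lebesgue_on S. lh S x * ?\<phi> x)
      = (LINT x|lebesgue_on S. (f x - lh S x) * ?\<phi> x)"
    if S: "S \<in> \<T>" for S
    unfolding left_diff_distrib
    by (intro Bochner_Integration.integral_diff[symmetric] L2_mult_integrable L2T[OF S])
  have E: "(LINT x|lebesgue_on S. wgrad \<Omega> u x \<bullet> gradient ?\<phi> x)
      = (LINT x|lebesgue_on S. (wgrad \<Omega> u x - G) \<bullet> gradient ?\<phi> x) + G \<bullet> (LINT x|lebesgue_on S. gradient ?\<phi> x)"
    if S: "S \<in> \<T>" for S G
  proof -
    have c: "(\<lambda>x. G) \<in> L2 S" by (rule L2_const[OF lmeas[OF S]])
    have "(LINT x|lebesgue_on S. (wgrad \<Omega> u x - G) \<bullet> gradient ?\<phi> x)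
        = (LINT x|lebesgue_on S. wgrad \<Omega> u x \<bullet> gradient ?\<phi> x) - (LINT x|lebesgue_on S. G \<bullet> gradient ?\<phi> x)"
      unfolding inner_diff_left
      by (intro Bochner_Integration.integral_diff L2_inner_integrable L2T[OF S] c)
    moreover have "(LINT x|lebesgue_on S. G \<bullet> gradient ?\<phi> x) = G \<bullet> (LINT x|lebesgue_on S. gradient ?\<phi> x)"
      using L2_integrable[OF L2T(5)[OF S] lmeas[OF S]] by (intro integral_inner_right) simp
    ultimately show ?thesis by simp
  qed
  have in\<rho>: "x \<in> ball m \<rho>" if "x \<in> ball m r" for x using that r by auto
  have I1: "(LINT x|lebesgue_on T1. gradient ?\<phi> x) = (bump_flux * r) *\<^sub>R n"
    using sides(1) halves(1) in\<rho> by (intro bump_gradient_integral[OF r(1) n meas[OF T(1)]]) blast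
  have I2: "(LINT x|lebesgue_on T2. gradient ?\<phi> x) = (bump_flux * r) *\<^sub>R (- n)"
    by (rule bump_gradient_integral[OF r(1) _ meas[OF T(2)]])
      (use n sides(2) halves(2) in\<rho> in auto)
  have jump: "G1 \<bullet> (LINT x|lebesgue_on T1. gradient ?\<phi> x) + G2 \<bullet> (LINT x|lebesgue_on T2. gradient ?\<phi> x)
      = bump_flux * r * ((G1 - G2) \<bullet> n)"
    unfolding I1 I2 by (simp add: inner_diff_left algebra_simps)
  let ?R = "\<lambda>S. LINT x|lebesgue_on S. (f x - lh S x) * ?\<phi> x"
  let ?E = "\<lambda>S G. LINT x|lebesgue_on S. (wgrad \<Omega> u x - G) \<bullet> gradient ?\<phi> x"
  have key: "bump_flux * r * ((G1 - G2) \<bullet> n)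
      = ?R T1 + ?R T2 - ?E T1 G1 - ?E T2 G2 - g (zero_ext D ?\<phi>)"
    unfolding g_test[OF test(1)] s1 s2 s3 using jump R[OF T(1)] R[OF T(2)] E[OF T(1), of G1] E[OF T(2), of G2]
    by linarith
  have bR: "\<bar>?R S\<bar> \<le> r * sqrt pi * L2_norm S (\<lambda>x. f x - lh S x)" if S: "S \<in> \<T>" for S
  proof -
    have "norm (?\<phi> x) \<le> 1" for x using bump_bounds[of m r x] by simp
    then have "L2_norm S ?\<phi> \<le> 1 * r * sqrt pi"
      using r(1) outside(1) by (intro L2_norm_bounded_support[OF L2T(4)[OF S] meas[OF S]]) auto
    from mult_left_mono[OF this L2_norm_nonneg[of S "\<lambda>x. f x - lh S x"]]
    show ?thesis
      using L2_mult_bound[OF L2_diff[OF L2T(1)[OF S] L2T(3)[OF S]] L2T(4)[OF S]] by (simp add: mult_ac)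
  qed
  have bE: "\<bar>?E S G\<bar> \<le> 4 * sqrt pi * L2_norm S (\<lambda>x. wgrad \<Omega> u x - G)" if S: "S \<in> \<T>" for S G
  proof -
    have "L2_norm S (gradient ?\<phi>) \<le> 4 / r * r * sqrt pi"
      using r(1) outside(2) bump_gradient_bound[OF r(1)]
      by (intro L2_norm_bounded_support[OF L2T(5)[OF S] meas[OF S]]) auto
    then have "L2_norm S (gradient ?\<phi>) \<le> 4 * sqrt pi" using r(1) by simp
    from mult_left_mono[OF this L2_norm_nonneg[of S "\<lambda>x. wgrad \<Omega> u x - G"]]
    show ?thesis
      using L2_inner_bound[OF L2_diff[OF L2T(2)[OF S] L2_const[OF lmeas[OF S]]] L2T(5)[OF S], of G]
      by (simp add: mult_ac)
  qed
  have "0 < bump_flux" by (rule half_bump_flux_pos)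
  then have "bump_flux * r * \<bar>(G1 - G2) \<bullet> n\<bar> = \<bar>bump_flux * r * ((G1 - G2) \<bullet> n)\<bar>"
    using r(1) by (simp add: abs_mult)
  also have "\<dots> \<le> \<bar>?R T1\<bar> + \<bar>?R T2\<bar> + \<bar>?E T1 G1\<bar> + \<bar>?E T2 G2\<bar> + \<bar>g (zero_ext D ?\<phi>)\<bar>"
    unfolding key by linarith
  also have "\<dots> \<le> N * sqrt (pi * r\<^sup>2 + 16 * pi)
      + r * sqrt pi * (L2_norm T1 (\<lambda>x. f x - lh T1 x) + L2_norm T2 (\<lambda>x. f x - lh T2 x))
      + 4 * sqrt pi * (L2_norm T1 (\<lambda>x. wgrad \<Omega> u x - G1) + L2_norm T2 (\<lambda>x. wgrad \<Omega> u x - G2))"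
    using dual' bR[OF T(1)] bR[OF T(2)] bE[OF T(1), of G1] bE[OF T(2), of G2]
    unfolding distrib_left by linarith
  finally show "bump_flux * r * \<bar>(G1 - G2) \<bullet> n\<bar> \<le> N * sqrt (pi * r\<^sup>2 + 16 * pi)
      + r * sqrt pi * (L2_norm T1 (\<lambda>x. f x - lh T1 x) + L2_norm T2 (\<lambda>x. f x - lh T2 x))
      + 4 * sqrt pi * (L2_norm T1 (\<lambda>x. wgrad \<Omega> u x - G1) + L2_norm T2 (\<lambda>x. wgrad \<Omega> u x - G2))" .
qed

theorem mainTheorem5:
  fixes \<Omega> :: "(real^2) set" and \<TT> :: "(real^2) set set set"
  assumes "convex_polygonal_domain \<Omega>"
    and "\<And>\<T>. \<T> \<in> \<TT> \<Longrightarrow> mesh_of \<Omega> \<T>"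
    and "shape_regular \<TT>"
  shows "\<exists>C>0. \<forall>f \<psi> u. \<forall>\<T>\<in>\<TT>. \<forall>uh lh.
    f \<in> L2 \<Omega> \<longrightarrow> \<psi> \<in> H2 \<Omega> \<longrightarrow> nonpos_on_boundary \<Omega> \<psi> \<longrightarrow>
    obstacle_solution \<Omega> f \<psi> u \<longrightarrow>
    discrete_solution \<T> f \<psi> uh \<longrightarrow>
    discrete_multiplier \<T> f uh lh \<longrightarrow>
    (\<forall>e\<in>interior_edges \<T>.
       sqrt (diameter e) * edge_L2_norm e (vjump \<T> e (discrete_wgrad \<T> uh))
       \<le> C * (broken_L2_norm (patch \<T> e) (\<lambda>T x. wgrad \<Omega> u x - discrete_wgrad \<T> uh T x)
            + diameter e * broken_L2_norm (patch \<T> e)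
                (\<lambda>T x. divergence (discrete_wgrad \<T> uh T) x + f x - lh T x)
            + Hm1_norm (interior (\<Union>(patch \<T> e)))
                (\<lambda>v. multiplier \<Omega> f u v - broken_inner \<T> lh (\<lambda>T. v))))"
proof -
  obtain \<sigma> where \<sigma>: "\<And>\<T> T. \<T> \<in> \<TT> \<Longrightarrow> T \<in> \<T> \<Longrightarrow> diameter T \<le> \<sigma> * inball_diameter T"
    using assms(3) unfolding shape_regular_def by blast
  have \<Omega>: "open \<Omega>" "convex \<Omega>" "polytope (closure \<Omega>)"
    using assms(1) by (auto simp: convex_polygonal_domain_def)
  have bcl: "bounded (closure \<Omega>)" using \<Omega>(3) polytope_imp_bounded by blast
  then have b\<Omega>: "bounded \<Omega>" using bounded_subset closure_subset by blast
  \<comment> \<open>Half-discs at edge midpoints of radius 1/q times the edge length lie in the adjacent triangles.\<close>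
  define q where "q = 2 + 3 * (4 * \<bar>\<sigma>\<bar> + 1)"
  have q: "q \<ge> 1" by (simp add: q_def)
  define d where "d = diameter (closure \<Omega>)"
  \<comment> \<open>The first summand bounds the H1 norm of the bump, as the radius is at most the diameter of the domain.\<close>
  define K where "K = sqrt (pi * d\<^sup>2 + 16 * pi) + 8 * sqrt pi"
  define C where "C = 2 * q / bump_flux * K"
  have \<kappa>: "bump_flux > 0" by (rule half_bump_flux_pos)
  have Kpos: "K > 0" unfolding K_def by (intro add_nonneg_pos) auto
  have Cpos: "C > 0" using \<kappa> Kpos q by (simp add: C_def)
  have "sqrt (diameter e) * edge_L2_norm e (vjump \<T> e (discrete_wgrad \<T> uh))
       \<le> C * (broken_L2_norm (patch \<T> e) (\<lambda>T x. wgrad \<Omega> u x - discrete_wgrad \<T> uh T x)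
            + diameter e * broken_L2_norm (patch \<T> e)
                (\<lambda>T x. divergence (discrete_wgrad \<T> uh T) x + f x - lh T x)
            + Hm1_norm (interior (\<Union>(patch \<T> e)))
                (\<lambda>v. multiplier \<Omega> f u v - broken_inner \<T> lh (\<lambda>T. v)))"
    (is "?lhs \<le> C * (?BE + diameter e * ?BR + ?N)")
    if \<T>: "\<T> \<in> \<TT>" and f: "f \<in> L2 \<Omega>" and u: "obstacle_solution \<Omega> f \<psi> u"
      and lh: "discrete_multiplier \<T> f uh lh" and e: "e \<in> interior_edges \<T>"
    for f \<psi> u \<T> uh lh e
  proof -
    have mesh: "mesh_of \<Omega> \<T>" by (rule assms(2)[OF \<T>])
    then have tri: "triangulation \<T>" and triangles: "\<And>T. T \<in> \<T> \<Longrightarrow> 2 simplex T" and cover: "\<Union>\<T> = closure \<Omega>"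
      by (auto simp: mesh_of_def)
    have uH1: "u \<in> H1 \<Omega>" using u by (auto simp: obstacle_solution_def obstacle_set_def H10_def)
    have lhW: "lh \<in> Wh \<T>" using lh by (simp add: discrete_multiplier_def)
    have shape: "diameter T \<le> \<sigma> * inball_diameter T" if "T \<in> \<T>" for T
      by (rule \<sigma>[OF \<T> that])
    obtain T1 T2 n m where geo: "T1 \<noteq> T2" "patch \<T> e = {T1, T2}" "norm n = 1"
      "outward_normal T1 e = n" "outward_normal T2 e = - n" "0 < diameter e"
      "\<forall>x\<in>T1. n \<bullet> (x - m) \<le> 0" "\<forall>x\<in>T2. n \<bullet> (x - m) \<ge> 0"
    "\<forall>x\<in>ball m (diameter e / q). n \<bullet> (x - m) \<le> 0 \<longrightarrow> x \<in> T1"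
    "\<forall>x\<in>ball m (diameter e / q). n \<bullet> (x - m) \<ge> 0 \<longrightarrow> x \<in> T2"
      by (rule interior_edge_geometry[OF tri triangles shape e q_def])
    define h where "h = diameter e"
    \<comment> \<open>Half of the radius available, so that the closed disc lies in the interior of the patch.\<close>
    define r where "r = h / (2 * q)"
    have h: "0 < h" using geo(6) by (simp add: h_def)
    have r: "0 < r" "r < h / q" "r \<le> h" using h q by (auto simp: r_def field_simps)
    have "T1 \<in> patch \<T> e" "T2 \<in> patch \<T> e" using geo(2) by auto
    then have T: "T1 \<in> \<T>" "T2 \<in> \<T>" "e edge_of T1" by (auto simp: patch_def)
    have "e \<subseteq> closure \<Omega>" using edge_of_imp_subset[OF T(3)] T(1) cover by blast
    then have "h \<le> d" unfolding h_def d_def by (rule diameter_subset[OF _ bcl])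
    then have rd: "r \<le> d" using r(3) by linarith
    define G where "G T = discrete_wgrad \<T> uh T 0" for T
    have G: "discrete_wgrad \<T> uh T = (\<lambda>x. G T)" for T
      by (simp add: G_def discrete_wgrad_def fun_eq_iff)
    define J where "J = (G T1 - G T2) \<bullet> n"
    have J: "vjump \<T> e (discrete_wgrad \<T> uh) = (\<lambda>x. J)"
      using geo(1) by (simp add: vjump_def fun_eq_iff geo(2,4,5) G J_def inner_diff_left)
    obtain a b where "e = closed_segment a b" by (rule edge_is_segment[OF triangles[OF T(1)] T(3)])
    then have "?lhs = sqrt h * sqrt (h * J\<^sup>2)"
      unfolding J edge_L2_norm_def by (simp add: edge_integral_const h_def)
    also have "\<dots> = h * \<bar>J\<bar>" using h by (simp add: real_sqrt_mult)
    finally have lhs: "?lhs = h * \<bar>J\<bar>" .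
    have U: "\<Union>(patch \<T> e) = T1 \<union> T2" using geo(2) by auto
    note prems = \<Omega>(1) b\<Omega> \<Omega>(2) mesh f uH1 lhW T(1,2) geo(1,3) r(1) r(2)[unfolded h_def] geo(7-10)
    note bound = edge_jump_bound(1)[OF prems, folded U]
      edge_jump_bound(2)[OF prems, of "G T1" "G T2", folded J_def U]
    have fin: "finite (patch \<T> e)" "T1 \<in> patch \<T> e" "T2 \<in> patch \<T> e" by (auto simp: geo(2))
    have BE: "L2_norm T1 (\<lambda>x. wgrad \<Omega> u x - G T1) \<le> ?BE" "L2_norm T2 (\<lambda>x. wgrad \<Omega> u x - G T2) \<le> ?BE"
      using L2_norm_le_broken[OF fin(1,2), of "\<lambda>T x. wgrad \<Omega> u x - discrete_wgrad \<T> uh T x"]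
        L2_norm_le_broken[OF fin(1,3), of "\<lambda>T x. wgrad \<Omega> u x - discrete_wgrad \<T> uh T x"] by (simp_all add: G)
    have BR: "L2_norm T1 (\<lambda>x. f x - lh T1 x) \<le> ?BR" "L2_norm T2 (\<lambda>x. f x - lh T2 x) \<le> ?BR"
      using L2_norm_le_broken[OF fin(1,2), of "\<lambda>T x. divergence (discrete_wgrad \<T> uh T) x + f x - lh T x"]
        L2_norm_le_broken[OF fin(1,3), of "\<lambda>T x. divergence (discrete_wgrad \<T> uh T) x + f x - lh T x"]
      by (simp_all add: G divergence_const)
    have pos: "0 \<le> ?BE" "0 \<le> ?BR"
      using BE(1) BR(1) L2_norm_nonneg order_trans by blast+
    have "bump_flux * r * \<bar>J\<bar> \<le> ?N * sqrt (pi * r\<^sup>2 + 16 * pi) + r * sqrt pi * (?BR + ?BR) + 4 * sqrt pi * (?BE + ?BE)"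
      by (rule order_trans[OF bound(2)])
        (intro add_mono mult_left_mono BR BE order_refl; use r(1) in simp)
    also have "\<dots> \<le> ?N * K + K * (h * ?BR) + K * ?BE"
    proof (intro add_mono)
      have "sqrt (pi * r\<^sup>2 + 16 * pi) \<le> sqrt (pi * d\<^sup>2 + 16 * pi)"
        using rd r(1) by (auto intro!: mult_left_mono power_mono)
      then have "sqrt (pi * r\<^sup>2 + 16 * pi) \<le> K" by (simp add: K_def add_increasing2)
      then show "?N * sqrt (pi * r\<^sup>2 + 16 * pi) \<le> ?N * K" using bound(1) by (rule mult_left_mono)
      have s: "8 * sqrt pi \<le> K" by (simp add: K_def)
      have "r * sqrt pi * (?BR + ?BR) = (2 * sqrt pi) * (r * ?BR)" by (simp add: algebra_simps)
      also have "\<dots> \<le> K * (h * ?BR)"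
        using s r h pos Kpos by (intro mult_mono mult_right_mono) (auto intro: order_trans[OF _ s])
      finally show "r * sqrt pi * (?BR + ?BR) \<le> K * (h * ?BR)" .
      have "4 * sqrt pi * (?BE + ?BE) = (8 * sqrt pi) * ?BE" by (simp add: algebra_simps)
      also have "\<dots> \<le> K * ?BE" by (rule mult_right_mono[OF s pos(1)])
      finally show "4 * sqrt pi * (?BE + ?BE) \<le> K * ?BE" .
    qed
    finally have main: "bump_flux * r * \<bar>J\<bar> \<le> K * (?BE + h * ?BR + ?N)" by (simp add: algebra_simps)
    have "h * \<bar>J\<bar> = 2 * q / bump_flux * (bump_flux * r * \<bar>J\<bar>)"
      using \<kappa> q by (simp add: r_def)
    also have "\<dots> \<le> 2 * q / bump_flux * (K * (?BE + h * ?BR + ?N))"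
      using \<kappa> q by (intro mult_left_mono main) auto
    finally show ?thesis unfolding lhs by (simp add: C_def h_def mult.assoc)
  qed
  then show ?thesis using Cpos by (intro exI[of _ C]) blast
qed

end
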